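(* For every $\mathfrak u\in\langle\Gamma\rangle$, $(\mathrm{id}\otimes\Delta)\Delta(\mathfrak u)=(\Delta\otimes\mathrm{id})\Delta(\mathfrak u)$.
   Context: Let $q$ be a prime power. Let $\Gamma=\{x_{n,\varepsilon}\}_{n\in\mathbb N,\varepsilon\in\mathbb F_q^*}$ with weights $w(x_{n,\varepsilon})=n$, $\langle\Gamma\rangle$ the set of words over $\Gamma$ (empty word $1$, juxtaposition = concatenation, depth = number of letters, weight = sum of letter weights), $\mathfrak D$ the $\mathbb F_q$-vector space with basis $\langle\Gamma\rangle$; write $x_n:=x_{n,1}$. For positive integers $r,s,j$ put $\Delta^j_{r,s}=(-1)^{r-1}\binom{j-1}{r-1}+(-1)^{s-1}\binom{j-1}{s-1}$ if $(q-1)\mid j$ and $0$ otherwise. The bilinear products $\diamond,\sqcup\!\sqcup$ on $\mathfrak D$ are defined recursively by $1\diamond\mathfrak a=\mathfrak a\diamond1=\mathfrak a$, $1\sqcup\!\sqcup\mathfrak a=\mathfrak a\sqcup\!\sqcup1=\mathfrak a$ and, for nonempty $\mathfrak a=x_{a,\alpha}\mathfrak a_-$, $\mathfrak b=x_{b,\beta}\mathfrak b_-$: $\mathfrak a\diamond\mathfrak b=x_{a+b,\alpha\beta}(\mathfrak a_-\sqcup\!\sqcup\mathfrak b_-)+\sum_{i+j=a+b}\Delta^j_{a,b}x_{i,\alpha\beta}(x_j\sqcup\!\sqcup(\mathfrak a_-\sqcup\!\sqcup\mathfrak b_-))$, $\mathfrak a\sqcup\!\sqcup\mathfrak b=x_{a,\alpha}(\mathfrak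 a_-\sqcup\!\sqcup\mathfrak b)+x_{b,\beta}(\mathfrak a\sqcup\!\sqcup\mathfrak b_-)+\mathfrak a\diamond\mathfrak b$. For a word $\mathfrak a=x_{i_1}\cdots x_{i_m}$ with all characters $1$ put $[\mathfrak a]=(-1)^m\Delta^{i_1}_{1,w(\mathfrak a)+1}\cdots\Delta^{i_m}_{1,w(\mathfrak a)+1}x_{i_1}\sqcup\!\sqcup\cdots\sqcup\!\sqcup x_{i_m}$, $[1]=1$. The coproduct $\Delta:\mathfrak D\to\mathfrak D\otimes\mathfrak D$ is linear with $\Delta(1)=1\otimes1$, $\Delta(x_{n,\varepsilon})=1\otimes x_{n,\varepsilon}+\sum_{r\ge1,\ r+w(\mathfrak a)=n}\binom{r+\mathrm{depth}(\mathfrak a)-2}{\mathrm{depth}(\mathfrak a)}x_{r,\varepsilon}\otimes[\mathfrak a]$ (sum over words $\mathfrak a$ with all characters $1$), and for $\mathfrak u=x_{u,\varepsilon}\mathfrak v$ of depth $\ge2$, writing $\Delta(x_{u,\varepsilon})=1\otimes x_{u,\varepsilon}+\sum a\otimes b$ and $\Delta(\mathfrak v)=\sum a_{\mathfrak v}\otimes b_{\mathfrak v}$, $\Delta(\mathfrak u)=1\otimes\mathfrak u+\sum(a\,a_{\mathfrak v})\otimes(b\sqcup\!\sqcup b_{\mathfrak v})$. On $\mathfrak D\otimes\mathfrak D$, $(a\otimes b)\sqcup\!\sqcup(c\otimes d)=(a\sqcup\!\sqcup c)\otimes(b\sqcup\!\sqcup d)$. *)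

theory Defs
  imports Main "HOL-Library.Cardinality"
begin

text \<open>
  The finite field F_q is modelled as an arbitrary finite field type 'k (q = CARD('k)).
  A letter x_{n,eps} is the pair (n, eps); a word is a list of letters (head = first letter).
  Elements of the vector space D (basis: words) are represented as functions
  word => 'k (coefficients); all elements constructed below are finitely supported.
  D (x) D has basis pairs of words, D (x) D (x) D basis triples of words.
\<close>

type_synonym 'k letter = "nat \<times> 'k"
type_synonym 'k word = "'k letter list"
type_synonym 'k vec = "'k word \<Rightarrow> 'k"
type_synonym 'k vec2 = "'k word \<times> 'k word \<Rightarrow> 'k"
type_synonym 'k vec3 = "'k word \<times> 'k word \<times> 'k word \<Rightarrow> 'k"

definition supp :: "('a \<Rightarrow> 'k::zero) \<Rightarrow> 'a set" where
  "supp v = {w. v w \<noteq> 0}"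

definition basis :: "'a \<Rightarrow> ('a \<Rightarrow> 'k::{zero,one})" where
  "basis u = (\<lambda>w. if w = u then 1 else 0)"

definition prepend :: "'k letter \<Rightarrow> ('k::zero) vec \<Rightarrow> 'k vec" where
  "prepend x v = (\<lambda>w. case w of [] \<Rightarrow> 0 | y # w' \<Rightarrow> (if y = x then v w' else 0))"

definition lin :: "('k word \<Rightarrow> ('k::comm_ring_1) vec) \<Rightarrow> 'k vec \<Rightarrow> 'k vec" where
  "lin f v = (\<lambda>w. \<Sum>u\<in>supp v. v u * f u w)"

definition Dco :: "nat \<Rightarrow> nat \<Rightarrow> nat \<Rightarrow> 'k::{field,finite}" where
  "Dco r s j = (if (CARD('k) - 1) dvd j
      then of_int ((-1)^(r-1) * int ((j-1) choose (r-1)) + (-1)^(s-1) * int ((j-1) choose (s-1)))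
      else 0)"

definition dstep :: "('k word \<Rightarrow> 'k word \<Rightarrow> 'k vec) \<Rightarrow> 'k letter \<Rightarrow> 'k word \<Rightarrow> 'k letter \<Rightarrow> 'k word
    \<Rightarrow> ('k::{field,finite}) vec" where
  "dstep f x a y b =
     (\<lambda>w. prepend (fst x + fst y, snd x * snd y) (f a b) w
        + (\<Sum>j\<in>{1..<fst x + fst y}. Dco (fst x) (fst y) j *
             prepend (fst x + fst y - j, snd x * snd y) (lin (\<lambda>u. f [(j, 1)] u) (f a b)) w))"

text \<open>The shuffle product on words, defined by recursion on a fuel parameter;
  shf n a b is the shuffle product of a and b whenever n \<ge> length a + length b.\<close>
primrec shf :: "nat \<Rightarrow> 'k word \<Rightarrow> 'k word \<Rightarrow> ('k::{field,finite}) vec" where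
  "shf 0 = (\<lambda>a b. if a = [] then basis b else if b = [] then basis a else (\<lambda>_. 0))"
| "shf (Suc n) = (\<lambda>a b. case a of [] \<Rightarrow> basis b | x # a' \<Rightarrow>
      (case b of [] \<Rightarrow> basis a | y # b' \<Rightarrow>
        (\<lambda>w. prepend x (shf n a' b) w + prepend y (shf n a b') w + dstep (shf n) x a' y b' w)))"

definition shw :: "'k word \<Rightarrow> 'k word \<Rightarrow> ('k::{field,finite}) vec" where
  "shw a b = shf (length a + length b) a b"

definition diaw :: "'k word \<Rightarrow> 'k word \<Rightarrow> ('k::{field,finite}) vec" where
  "diaw a b = (case a of [] \<Rightarrow> basis b | x # a' \<Rightarrow>
      (case b of [] \<Rightarrow> basis a | y # b' \<Rightarrow> dstep (shf (length a + length b)) x a' y b'))"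

definition shuffle :: "('k::{field,finite}) vec \<Rightarrow> 'k vec \<Rightarrow> 'k vec" where
  "shuffle v1 v2 = (\<lambda>w. \<Sum>u1\<in>supp v1. \<Sum>u2\<in>supp v2. v1 u1 * v2 u2 * shw u1 u2 w)"

definition weight :: "'k word \<Rightarrow> nat" where
  "weight a = (\<Sum>x\<leftarrow>a. fst x)"

definition depth :: "'k word \<Rightarrow> nat" where
  "depth a = length a"

definition valid_word :: "('k::zero) word \<Rightarrow> bool" where
  "valid_word a \<longleftrightarrow> (\<forall>x\<in>set a. 1 \<le> fst x \<and> snd x \<noteq> 0)"

definition char1_word :: "('k::one) word \<Rightarrow> bool" where
  "char1_word a \<longleftrightarrow> (\<forall>x\<in>set a. 1 \<le> fst x \<and> snd x = 1)"

definition bracket :: "'k word \<Rightarrow> ('k::{field,finite}) vec" where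
  "bracket a = (\<lambda>w. (-1)^length a * (\<Prod>x\<leftarrow>a. Dco 1 (weight a + 1) (fst x)) *
       foldr (\<lambda>x v. shuffle (basis [(fst x, 1)]) v) a (basis []) w)"

text \<open>Delta(x_{n,eps}) - 1 (x) x_{n,eps}.\<close>
definition cop_rest :: "'k letter \<Rightarrow> ('k::{field,finite}) vec2" where
  "cop_rest x = (\<lambda>(p, q). \<Sum>r\<in>{1..fst x}. \<Sum>a\<in>{a. char1_word a \<and> r + weight a = fst x}.
       of_nat ((r + depth a - 2) choose depth a) * basis [(r, snd x)] p * bracket a q)"

definition combine :: "('k::{field,finite}) vec2 \<Rightarrow> 'k vec2 \<Rightarrow> 'k vec2" where
  "combine T1 T2 = (\<lambda>(p, q). \<Sum>ab\<in>supp T1. \<Sum>cd\<in>supp T2.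
       T1 ab * T2 cd * (if p = fst ab @ fst cd then shw (snd ab) (snd cd) q else 0))"

fun coprod :: "'k word \<Rightarrow> ('k::{field,finite}) vec2" where
  "coprod [] = basis ([], [])"
| "coprod [x] = (\<lambda>pq. basis ([], [x]) pq + cop_rest x pq)"
| "coprod (x # y # v) = (\<lambda>pq. basis ([], x # y # v) pq + combine (cop_rest x) (coprod (y # v)) pq)"

definition id_cop :: "('k::{field,finite}) vec2 \<Rightarrow> 'k vec3" where
  "id_cop T = (\<lambda>(a, c, d). \<Sum>ab\<in>supp T. T ab * (if fst ab = a then coprod (snd ab) (c, d) else 0))"

definition cop_id :: "('k::{field,finite}) vec2 \<Rightarrow> 'k vec3" where
  "cop_id T = (\<lambda>(c, d, b). \<Sum>ab\<in>supp T. T ab * (if snd ab = b then coprod (fst ab) (c, d) else 0))"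

end

theory Submission
  imports Defs "HOL-Computational_Algebra.Formal_Laurent_Series"
begin

text \<open>
  Evaluate the generating series \<open>x(z) = \<Sum>\<^sub>n x\<^sub>n z\<^sup>n\<^sup>-\<^sup>1\<close> of the letters at points \<open>z\<close> of an algebra over \<open>F\<^sub>q\<close>,
  as infinite linear combinations of words. With \<open>G(t) = 1/t + \<Sum> x\<^sub>k t\<^sup>k\<^sup>-\<^sup>1\<close>, summed over the multiples
  \<open>k\<close> of \<open>q - 1\<close>, partial fractions turn the diamond product into
  \<open>x(z)\<aa> \<diamond> x(w)\<bb> = (x(z) - x(w)) (G(z - w) * \<aa> * \<bb>)\<close>, where \<open>*\<close> is the shuffle product.
  From this one computes \<open>G(a) * G(b)\<close> and finds that \<open>E = 1/G\<close> is additive, which is exactly what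
  associativity of the shuffle product requires.

  The coproduct is \<open>\<Delta>(x(z)\<aa>) = 1 \<otimes> x(z)\<aa> + x(E(z)) \<Delta>(\<aa>)\<close>: the letters of the left factor are evaluated
  at the point \<open>E(z)\<close> of the right factor. Hence \<open>\<Delta>(G(t)) = G(E(t))\<close>, and since \<open>E(z) - E(w) = E(z - w)\<close>
  the product formula at the points \<open>E(z), E(w)\<close> shows that \<open>\<Delta>\<close> is multiplicative. Coassociativity
  then reduces to \<open>\<Delta>(E(z)) = E(E(z))\<close>. Identities between words are recovered from identities
  between series because the latter hold at infinitely many points.
\<close>

text \<open>The structure constants of the coproduct are powers of \<open>E\<close> in disguise. In
  \<open>[a]\<close> the second binomial of each factor vanishes, because a letter of
  \<open>a\<close> weighs at most as much as \<open>a\<close>; the indicator of \<open>q - 1\<close>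
  dividing the weight of the letter remains. Let \<open>Y\<close> be minus the sum of the letters
  \<open>x_k\<close> with \<open>q - 1\<close> dividing \<open>k\<close>. Then the brackets of all
  words of depth \<open>m\<close> add up to \<open>Y^m\<close>, and the binomials are the
  coefficients of \<open>(1 - Y)^(-(r-1))\<close>. Since \<open>1 - Y\<close> is
  \<open>t G(t)\<close> at \<open>t = 1\<close> and the weight restores \<open>t\<close>, the letter
  \<open>x_r\<close> on the left is accompanied by \<open>E^(r-1)\<close>.

  The point \<open>E(z)\<close> is itself a series, so the product has to be studied over
  coefficient rings that may again consist of series. Such a ring need not be a field and
  \<open>G\<close> has a pole at 0, whence the care with units and generic points. Exceptional
  points do no harm: every coefficient of either side involves finitely many coefficients of the
  arguments and is polynomial in the points.\<close>

context comm_ring_1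
begin

text \<open>Stated ahead of the class \<open>fq_algebra\<close>, whose axioms refer to it. Inverses
  are given by their equation in the ambient ring, which has no division; nonzero elements of such a
  set are units there.\<close>

definition subfield_set :: "'a set \<Rightarrow> bool" where
  "subfield_set S \<longleftrightarrow> 1 \<in> S \<and> (\<forall>x\<in>S. \<forall>y\<in>S. x - y \<in> S \<and> x * y \<in> S)
     \<and> (\<forall>x\<in>S. x \<noteq> 0 \<longrightarrow> (\<exists>y\<in>S. x * y = 1))"

end

text \<open>\<open>Lf\<close> supplies infinitely many evaluation points with invertible differences.\<close>
class fq_algebra = comm_ring_1 +
  fixes Fq :: "'a set" and Lf :: "'a set"
  assumes finite_Fq: "finite Fq"
    and infinite_Lf: "infinite Lf"
    and Fq_subset_Lf: "Fq \<subseteq> Lf"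
    and subfield_Fq: "subfield_set Fq"
    and subfield_Lf: "subfield_set Lf"

lemma subfield_setD:
  fixes S :: "'a::comm_ring_1 set"
  assumes "subfield_set S"
  shows "1 \<in> S" "0 \<in> S" "x \<in> S \<Longrightarrow> y \<in> S \<Longrightarrow> x - y \<in> S" "x \<in> S \<Longrightarrow> y \<in> S \<Longrightarrow> x * y \<in> S"
    "x \<in> S \<Longrightarrow> - x \<in> S" "x \<in> S \<Longrightarrow> y \<in> S \<Longrightarrow> x + y \<in> S"
proof -
  note a = assms[unfolded subfield_set_def]
  show 1: "1 \<in> S" and 3: "\<And>x y. x \<in> S \<Longrightarrow> y \<in> S \<Longrightarrow> x - y \<in> S"
    and "x \<in> S \<Longrightarrow> y \<in> S \<Longrightarrow> x * y \<in> S" using a by auto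
  from 3[OF 1 1] show 0: "0 \<in> S" by simp
  from 3[OF 0] show 5: "x \<in> S \<Longrightarrow> - x \<in> S" for x by (metis diff_0)
  from 3[OF _ 5] show "x \<in> S \<Longrightarrow> y \<in> S \<Longrightarrow> x + y \<in> S" by (metis diff_minus_eq_add)
qed

section \<open>Units, and polynomials with infinitely many roots\<close>

definition uinv :: "'a::comm_monoid_mult \<Rightarrow> 'a" where
  "uinv x = (SOME y. x * y = 1)"

lemma uinv_right: "x dvd 1 \<Longrightarrow> x * uinv x = 1"
  unfolding uinv_def dvd_def by (metis (mono_tags, lifting) someI_ex)

lemma uinv_eqI: "x * y = 1 \<Longrightarrow> uinv x = y"
  by (metis dvd_triv_left mult.commute mult.left_commute mult_1 uinv_right)

lemma subfield_set_unit:
  assumes "subfield_set S" "x \<in> S" "x \<noteq> 0"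
  shows "x dvd (1::'a::comm_ring_1)" "uinv x \<in> S"
proof -
  obtain y where y: "y \<in> S" "x * y = 1" using assms unfolding subfield_set_def by blast
  then show "x dvd 1" by (metis dvd_triv_left)
  show "uinv x \<in> S" using y uinv_eqI by metis
qed

lemmas Fq_closed = subfield_setD[OF subfield_Fq]
lemmas Lf_closed = subfield_setD[OF subfield_Lf]
lemmas Fq_unit = subfield_set_unit[OF subfield_Fq]
lemmas Lf_unit = subfield_set_unit[OF subfield_Lf]

lemma poly_eq_0_infinite_roots:
  fixes p :: "'a::fq_algebra poly"
  assumes "infinite S" "S \<subseteq> Lf" "\<And>z. z \<in> S \<Longrightarrow> poly p z = 0"
  shows "p = 0"
  using assms
proof (induction "degree p" arbitrary: p S)
  case 0
  then obtain a where "p = [:a:]" by (metis degree_eq_zeroE)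
  moreover obtain z where "z \<in> S" using 0 by fastforce
  ultimately show ?case using 0 by force
next
  case (Suc n)
  obtain z0 where z0: "z0 \<in> S" using Suc.prems(1) by fastforce
  obtain q where q: "p = [:-z0, 1:] * q" using Suc.prems(3)[OF z0] by (metis dvdE poly_eq_0_iff_dvd)
  have "q \<noteq> 0" using Suc.hyps(2) q by auto
  have p: "p = pCons 0 q - smult z0 q" by (simp add: q)
  \<comment> \<open>The linear factor is monic, so the leading coefficient of \<open>q\<close>
    survives in \<open>p\<close> and the degree drops by exactly one, even in the presence of zero
    divisors.\<close>
  have "coeff p (Suc (degree q)) = coeff q (degree q)"
    by (simp add: p coeff_eq_0)
  then have "coeff p (Suc (degree q)) \<noteq> 0" using \<open>q \<noteq> 0\<close> by simp
  then have "Suc (degree q) \<le> degree p" by (rule le_degree)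
  moreover have "degree p \<le> Suc (degree q)"
    unfolding p by (intro degree_diff_le degree_pCons_le) (meson degree_smult_le le_SucI)
  ultimately have dq: "n = degree q" using Suc.hyps(2) by simp
  have "q = 0"
  proof (rule Suc.hyps(1)[OF dq])
    show "infinite (S - {z0})" "S - {z0} \<subseteq> Lf" using Suc.prems by auto
    fix z assume z: "z \<in> S - {z0}"
    then have "z - z0 \<in> Lf" "z - z0 \<noteq> 0" using z0 Suc.prems(2) Lf_closed(3) by auto
    then obtain y where "(z - z0) * y = 1" using Lf_unit(1) by (metis dvdE)
    moreover have "(z - z0) * poly q z = poly p z" unfolding q by (simp add: algebra_simps)
    then have "(z - z0) * poly q z = 0" using Suc.prems(3)[of z] z by simp
    ultimately show "poly q z = 0"
      by (metis mult.assoc mult.commute mult.right_neutral mult_zero_left)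
  qed
  with \<open>q \<noteq> 0\<close> show ?case by simp
qed

lemma power_sum_coeffs_eq_0:
  fixes c :: "nat \<Rightarrow> 'a::fq_algebra"
  assumes "infinite S" "S \<subseteq> Lf" "\<And>z. z \<in> S \<Longrightarrow> (\<Sum>n\<le>N. z ^ n * c n) = 0" "n \<le> N"
  shows "c n = 0"
proof -
  have "(\<Sum>n\<le>N. monom (c n) n) = 0"
    by (rule poly_eq_0_infinite_roots[OF assms(1,2)])
      (use assms(3) in \<open>simp add: poly_sum poly_monom mult.commute\<close>)
  then have "coeff (\<Sum>n\<le>N. monom (c n) n) n = 0" by simp
  then show ?thesis using assms(4) by (simp add: coeff_sum coeff_monom)
qed

text \<open>The letters of a series are indexed from \<open>0\<close>, index \<open>n\<close> having weight \<open>n + 1\<close>, so that every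
  word is admissible.\<close>
definition wt :: "(nat \<times> 'c) list \<Rightarrow> nat" where
  "wt s = (\<Sum>x\<leftarrow>s. Suc (fst x))"

lemma wt_simps [simp]: "wt [] = 0" "wt (x # s) = Suc (fst x) + wt s" "wt (s @ t) = wt s + wt t"
  by (simp_all add: wt_def)

lemma length_le_wt: "length s \<le> wt s"
  by (induction s) auto

lemma finite_wt_le: "finite {s :: (nat \<times> 'c::finite) list. wt s \<le> N}"
proof (rule finite_subset)
  have "set s \<subseteq> {..N} \<times> UNIV" if "wt s \<le> N" for s :: "(nat \<times> 'c) list"
    using that by (induction s) auto
  then show "{s :: (nat \<times> 'c) list. wt s \<le> N} \<subseteq> {s. set s \<subseteq> {..N} \<times> UNIV \<and> length s \<le> N}"
    using length_le_wt order_trans by blast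
  show "finite {s :: (nat \<times> 'c::finite) list. set s \<subseteq> {..N} \<times> UNIV \<and> length s \<le> N}"
    by (rule finite_lists_length_le) simp
qed

text \<open>The power sums \<open>- (\<Sum>\<lambda>\<in>F\<^sub>q\<^sup>*. \<lambda>\<^sup>j)\<close> are the indicator of \<open>(q - 1) dvd j\<close>; taking them as
  the structure constants is what makes the product visible on generating series.\<close>
definition hc :: "nat \<Rightarrow> 'r::fq_algebra" where
  "hc j = - (\<Sum>l\<in>Fq - {0}. l ^ Suc j)"

definition dcf :: "nat \<Rightarrow> nat \<Rightarrow> nat \<Rightarrow> 'r::fq_algebra" where
  "dcf a b j = hc j * ((-1) ^ a * of_nat (j choose a) + (-1) ^ b * of_nat (j choose b))"

lemma dcf_commute: "dcf a b j = dcf b a j"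
  by (simp add: dcf_def add.commute)

text \<open>Recursion on the word whose coefficient is read, so that infinite series can be multiplied.
  The guard \<open>wt s + j < wt t\<close> only serves termination: the letter in front makes the remaining
  coefficients irrelevant.\<close>
function smul :: "((nat \<times> 'c::{finite,comm_monoid_mult}) list \<Rightarrow> 'r::fq_algebra) \<Rightarrow>
    ((nat \<times> 'c) list \<Rightarrow> 'r) \<Rightarrow> (nat \<times> 'c) list \<Rightarrow> 'r" where
  "smul f g [] = f [] * g []"
| "smul f g ((i, c) # t) =
     smul (\<lambda>s. f ((i, c) # s)) g t + smul f (\<lambda>s. g ((i, c) # s)) t
     + (\<Sum>a\<in>UNIV. \<Sum>b\<in>UNIV. if a * b = c then
          (\<Sum>n<i. smul (\<lambda>s. f ((n, a) # s)) (\<lambda>s. g ((i - Suc n, b) # s)) t)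
          + (\<Sum>j<wt t. \<Sum>n\<le>i+j. dcf n (i + j - n) j *
               smul (\<lambda>s. if s = [(j, 1)] then 1 else 0)
                    (\<lambda>s. if wt s + j < wt t
                          then smul (\<lambda>s. f ((n, a) # s)) (\<lambda>s. g ((i + j - n, b) # s)) s else 0) t)
        else 0)"
  by pat_completeness auto
termination by (relation "measure (\<lambda>(f, g, s). wt s)") auto

declare smul.simps [simp del]

lemma wt_induct [case_names less]:
  assumes "\<And>s. (\<And>t. wt t < wt s \<Longrightarrow> P t) \<Longrightarrow> P s"
  shows "P s"
  using assms by (rule measure_induct_rule[of wt])

text \<open>In the last summand the guard gives \<open>wt s + j < wt t\<close>, so
  \<open>(n, a) # s\<close> and \<open>(i + j - n, b) # s\<close> are no heavier than the word
  \<open>(i, c) # t\<close> whose coefficient is read.\<close>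

lemma smul_cong:
  fixes f g :: "(nat \<times> 'c::{finite,comm_monoid_mult}) list \<Rightarrow> 'r::fq_algebra"
  assumes "\<And>s'. wt s' \<le> wt s \<Longrightarrow> f s' = f' s'" "\<And>s'. wt s' \<le> wt s \<Longrightarrow> g s' = g' s'"
  shows "smul f g s = smul f' g' s"
  using assms
proof (induction s arbitrary: f g f' g' rule: wt_induct)
  case (less s)
  show ?case
  proof (cases s)
    case Nil
    then show ?thesis using less.prems by (simp add: smul.simps)
  next
    case (Cons x t)
    obtain i c where x: "x = (i, c)" by force
    note p = less.prems[unfolded Cons x wt_simps fst_conv]
    have 1: "smul (\<lambda>s. f ((i, c) # s)) g t = smul (\<lambda>s. f' ((i, c) # s)) g' t"
      "smul f (\<lambda>s. g ((i, c) # s)) t = smul f' (\<lambda>s. g' ((i, c) # s)) t"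
      by (rule less.IH; use p in \<open>simp add: Cons x\<close>)+
    have 2: "smul (\<lambda>s. f ((n, a) # s)) (\<lambda>s. g ((m, b) # s)) s
        = smul (\<lambda>s. f' ((n, a) # s)) (\<lambda>s. g' ((m, b) # s)) s"
      if "n + wt s \<le> i + wt t" "m + wt s \<le> i + wt t" "wt s \<le> wt t" for n m a b s
      by (rule less.IH; use p that in \<open>simp add: Cons x\<close>)
    have 3: "smul e (\<lambda>s. if wt s + j < wt t
              then smul (\<lambda>s. f ((n, a) # s)) (\<lambda>s. g ((i + j - n, b) # s)) s else 0) t
        = smul e (\<lambda>s. if wt s + j < wt t
              then smul (\<lambda>s. f' ((n, a) # s)) (\<lambda>s. g' ((i + j - n, b) # s)) s else 0) t"
      if "n \<le> i + j" for n a b j and e :: "(nat \<times> 'c) list \<Rightarrow> 'r"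
      by (rule less.IH; use that in \<open>auto simp: Cons x intro!: 2\<close>)
    have 4: "(\<Sum>n<i. smul (\<lambda>s. f ((n, a) # s)) (\<lambda>s. g ((i - Suc n, b) # s)) t)
        = (\<Sum>n<i. smul (\<lambda>s. f' ((n, a) # s)) (\<lambda>s. g' ((i - Suc n, b) # s)) t)" for a b
      by (rule sum.cong[OF refl], rule 2) auto
    have 5: "(\<Sum>j<wt t. \<Sum>n\<le>i+j. dcf n (i + j - n) j * smul (e j) (\<lambda>s. if wt s + j < wt t
              then smul (\<lambda>s. f ((n, a) # s)) (\<lambda>s. g ((i + j - n, b) # s)) s else 0) t)
        = (\<Sum>j<wt t. \<Sum>n\<le>i+j. dcf n (i + j - n) j * smul (e j) (\<lambda>s. if wt s + j < wt t
              then smul (\<lambda>s. f' ((n, a) # s)) (\<lambda>s. g' ((i + j - n, b) # s)) s else 0) t)"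
      for a b and e :: "nat \<Rightarrow> (nat \<times> 'c) list \<Rightarrow> 'r"
      by (intro sum.cong refl, rule arg_cong2[of _ _ _ _ "(*)", OF refl], rule 3) simp
    show ?thesis unfolding Cons x smul.simps 1 4 5 ..
  qed
qed

lemma sum_lessThan_flip: "(\<Sum>n<i. F n (i - Suc n)) = (\<Sum>n<i. F (i - Suc n) n)"
  by (rule sum.reindex_bij_witness[of _ "\<lambda>n. i - Suc n" "\<lambda>n. i - Suc n"]) auto

lemma sum_atMost_flip: "(\<Sum>n\<le>i. F n (i - n)) = (\<Sum>n\<le>i. F (i - n) n)" for i :: nat
  by (rule sum.reindex_bij_witness[of _ "\<lambda>n. i - n" "\<lambda>n. i - n"]) auto

lemma smul_commute:
  fixes f g :: "(nat \<times> 'c::{finite,comm_monoid_mult}) list \<Rightarrow> 'r::fq_algebra"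
  shows "smul f g s = smul g f s"
proof (induction s arbitrary: f g rule: wt_induct)
  case (less s)
  show ?case
  proof (cases s)
    case Nil
    then show ?thesis by (simp add: smul.simps mult.commute)
  next
    case (Cons x t)
    obtain i c where x: "x = (i, c)" by force
    have IH: "smul f g s = smul g f s" if "wt s \<le> wt t" for f g :: "(nat \<times> 'c) list \<Rightarrow> 'r" and s
      by (rule less.IH) (use that in \<open>simp add: Cons x\<close>)
    have e1: "(\<Sum>n<i. smul (\<lambda>s. f ((n, a) # s)) (\<lambda>s. g ((i - Suc n, b) # s)) t)
       = (\<Sum>n<i. smul (\<lambda>s. g ((n, b) # s)) (\<lambda>s. f ((i - Suc n, a) # s)) t)" for a b
      unfolding sum_lessThan_flip[of "\<lambda>n m. smul (\<lambda>s. f ((n, a) # s)) (\<lambda>s. g ((m, b) # s)) t"]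
      by (rule sum.cong[OF refl], rule IH) simp
    have 2: "smul e (\<lambda>s. if wt s + j < wt t
                then smul (\<lambda>s. f ((n, a) # s)) (\<lambda>s. g ((m, b) # s)) s else 0) t
       = smul e (\<lambda>s. if wt s + j < wt t
                then smul (\<lambda>s. g ((m, b) # s)) (\<lambda>s. f ((n, a) # s)) s else 0) t"
      for a b j n m and e :: "(nat \<times> 'c) list \<Rightarrow> 'r"
      by (rule smul_cong[OF refl], rule if_cong[OF refl _ refl], rule IH) simp
    have e2: "(\<Sum>n\<le>i+j. dcf n (i + j - n) j *
               smul e (\<lambda>s. if wt s + j < wt t
                          then smul (\<lambda>s. f ((n, a) # s)) (\<lambda>s. g ((i + j - n, b) # s)) s else 0) t)
       = (\<Sum>n\<le>i+j. dcf n (i + j - n) j *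
               smul e (\<lambda>s. if wt s + j < wt t
                          then smul (\<lambda>s. g ((n, b) # s)) (\<lambda>s. f ((i + j - n, a) # s)) s else 0) t)"
      for a b j and e :: "(nat \<times> 'c) list \<Rightarrow> 'r"
      unfolding sum_atMost_flip[of "\<lambda>n m. dcf n m j * smul e (\<lambda>s. if wt s + j < wt t
                then smul (\<lambda>s. f ((n, a) # s)) (\<lambda>s. g ((m, b) # s)) s else 0) t"]
      by (rule sum.cong[OF refl], rule arg_cong2[of _ _ _ _ "(*)"], rule dcf_commute, rule 2)
    have e3: "(\<Sum>a\<in>UNIV. \<Sum>b\<in>UNIV. if a * b = c then A a b else 0)
        = (\<Sum>a\<in>UNIV. \<Sum>b\<in>UNIV. if a * b = c then A b a else 0)" for A :: "'c \<Rightarrow> 'c \<Rightarrow> 'r"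
      by (subst sum.swap) (simp only: mult.commute)
    have 4: "smul (\<lambda>s. f ((i, c) # s)) g t = smul g (\<lambda>s. f ((i, c) # s)) t"
      "smul f (\<lambda>s. g ((i, c) # s)) t = smul (\<lambda>s. g ((i, c) # s)) f t"
      by (rule IH; simp)+
    show ?thesis unfolding Cons x smul.simps e1 e2 4
      by (subst e3) (simp only: add_ac)
  qed
qed

lemma smul_linear_left:
  fixes f g :: "(nat \<times> 'c::{finite,comm_monoid_mult}) list \<Rightarrow> 'r::fq_algebra"
  shows "smul (\<lambda>s. r * f s + f' s) g s = r * smul f g s + smul f' g s"
proof (induction s arbitrary: f f' g rule: wt_induct)
  case (less s)
  show ?case
  proof (cases s)
    case Nil
    then show ?thesis by (simp add: smul.simps algebra_simps)
  next
    case (Cons x t)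
    obtain i c where x: "x = (i, c)" by force
    have IH: "smul (\<lambda>s. r * f s + f' s) g s = r * smul f g s + smul f' g s"
      if "wt s \<le> wt t" for f f' g :: "(nat \<times> 'c) list \<Rightarrow> 'r" and s
      by (rule less.IH) (use that in \<open>simp add: Cons x\<close>)
    have IH2: "smul e (\<lambda>s. if wt s + j < wt t
                  then smul (\<lambda>s. r * f ((n, a) # s) + f' ((n, a) # s)) g s else 0) t
       = r * smul e (\<lambda>s. if wt s + j < wt t then smul (\<lambda>s. f ((n, a) # s)) g s else 0) t
         + smul e (\<lambda>s. if wt s + j < wt t then smul (\<lambda>s. f' ((n, a) # s)) g s else 0) t"
      for e g :: "(nat \<times> 'c) list \<Rightarrow> 'r" and j n a
      unfolding smul_commute[of e]
    proof (subst IH[symmetric])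
      show "smul (\<lambda>s. if wt s + j < wt t
              then smul (\<lambda>s. r * f ((n, a) # s) + f' ((n, a) # s)) g s else 0) e t
        = smul (\<lambda>s. r * (if wt s + j < wt t then smul (\<lambda>s. f ((n, a) # s)) g s else 0)
            + (if wt s + j < wt t then smul (\<lambda>s. f' ((n, a) # s)) g s else 0)) e t"
        by (rule smul_cong) (use IH in auto)
    qed simp
    have e1: "(\<Sum>n<i. smul (\<lambda>s. r * f ((n, a) # s) + f' ((n, a) # s)) (h n) t)
       = r * (\<Sum>n<i. smul (\<lambda>s. f ((n, a) # s)) (h n) t) + (\<Sum>n<i. smul (\<lambda>s. f' ((n, a) # s)) (h n) t)"
      for a h by (simp add: IH sum.distrib sum_distrib_left)
    have e2: "(\<Sum>j<wt t. \<Sum>n\<le>i+j. d j n * (r * p j n + p' j n))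
       = r * (\<Sum>j<wt t. \<Sum>n\<le>i+j. d j n * p j n) + (\<Sum>j<wt t. \<Sum>n\<le>i+j. d j n * p' j n)"
      for d p p' :: "nat \<Rightarrow> nat \<Rightarrow> 'r"
      by (simp only: sum_distrib_left sum.distrib distrib_left mult.left_commute[of r])
    have e3: "(\<Sum>a\<in>UNIV. \<Sum>b\<in>UNIV. if a * b = c then (r * A a b + A' a b) + (r * B a b + B' a b) else 0)
       = r * (\<Sum>a\<in>UNIV. \<Sum>b\<in>UNIV. if a * b = c then A a b + B a b else 0)
         + (\<Sum>a\<in>UNIV. \<Sum>b\<in>UNIV. if a * b = c then A' a b + B' a b else 0)"
      for A A' B B' :: "'c \<Rightarrow> 'c \<Rightarrow> 'r"
      unfolding sum_distrib_left sum.distrib[symmetric]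
      by (intro sum.cong refl) (simp add: algebra_simps)
    have 4: "smul (\<lambda>s. r * f ((i, c) # s) + f' ((i, c) # s)) g t =
        r * smul (\<lambda>s. f ((i, c) # s)) g t + smul (\<lambda>s. f' ((i, c) # s)) g t"
      "smul (\<lambda>s. r * f s + f' s) (\<lambda>s. g ((i, c) # s)) t =
        r * smul f (\<lambda>s. g ((i, c) # s)) t + smul f' (\<lambda>s. g ((i, c) # s)) t"
      by (rule IH; simp)+
    show ?thesis unfolding Cons x smul.simps e1 IH2 e2 e3 4
      by (simp only: distrib_left add_ac)
  qed
qed

text \<open>Lowest weights add. In the correction term \<open>x_j\<close> weighs
  \<open>j + 1\<close> and the inner product starts at weight \<open>k + l - (i + j + 2)\<close>;
  together they start at \<open>k + l - (i + 1)\<close>, beyond \<open>wt t\<close>. This is what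
  permits truncating the factors.\<close>

lemma smul_order:
  fixes f g :: "(nat \<times> 'c::{finite,comm_monoid_mult}) list \<Rightarrow> 'r::fq_algebra"
  assumes "\<And>s'. wt s' < k \<Longrightarrow> f s' = 0" "\<And>s'. wt s' < l \<Longrightarrow> g s' = 0" "wt s < k + l"
  shows "smul f g s = 0"
  using assms
proof (induction s arbitrary: f g k l rule: wt_induct)
  case (less s)
  show ?case
  proof (cases s)
    case Nil
    then show ?thesis using less.prems by (cases "k = 0") (auto simp: smul.simps)
  next
    case (Cons x t)
    obtain i c where x: "x = (i, c)" by force
    have w: "Suc i + wt t < k + l" using less.prems(3) by (simp add: Cons x)
    have 1: "smul (\<lambda>s. f ((i, c) # s)) g t = 0"
      by (rule less.IH[of _ "k - Suc i" _ l]; use less.prems w in \<open>simp add: Cons x\<close>)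
    have 2: "smul f (\<lambda>s. g ((i, c) # s)) t = 0"
      by (rule less.IH[of _ k _ "l - Suc i"]; use less.prems w in \<open>simp add: Cons x\<close>)
    have 3: "smul (\<lambda>s. f ((n, a) # s)) (\<lambda>s. g ((m, b) # s)) s = 0"
      if "wt s + Suc n + Suc m < k + l" "wt s \<le> wt t" for n m a b s
      by (rule less.IH[of _ "k - Suc n" _ "l - Suc m"]; use less.prems that in \<open>simp add: Cons x\<close>)
    have 4: "smul (\<lambda>s. if s = [(j, 1)] then 1 else 0) (\<lambda>s. if wt s + j < wt t
              then smul (\<lambda>s. f ((n, a) # s)) (\<lambda>s. g ((i + j - n, b) # s)) s else 0) t = 0"
      if "n \<le> i + j" for n a b j
      by (rule less.IH[of _ "Suc j" _ "k + l - Suc (Suc (i + j))"])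
        (use that w in \<open>auto simp: Cons x intro!: 3\<close>)
    have 5: "smul (\<lambda>s. f ((n, a) # s)) (\<lambda>s. g ((i - Suc n, b) # s)) t = 0" if "n < i" for n a b
      by (rule 3) (use that w in auto)
    show ?thesis unfolding Cons x smul.simps 1 2
      by (auto simp: 4 5 intro!: sum.neutral)
  qed
qed

section \<open>The space of series and its product\<close>

typedef ('c, 'r) wser = "UNIV :: ((nat \<times> 'c) list \<Rightarrow> 'r) set"
  morphisms coef wser ..

lemma coef_wser [simp]: "coef (wser F) = F"
  by (rule wser_inverse) simp

lemma wser_eqI: "(\<And>s. coef f s = coef g s) \<Longrightarrow> f = g"
  by (metis coef_inverse ext)

instantiation wser :: (type, ab_group_add) ab_group_add
begin

definition "0 = wser (\<lambda>s. 0)"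
definition "f + g = wser (\<lambda>s. coef f s + coef g s)"
definition "f - g = wser (\<lambda>s. coef f s - coef g s)"
definition "- f = wser (\<lambda>s. - coef f s)"

instance
  by standard
    (auto intro!: wser_eqI simp: zero_wser_def plus_wser_def minus_wser_def uminus_wser_def)

end

lemma coef_graded_partoup [simp]:
  "coef 0 s = 0" "coef (f + g) s = coef f s + coef g s" "coef (f - g) s = coef f s - coef g s"
  "coef (- f) s = - coef f s"
  by (simp_all add: zero_wser_def plus_wser_def minus_wser_def uminus_wser_def)

lemma coef_sum: "coef (\<Sum>x\<in>A. f x) s = (\<Sum>x\<in>A. coef (f x) s)"
  by (induction A rule: infinite_finite_induct) auto

text \<open>Left quotient by a letter, in the sense of formal languages; it rewrites the recursion
  for coefficients as one between series.\<close>

definition lq :: "nat \<times> 'c \<Rightarrow> ('c, 'r) wser \<Rightarrow> ('c, 'r) wser" where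
  "lq x f = wser (\<lambda>s. coef f (x # s))"

definition scal :: "'r::comm_ring_1 \<Rightarrow> ('c, 'r) wser \<Rightarrow> ('c, 'r) wser" where
  "scal r f = wser (\<lambda>s. r * coef f s)"

definition bas :: "(nat \<times> 'c) list \<Rightarrow> ('c, 'r::comm_ring_1) wser" where
  "bas u = wser (\<lambda>s. if s = u then 1 else 0)"

text \<open>\<open>pg a z f\<close> is the series \<open>\<Sum>n. z\<^sup>n x\<^bsub>n,a\<^esub> f\<close>, evaluated at a point \<open>z\<close> of the coefficient ring.\<close>
definition pg :: "'c \<Rightarrow> 'r::comm_ring_1 \<Rightarrow> ('c, 'r) wser \<Rightarrow> ('c, 'r) wser" where
  "pg a z f = wser (\<lambda>s. case s of [] \<Rightarrow> 0 | x # t \<Rightarrow> if snd x = a then z ^ fst x * coef f t else 0)"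

instantiation wser :: ("{finite,comm_monoid_mult}", fq_algebra) "{times,one}"
begin

definition "f * g = wser (smul (coef f) (coef g))"
definition "1 = bas []"

instance ..

end

lemma coef_simps [simp]:
  "coef (lq x f) s = coef f (x # s)"
  "coef (scal r f) s = r * coef f s"
  "coef (bas u) s = (if s = u then 1 else 0)"
  "coef (pg a z f) [] = 0"
  "coef (pg a z f) ((n, c) # s) = (if c = a then z ^ n * coef f s else 0)"
  by (simp_all add: lq_def scal_def bas_def pg_def)

lemma coef_one: "coef 1 s = (if s = [] then 1 else 0)"
  by (simp add: one_wser_def)

lemma coef_mult_Nil [simp]: "coef (f * g) [] = coef f [] * coef g []"
  by (simp add: times_wser_def smul.simps)

lemma wser_mult_commute:
  fixes f g :: "('c::{finite,comm_monoid_mult}, 'r::fq_algebra) wser"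
  shows "f * g = g * f"
  by (intro wser_eqI) (simp add: times_wser_def smul_commute)

lemma wser_mult_linear_left:
  fixes f g :: "('c::{finite,comm_monoid_mult}, 'r::fq_algebra) wser"
  shows "(scal r f + f') * g = scal r (f * g) + f' * g"
proof -
  have "coef (scal r f + f') = (\<lambda>s. r * coef f s + coef f' s)"
    by (simp add: fun_eq_iff)
  then show ?thesis
    by (intro wser_eqI) (simp add: times_wser_def smul_linear_left)
qed

lemma scal_simps [simp]:
  "scal 1 f = f" "scal r (scal s f) = scal (r * s) f" "scal 0 f = 0" "scal r 0 = 0"
  by (auto intro!: wser_eqI simp: mult.assoc)

lemma scal_distribs:
  "scal r (f + g) = scal r f + scal r g" "scal r (f - g) = scal r f - scal r g"
  "scal r (- f) = - scal r f" "scal (r + s) f = scal r f + scal s f"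
  "scal (r - s) f = scal r f - scal s f" "scal (- r) f = - scal r f"
  by (auto intro!: wser_eqI simp: algebra_simps)

lemma scal_sum: "scal r (\<Sum>x\<in>A. f x) = (\<Sum>x\<in>A. scal r (f x))"
  by (intro wser_eqI) (simp add: coef_sum sum_distrib_left)

lemma wser_mult_0 [simp]:
  fixes f :: "('c::{finite,comm_monoid_mult}, 'r::fq_algebra) wser"
  shows "0 * f = 0" "f * 0 = 0"
proof -
  show "0 * f = 0"
    using wser_mult_linear_left[of "-1" f f f] by (simp add: scal_distribs)
  then show "f * 0 = 0" by (simp only: wser_mult_commute[of f 0])
qed

lemma wser_mult_distribs:
  fixes f g h :: "('c::{finite,comm_monoid_mult}, 'r::fq_algebra) wser"
  shows "(f + g) * h = f * h + g * h" "(f - g) * h = f * h - g * h"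
    "h * (f + g) = h * f + h * g" "h * (f - g) = h * f - h * g"
    "(- f) * h = - (f * h)" "h * (- f) = - (h * f)"
    "scal r f * h = scal r (f * h)" "h * scal r f = scal r (h * f)"
proof -
  show 1: "(f + g) * h = f * h + g * h" for f g
    using wser_mult_linear_left[of 1 f g h] by simp
  show 2: "(- f) * h = - (f * h)" for f
    using wser_mult_linear_left[of "-1" f 0 h] by (simp add: scal_distribs)
  show 3: "(f - g) * h = f * h - g * h" for f g
    using 1[of f "- g"] 2[of g] by simp
  show 4: "scal r f * h = scal r (f * h)" for f
    using wser_mult_linear_left[of r f 0 h] by simp
  show "h * (f + g) = h * f + h * g" "h * (f - g) = h * f - h * g"
    "h * (- f) = - (h * f)" "h * scal r f = scal r (h * f)"
    unfolding wser_mult_commute[of h] 1 2 3 4 by simp_all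
qed

lemma wser_mult_sum:
  fixes h :: "('c::{finite,comm_monoid_mult}, 'r::fq_algebra) wser"
  shows "(\<Sum>x\<in>A. f x) * h = (\<Sum>x\<in>A. f x * h)" "h * (\<Sum>x\<in>A. f x) = (\<Sum>x\<in>A. h * f x)"
  by (induction A rule: infinite_finite_induct) (simp_all add: wser_mult_distribs)

lemma coef_mult_order:
  fixes f g :: "('c::{finite,comm_monoid_mult}, 'r::fq_algebra) wser"
  assumes "\<And>s'. wt s' < k \<Longrightarrow> coef f s' = 0" "\<And>s'. wt s' < l \<Longrightarrow> coef g s' = 0" "wt s < k + l"
  shows "coef (f * g) s = 0"
  unfolding times_wser_def coef_wser by (rule smul_order) (use assms in auto)

lemma coef_mult_Cons:
  fixes f g :: "('c::{finite,comm_monoid_mult}, 'r::fq_algebra) wser"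
  shows "coef (f * g) ((i, c) # t) = coef (lq (i, c) f * g) t + coef (f * lq (i, c) g) t
     + (\<Sum>a\<in>UNIV. \<Sum>b\<in>UNIV. if a * b = c then
          (\<Sum>n<i. coef (lq (n, a) f * lq (i - Suc n, b) g) t)
          + (\<Sum>j<wt t. \<Sum>n\<le>i+j. dcf n (i + j - n) j *
               coef (bas [(j, 1)] * (lq (n, a) f * lq (i + j - n, b) g)) t)
        else 0)"
proof -
  have e: "smul (\<lambda>s. if s = [(j, 1)] then 1 else 0) (\<lambda>s. if wt s + j < wt t then h s else 0) t
      = coef (bas [(j, 1)] * wser h) t" for j h
  proof -
    define k where "k = wser (\<lambda>s. if wt s + j < wt t then 0 else h s)"
    have "coef (bas [(j, 1)] * k) t = 0"
      by (rule coef_mult_order[of "Suc j" _ "wt t - j"]) (auto simp: k_def)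
    moreover have "wser (\<lambda>s. if wt s + j < wt t then h s else 0) = wser h - k"
      by (intro wser_eqI) (simp add: k_def)
    ultimately have "coef (bas [(j, 1)] * wser (\<lambda>s. if wt s + j < wt t then h s else 0)) t
        = coef (bas [(j, 1)] * wser h) t"
      by (simp add: wser_mult_distribs)
    then show ?thesis by (simp add: times_wser_def bas_def)
  qed
  have l: "(\<lambda>s. coef f (x # s)) = coef (lq x f)" for x and f :: "('c, 'r) wser"
    by (simp add: fun_eq_iff)
  show ?thesis
    unfolding times_wser_def[of f g] coef_wser smul.simps e unfolding l times_wser_def coef_wser ..
qed

lemma lq_simps [simp]:
  fixes f g :: "('c, 'r::comm_ring_1) wser"
  shows "lq x (f + g) = lq x f + lq x g" "lq x (f - g) = lq x f - lq x g"  "lq x (0 :: ('c, 'r) wser) = 0"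
  "lq x (scal r f) = scal r (lq x f)"
  "lq x (bas []) = 0" "lq x (bas (y # s)) = (if x = y then bas s else 0)"
  "lq (n, c) (pg a z f) = (if c = a then scal (z ^ n) f else 0)"
  by (auto intro!: wser_eqI)

lemma wser_mult_1 [simp]:
  fixes f :: "('c::{finite,comm_monoid_mult}, 'r::fq_algebra) wser"
  shows "1 * f = f" "f * 1 = f"
proof -
  have "coef (1 * f) s = coef f s" for s
  proof (induction s arbitrary: f)
    case (Cons x s)
    then show ?case by (cases x) (simp add: coef_mult_Cons one_wser_def cong: if_cong)
  qed (simp add: coef_one)
  then show "1 * f = f" by (rule wser_eqI)
  then show "f * 1 = f" by (simp only: wser_mult_commute[of f 1])
qed

lemma pg_linear:
  "pg a z (f + g) = pg a z f + pg a z g" "pg a z (f - g) = pg a z f - pg a z g"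
  "pg a z (- f) = - pg a z f" "pg a z (scal r f) = scal r (pg a z f)" "pg a z 0 = 0"
  by (intro wser_eqI; rename_tac s; case_tac s; auto simp: algebra_simps)+

lemma pg_sum: "pg a z (\<Sum>x\<in>A. f x) = (\<Sum>x\<in>A. pg a z (f x))"
  by (induction A rule: infinite_finite_induct) (simp_all add: pg_linear)

section \<open>Finitely determined functionals\<close>

text \<open>Linear functionals that are continuous for coefficientwise convergence. When
  \<open>'c\<close> is finite there are finitely many words of each weight, so such a functional is
  a finite combination of coefficients and is determined by its values on words.\<close>

definition lfun :: "(('c, 'r::fq_algebra) wser \<Rightarrow> 'r) \<Rightarrow> bool" where
  "lfun \<phi> \<longleftrightarrow> (\<forall>r f g. \<phi> (scal r f + g) = r * \<phi> f + \<phi> g)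
     \<and> (\<exists>N. \<forall>f. (\<forall>s. wt s \<le> N \<longrightarrow> coef f s = 0) \<longrightarrow> \<phi> f = 0)"

definition lmap :: "(('c, 'r::fq_algebra) wser \<Rightarrow> ('d, 'r) wser) \<Rightarrow> bool" where
  "lmap T \<longleftrightarrow> (\<forall>s. lfun (\<lambda>f. coef (T f) s))"

lemma lfun_linear:
  assumes "lfun \<phi>"
  shows "\<phi> (scal r f + g) = r * \<phi> f + \<phi> g" "\<phi> 0 = 0" "\<phi> (scal r f) = r * \<phi> f"
    "\<phi> (f + g) = \<phi> f + \<phi> g" "\<phi> (f - g) = \<phi> f - \<phi> g" "\<phi> (\<Sum>x\<in>A. h x) = (\<Sum>x\<in>A. \<phi> (h x))"
proof -
  show l: "\<phi> (scal r f + g) = r * \<phi> f + \<phi> g" for r f g using assms by (simp add: lfun_def)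
  show 0: "\<phi> 0 = 0" using l[of 1 0 0] by simp
  show s: "\<phi> (scal r f) = r * \<phi> f" for r f using l[of r f 0] 0 by simp
  show p: "\<phi> (f + g) = \<phi> f + \<phi> g" for f g using l[of 1 f g] by simp
  show "\<phi> (f - g) = \<phi> f - \<phi> g" using l[of "-1" g f] by (simp add: scal_distribs)
  show "\<phi> (\<Sum>x\<in>A. h x) = (\<Sum>x\<in>A. \<phi> (h x))"
    by (induction A rule: infinite_finite_induct) (simp_all add: 0 p)
qed

lemma lfun_expand:
  fixes \<phi> :: "('c::finite, 'r::fq_algebra) wser \<Rightarrow> 'r"
  assumes "lfun \<phi>" and "\<And>f. (\<forall>s. wt s \<le> N \<longrightarrow> coef f s = 0) \<Longrightarrow> \<phi> f = 0"
  shows "\<phi> f = (\<Sum>s | wt s \<le> N. coef f s * \<phi> (bas s))"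
proof -
  define g where "g = (\<Sum>s | wt s \<le> N. scal (coef f s) (bas s))"
  have "\<phi> (f - g) = 0"
    by (rule assms(2)) (auto simp: g_def coef_sum finite_wt_le if_distrib[of "\<lambda>x. _ * x"] cong: if_cong)
  then show ?thesis by (simp add: lfun_linear[OF assms(1)] g_def)
qed

lemma lfun_expand_ex:
  fixes \<phi> :: "('c::finite, 'r::fq_algebra) wser \<Rightarrow> 'r"
  assumes "lfun \<phi>"
  shows "\<exists>N. (\<forall>f. \<phi> f = (\<Sum>s | wt s \<le> N. coef f s * \<phi> (bas s))) \<and> (\<forall>s. N < wt s \<longrightarrow> \<phi> (bas s) = 0)"
proof -
  obtain N where N: "\<And>f. (\<forall>s. wt s \<le> N \<longrightarrow> coef f s = 0) \<Longrightarrow> \<phi> f = 0"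
    using assms by (auto simp: lfun_def)
  show ?thesis
  proof (intro exI conjI allI impI)
    show "\<phi> f = (\<Sum>s | wt s \<le> N. coef f s * \<phi> (bas s))" for f
      by (rule lfun_expand[OF assms N])
    show "\<phi> (bas s) = 0" if "N < wt s" for s
      by (rule N) (use that in auto)
  qed
qed

lemma lfun_eq_0_words:
  fixes \<phi> :: "('c::finite, 'r::fq_algebra) wser \<Rightarrow> 'r"
  assumes "lfun \<phi>" "\<And>u. \<phi> (bas u) = 0"
  shows "\<phi> f = 0"
  using lfun_expand_ex[OF assms(1)] assms(2) by (metis (no_types, lifting) mult_zero_right sum.neutral)

lemma lfun_diff:
  assumes "lfun \<phi>" "lfun \<psi>"
  shows "lfun (\<lambda>f. \<phi> f - \<psi> f)"
  unfolding lfun_def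
proof (intro conjI allI)
  show "\<phi> (scal r f + g) - \<psi> (scal r f + g) = r * (\<phi> f - \<psi> f) + (\<phi> g - \<psi> g)" for r f g
    unfolding lfun_linear(1)[OF assms(1)] lfun_linear(1)[OF assms(2)] by (simp add: algebra_simps)
  obtain N M where N: "\<And>f. (\<forall>s. wt s \<le> N \<longrightarrow> coef f s = 0) \<Longrightarrow> \<phi> f = 0"
    and M: "\<And>f. (\<forall>s. wt s \<le> M \<longrightarrow> coef f s = 0) \<Longrightarrow> \<psi> f = 0"
    using assms by (auto simp: lfun_def)
  show "\<exists>N. \<forall>f. (\<forall>s. wt s \<le> N \<longrightarrow> coef f s = 0) \<longrightarrow> \<phi> f - \<psi> f = 0"
  proof (intro exI allI impI)
    fix f :: "('a, 'b) wser" assume f: "\<forall>s. wt s \<le> max N M \<longrightarrow> coef f s = 0"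
    show "\<phi> f - \<psi> f = 0" using N[of f] M[of f] f by simp
  qed
qed

lemma lfun_scale:
  assumes "lfun \<phi>"
  shows "lfun (\<lambda>f. r * \<phi> f)"
  unfolding lfun_def
proof (intro conjI allI)
  show "r * \<phi> (scal t f + g) = t * (r * \<phi> f) + r * \<phi> g" for t f g
    unfolding lfun_linear(1)[OF assms(1)] by (simp add: distrib_left mult.left_commute)
  show "\<exists>N. \<forall>f. (\<forall>s. wt s \<le> N \<longrightarrow> coef f s = 0) \<longrightarrow> r * \<phi> f = 0"
    using assms unfolding lfun_def by (metis mult_zero_right)
qed

lemma lfun_sum:
  assumes "\<And>x. x \<in> A \<Longrightarrow> lfun (\<phi> x)"
  shows "lfun (\<lambda>f. \<Sum>x\<in>A. \<phi> x f)"
  using assms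
proof (induction A rule: infinite_finite_induct)
  case (insert x A)
  have "lfun (\<lambda>f. \<phi> x f - (-1) * (\<Sum>x\<in>A. \<phi> x f))"
    by (intro lfun_diff lfun_scale insert) auto
  with insert show ?case by simp
qed (auto simp: lfun_def)

lemma lfun_lmap:
  fixes \<phi> :: "('d::finite, 'r::fq_algebra) wser \<Rightarrow> 'r"
  assumes "lfun \<phi>" "lmap T"
  shows "lfun (\<lambda>f. \<phi> (T f))"
proof -
  obtain N where N: "\<And>f. \<phi> f = (\<Sum>s | wt s \<le> N. coef f s * \<phi> (bas s))"
    "\<And>s. N < wt s \<Longrightarrow> \<phi> (bas s) = 0"
    using lfun_expand_ex[OF assms(1)] by blast
  have "lfun (\<lambda>f. \<Sum>s | wt s \<le> N. \<phi> (bas s) * coef (T f) s)"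
    by (intro lfun_sum lfun_scale) (use assms(2) in \<open>auto simp: lmap_def\<close>)
  then show ?thesis by (simp only: N(1)[of "T _"] mult.commute)
qed

lemma lmap_mult:
  fixes g :: "('c::{finite,comm_monoid_mult}, 'r::fq_algebra) wser"
  shows "lmap (\<lambda>f. f * g)" "lmap (\<lambda>f. g * f)"
proof -
  have "lfun (\<lambda>f. coef (f * g) s)" for s
    unfolding lfun_def
    by (auto simp: wser_mult_linear_left intro!: exI[of _ "wt s"] coef_mult_order[of "Suc (wt s)" _ 0])
  then show "lmap (\<lambda>f. f * g)" by (simp add: lmap_def)
  then show "lmap (\<lambda>f. g * f)" by (simp add: wser_mult_commute)
qed

lemma lmap_comp:
  assumes "lmap S" "lmap T"
  shows "lmap (\<lambda>f. (S :: ('d::finite, 'r::fq_algebra) wser \<Rightarrow> ('e, 'r) wser) (T f))"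
  unfolding lmap_def by (rule allI, rule lfun_lmap[of "\<lambda>f. coef (S f) _"])
    (use assms in \<open>auto simp: lmap_def\<close>)

text \<open>As a function of \<open>z\<close>, the value on \<open>pg c z (bas a)\<close> is a
  polynomial whose coefficients are the values on the words \<open>(n, c) # a\<close>; its degree is
  bounded because the functional ignores heavy words. Infinitely many zeros in \<open>Lf\<close>
  kill it.\<close>

lemma lfun_bas_Cons_eq_0:
  fixes \<phi> :: "('c::finite, 'r::fq_algebra) wser \<Rightarrow> 'r"
  assumes "lfun \<phi>" "infinite S" "S \<subseteq> Lf" "\<And>z. z \<in> S \<Longrightarrow> \<phi> (pg c z (bas a)) = 0"
  shows "\<phi> (bas ((n, c) # a)) = 0"
proof -
  obtain N where N: "\<And>f. \<phi> f = (\<Sum>s | wt s \<le> N. coef f s * \<phi> (bas s))"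
    "\<And>s. N < wt s \<Longrightarrow> \<phi> (bas s) = 0"
    using lfun_expand_ex[OF assms(1)] by blast
  have "(\<Sum>n\<le>N. z ^ n * \<phi> (bas ((n, c) # a))) = 0" if "z \<in> S" for z
  proof -
    have "0 = (\<Sum>s | wt s \<le> N. coef (pg c z (bas a)) s * \<phi> (bas s))"
      using assms(4)[OF that] N(1)[of "pg c z (bas a)"] by simp
    also have "\<dots> = (\<Sum>s\<in>(\<lambda>n. (n, c) # a) ` {..N}. coef (pg c z (bas a)) s * \<phi> (bas s))"
    proof (rule sum.mono_neutral_cong)
      show "coef (pg c z (bas a)) s * \<phi> (bas s) = 0"
        if "s \<in> {s. wt s \<le> N} - (\<lambda>n. (n, c) # a) ` {..N}" for s
        using that by (cases s) (auto split: if_splits)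
      show "coef (pg c z (bas a)) s * \<phi> (bas s) = 0"
        if "s \<in> (\<lambda>n. (n, c) # a) ` {..N} - {s. wt s \<le> N}" for s
        using that N(2)[of s] by auto
    qed (auto simp: finite_wt_le)
    also have "\<dots> = (\<Sum>n\<le>N. z ^ n * \<phi> (bas ((n, c) # a)))"
      by (subst sum.reindex) (auto simp: inj_on_def)
    finally show ?thesis by simp
  qed
  then show ?thesis
    using power_sum_coeffs_eq_0[OF assms(2,3), where N = N and n = n and c = "\<lambda>n. \<phi> (bas ((n, c) # a))"] N(2)[of "(n, c) # a"]
    by (cases "n \<le> N") auto
qed

definition depth_le :: "nat \<Rightarrow> ('c, 'r::zero) wser \<Rightarrow> bool" where
  "depth_le d f \<longleftrightarrow> (\<forall>s. d < length s \<longrightarrow> coef f s = 0)"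

text \<open>The tool for the inductions on depth: it suffices to test on the empty word and on
  generating series at points. The set \<open>S\<close> can be chosen to avoid points where an
  identity would have a pole.\<close>

lemma lfun_eq_0:
  fixes \<phi> :: "('c::{finite,comm_monoid_mult}, 'r::fq_algebra) wser \<Rightarrow> 'r"
  assumes "lfun \<phi>" "\<phi> 1 = 0" "infinite S" "S \<subseteq> Lf" "depth_le d f"
    and "\<And>c z a e. d = Suc e \<Longrightarrow> z \<in> S \<Longrightarrow> depth_le e a \<Longrightarrow> \<phi> (pg c z a) = 0"
  shows "\<phi> f = 0"
proof -
  obtain N where N: "\<And>f. \<phi> f = (\<Sum>s | wt s \<le> N. coef f s * \<phi> (bas s))"
    "\<And>s. N < wt s \<Longrightarrow> \<phi> (bas s) = 0"
    using lfun_expand_ex[OF assms(1)] by blast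
  show ?thesis unfolding N(1)[of f]
  proof (intro sum.neutral ballI)
    fix s :: "(nat \<times> 'c) list"
    show "coef f s * \<phi> (bas s) = 0"
    proof (cases "length s \<le> d")
      case True
      show ?thesis
      proof (cases s)
        case Nil
        then show ?thesis using assms(2) by (simp add: one_wser_def)
      next
        case (Cons x a)
        then obtain e where "d = Suc e" "length a \<le> e" using True by (cases d) auto
        then have "\<phi> (bas ((fst x, snd x) # a)) = 0"
          by (intro lfun_bas_Cons_eq_0[OF assms(1,3,4)] assms(6)) (auto simp: depth_le_def)
        then show ?thesis by (simp add: Cons)
      qed
    qed (use assms(5) in \<open>auto simp: depth_le_def\<close>)
  qed
qed

section \<open>The product on generating series\<close>

lemma unit_mult: "x dvd 1 \<Longrightarrow> y dvd 1 \<Longrightarrow> x * y dvd (1::'a::comm_monoid_mult)"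
  by (metis mult_1 mult_dvd_mono)

lemma uinv_mult:
  fixes x y :: "'a::comm_monoid_mult"
  assumes "x dvd 1" "y dvd 1"
  shows "uinv (x * y) = uinv x * uinv y"
proof (rule uinv_eqI)
  have "x * y * (uinv x * uinv y) = (x * uinv x) * (y * uinv y)" by (simp only: mult_ac)
  then show "x * y * (uinv x * uinv y) = 1" using assms by (simp add: uinv_right)
qed

lemma Fq_reindex:
  fixes m :: "'r::fq_algebra"
  assumes "m \<in> Fq" "m \<noteq> 0"
  shows "(\<Sum>l\<in>Fq - {0}. f (m * l)) = (\<Sum>l\<in>Fq - {0}. f l)"
    "(\<Sum>l\<in>Fq - {0}. f (m * uinv l)) = (\<Sum>l\<in>Fq - {0}. f l)"
proof -
  have u: "x * uinv x = 1" "uinv x \<in> Fq" "uinv x \<noteq> 0" if "x \<in> Fq" "x \<noteq> 0" for x :: 'r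
  proof -
    show 1: "x * uinv x = 1" by (rule uinv_right[OF Fq_unit(1)[OF that]])
    show "uinv x \<in> Fq" by (rule Fq_unit(2)[OF that])
    show "uinv x \<noteq> 0" using 1 by auto
  qed
  have nz: "x * y \<noteq> 0" if "x \<in> Fq - {0}" "y \<in> Fq - {0}" for x y :: 'r
  proof
    assume "x * y = 0"
    then have "uinv x * (x * y) = 0" by simp
    then have "(x * uinv x) * y = 0" by (simp only: mult_ac)
    then show False using that u[of x] by simp
  qed
  have c: "a * (b * x) = x" if "a * b = 1" for a b x :: 'r
    using that by (metis mult.assoc mult_1)
  have um: "uinv m * m = 1" using u(1)[OF assms] by (simp only: mult.commute)
  show "(\<Sum>l\<in>Fq - {0}. f (m * l)) = (\<Sum>l\<in>Fq - {0}. f l)"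
    by (rule sum.reindex_bij_witness[of _ "\<lambda>l. uinv m * l" "\<lambda>l. m * l"])
      (use assms u nz in \<open>auto simp: c[OF u(1)] c[OF um] intro!: Fq_closed(4)\<close>)
  have i: "m * uinv (m * uinv x) = x" if "x \<in> Fq - {0}" for x
  proof -
    have "uinv (m * uinv x) = uinv m * x"
    proof (rule uinv_eqI)
      have "m * uinv x * (uinv m * x) = (m * uinv m) * (x * uinv x)" by (simp only: mult_ac)
      then show "m * uinv x * (uinv m * x) = 1" using u that assms by simp
    qed
    then show ?thesis using u(1)[OF assms] c by simp
  qed
  show "(\<Sum>l\<in>Fq - {0}. f (m * uinv l)) = (\<Sum>l\<in>Fq - {0}. f l)"
    by (rule sum.reindex_bij_witness[of _ "\<lambda>l. m * uinv l" "\<lambda>l. m * uinv l"])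
      (use assms u nz i in \<open>auto intro!: Fq_closed(4)\<close>)
qed

lemma Fq_shift:
  fixes m :: "'r::fq_algebra"
  assumes "m \<in> Fq"
  shows "(\<Sum>l\<in>Fq. f (m + l)) = (\<Sum>l\<in>Fq. f l)" "(\<Sum>l\<in>Fq. f (m - l)) = (\<Sum>l\<in>Fq. f l)"
proof -
  show "(\<Sum>l\<in>Fq. f (m + l)) = (\<Sum>l\<in>Fq. f l)"
    by (rule sum.reindex_bij_witness[of _ "\<lambda>l. l - m" "\<lambda>l. m + l"])
      (use assms in \<open>auto intro!: Fq_closed\<close>)
  show "(\<Sum>l\<in>Fq. f (m - l)) = (\<Sum>l\<in>Fq. f l)"
    by (rule sum.reindex_bij_witness[of _ "\<lambda>l. m - l" "\<lambda>l. m - l"])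
      (use assms in \<open>auto intro!: Fq_closed\<close>)
qed

text \<open>Substituting \<open>m * l\<close> for \<open>l\<close> permutes the sum, so the power
  sum is homogeneous. The symmetries \<open>Gs_scale\<close> and \<open>Es_scale\<close> rest on
  this.\<close>

lemma hc_scale:
  fixes m :: "'r::fq_algebra"
  assumes "m \<in> Fq" "m \<noteq> 0"
  shows "m ^ Suc j * hc j = hc j"
  using Fq_reindex(1)[OF assms, of "\<lambda>l. l ^ Suc j"]
  by (simp add: hc_def sum_distrib_left power_mult_distrib del: power_Suc)

lemma hc_minus: "(-1) ^ j * hc j = - (hc j :: 'r::fq_algebra)"
  using hc_scale[of "-1 :: 'r" j] Fq_closed(5)[OF Fq_closed(1), where ?'a = 'r]
  by (simp add: minus_equation_iff)

text \<open>The power series part of \<open>G(t)\<close> with \<open>f\<close> appended by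
  concatenation. This differs from the shuffle product \<open>Hp t 1 * f\<close>; only
  \<open>Hp t 1\<close> enters \<open>Gs\<close>.\<close>

definition Hp :: "'r \<Rightarrow> ('c::comm_monoid_mult, 'r::fq_algebra) wser \<Rightarrow> ('c, 'r) wser" where
  "Hp t f = wser (\<lambda>s. case s of [] \<Rightarrow> 0
     | x # u \<Rightarrow> if snd x = 1 then hc (fst x) * t ^ fst x * coef f u else 0)"

lemma coef_Hp [simp]:
  "coef (Hp t f) [] = 0"
  "coef (Hp t f) ((n, c) # s) = (if c = 1 then hc n * t ^ n * coef f s else 0)"
  by (simp_all add: Hp_def)

text \<open>The series \<open>Gs t\<close> stands for \<open>\<Sum>\<^sub>v 1 / (t - v)\<close> over a finite \<open>F\<^sub>q\<close>-vector space;
  it is the inverse of an \<open>F\<^sub>q\<close>-linear power series in \<open>t\<close>.\<close>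
definition Gs :: "'r \<Rightarrow> ('c::{finite,comm_monoid_mult}, 'r::fq_algebra) wser" where
  "Gs t = scal (uinv t) 1 + Hp t 1"

lemma Hp_linear:
  "Hp t (f + g) = Hp t f + Hp t g" "Hp t (f - g) = Hp t f - Hp t g" "Hp t (- f) = - Hp t f"
  "Hp t (scal r f) = scal r (Hp t f)"
  by (intro wser_eqI; rename_tac s; case_tac s; auto simp: algebra_simps)+

text \<open>The definition of \<open>hc\<close> as a power sum, read backwards. It reduces products
  of such series to products of generating series at the finitely many points
  \<open>l * t\<close>.\<close>

lemma Hp_eq_sum: "Hp t f = - (\<Sum>l\<in>Fq - {0}. scal l (pg 1 (l * t) f))"
proof (rule wser_eqI)
  fix s show "coef (Hp t f) s = coef (- (\<Sum>l\<in>Fq - {0}. scal l (pg 1 (l * t) f))) s"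
  proof (cases s)
    case (Cons x u)
    then show ?thesis
      by (cases x) (auto simp: coef_sum hc_def sum_distrib_left sum_distrib_right power_mult_distrib
          mult_ac intro!: sum.cong)
  qed (simp add: coef_sum)
qed

lemma coef_Hp_mult:
  fixes f :: "('c::{finite,comm_monoid_mult}, 'r::fq_algebra) wser"
  shows "coef (Hp t 1 * f) s = (\<Sum>j<wt s. hc j * t ^ j * coef (bas [(j, 1)] * f) s)"
proof -
  have "coef (Hp t 1 * f) s = (\<Sum>u | wt u \<le> wt s. coef (Hp t 1) u * coef (bas u * f) s)"
    by (rule lfun_expand, use lmap_mult(1)[of f] in \<open>simp add: lmap_def\<close>)
      (auto intro!: coef_mult_order[of "Suc (wt s)" _ 0])
  also have "\<dots> = (\<Sum>u\<in>(\<lambda>j. [(j, 1)]) ` {..<wt s}. coef (Hp t 1) u * coef (bas u * f) s)"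
  proof (rule sum.mono_neutral_right)
    have "coef (Hp t 1) u = 0" if "wt u \<le> wt s" "u \<notin> (\<lambda>j. [(j, 1)]) ` {..<wt s}" for u :: "(nat \<times> 'c) list"
      using that by (cases u) (auto simp: coef_one image_iff)
    then show "\<forall>u\<in>{u. wt u \<le> wt s} - (\<lambda>j. [(j, 1)]) ` {..<wt s}. coef (Hp t 1) u * coef (bas u * f) s = 0"
      by auto
  qed (auto simp: finite_wt_le)
  also have "\<dots> = (\<Sum>j<wt s. hc j * t ^ j * coef (bas [(j, 1)] * f) s)"
    by (subst sum.reindex) (auto simp: inj_on_def coef_one)
  finally show ?thesis .
qed

lemma binomial_shift_sum:
  fixes z w :: "'r::comm_ring_1"
  shows "(\<Sum>n\<le>i+j. (-1) ^ n * of_nat (j choose n) * (z ^ n * w ^ (i + j - n))) = w ^ i * (w - z) ^ j"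
proof -
  have "(\<Sum>n\<le>i+j. (-1) ^ n * of_nat (j choose n) * (z ^ n * w ^ (i + j - n)))
      = (\<Sum>n\<le>j. (-1) ^ n * of_nat (j choose n) * (z ^ n * w ^ (i + j - n)))"
    by (rule sum.mono_neutral_right) (auto simp: binomial_eq_0)
  also have "\<dots> = (\<Sum>n\<le>j. w ^ i * (of_nat (j choose n) * (- z) ^ n * w ^ (j - n)))"
  proof (intro sum.cong refl)
    fix n assume "n \<in> {..j}"
    then have "w ^ (i + j - n) = w ^ i * w ^ (j - n)" by (simp flip: power_add)
    then show "(-1) ^ n * of_nat (j choose n) * (z ^ n * w ^ (i + j - n))
        = w ^ i * (of_nat (j choose n) * (- z) ^ n * w ^ (j - n))"
      by (simp only: power_minus[of z] mult_ac)
  qed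
  also have "\<dots> = w ^ i * (- z + w) ^ j" by (simp only: binomial_ring sum_distrib_left)
  finally show ?thesis by simp
qed

text \<open>The binomial theorem turns the two halves of \<open>dcf\<close> into
  \<open>w^i (w - z)^j\<close> and \<open>z^i (z - w)^j\<close>. By \<open>hc_minus\<close> the sign
  \<open>(-1)^j\<close> of the first becomes \<open>-1\<close>, and the two combine.\<close>

lemma dcf_sum:
  fixes z w :: "'r::fq_algebra"
  shows "(\<Sum>n\<le>i+j. dcf n (i + j - n) j * (z ^ n * w ^ (i + j - n))) = hc j * (z ^ i - w ^ i) * (z - w) ^ j"
proof -
  have 1: "(\<Sum>n\<le>i+j. (-1) ^ (i + j - n) * of_nat (j choose (i + j - n)) * (z ^ n * w ^ (i + j - n)))
      = z ^ i * (z - w) ^ j"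
    unfolding sum_atMost_flip[of "\<lambda>n m. (-1) ^ m * of_nat (j choose m) * (z ^ n * w ^ m)"]
    using binomial_shift_sum[where j = j and i = i and z = w and w = z] by (simp only: mult.commute[of "w ^ _"])
  have "(\<Sum>n\<le>i+j. dcf n (i + j - n) j * (z ^ n * w ^ (i + j - n))) =
     hc j * ((\<Sum>n\<le>i+j. (-1) ^ n * of_nat (j choose n) * (z ^ n * w ^ (i + j - n)))
      + (\<Sum>n\<le>i+j. (-1) ^ (i + j - n) * of_nat (j choose (i + j - n)) * (z ^ n * w ^ (i + j - n))))"
    unfolding dcf_def sum.distrib[symmetric] sum_distrib_left
    by (intro sum.cong refl) (simp only: distrib_left distrib_right mult.assoc)
  also have "\<dots> = hc j * (w ^ i * ((-1) ^ j * (z - w) ^ j) + z ^ i * (z - w) ^ j)"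
    unfolding binomial_shift_sum 1 power_minus[of "z - w", symmetric] by simp
  also have "\<dots> = w ^ i * ((-1) ^ j * hc j) * (z - w) ^ j + z ^ i * hc j * (z - w) ^ j"
    by (simp only: distrib_left mult_ac)
  also have "\<dots> = hc j * (z ^ i - w ^ i) * (z - w) ^ j"
    unfolding hc_minus by (simp add: algebra_simps)
  finally show ?thesis .
qed

lemma sum_sum_if:
  fixes a b :: "'c::finite"
  assumes "\<And>x y. (x, y) \<noteq> (a, b) \<Longrightarrow> F x y = 0"
  shows "(\<Sum>x\<in>UNIV. \<Sum>y\<in>UNIV. F x y) = (F a b :: 'r::comm_monoid_add)"
proof -
  have "(\<Sum>x\<in>UNIV. \<Sum>y\<in>UNIV. F x y) = (\<Sum>x\<in>UNIV. if x = a then F a b else 0)"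
  proof (intro sum.cong refl)
    fix x
    have "(\<Sum>y\<in>UNIV. F x y) = (\<Sum>y\<in>UNIV. if y = b then F x b else 0)"
      by (intro sum.cong refl) (use assms in auto)
    also have "\<dots> = (if x = a then F a b else 0)" using assms[of x b] by auto
    finally show "(\<Sum>y\<in>UNIV. F x y) = (if x = a then F a b else 0)" .
  qed
  then show ?thesis by simp
qed

text \<open>Coefficients are compared by their first letter. The letter of added weights contributes
  the sum of \<open>z^n w^(i-1-n)\<close>, that is \<open>(z^i - w^i) / (z - w)\<close>, the pole of
  \<open>G(z - w)\<close>. The corrections contribute \<open>z^i - w^i\<close> times its power
  series part, by \<open>dcf_sum\<close>. The factor \<open>z^i - w^i\<close> is the difference of
  two evaluations.\<close>

lemma pg_mult_pg:
  fixes f g :: "('c::{finite,comm_monoid_mult}, 'r::fq_algebra) wser"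
  assumes "z - w dvd 1"
  shows "pg a z f * pg b w g = pg a z (f * pg b w g) + pg b w (pg a z f * g)
     + (pg (a * b) z (Gs (z - w) * (f * g)) - pg (a * b) w (Gs (z - w) * (f * g)))"
    (is "?L = ?R")
proof (rule wser_eqI)
  fix s show "coef ?L s = coef ?R s"
  proof (cases s)
    case (Cons x t)
    obtain i c where x: "x = (i, c)" by force
    have 1: "coef (lq (i, c) (pg a z f) * pg b w g) t = (if c = a then z ^ i * coef (f * pg b w g) t else 0)"
      "coef (pg a z f * lq (i, c) (pg b w g)) t = (if c = b then w ^ i * coef (pg a z f * g) t else 0)"
      by (simp_all add: wser_mult_distribs)
    have s1: "(\<Sum>n<i. coef (lq (n, a) (pg a z f) * lq (i - Suc n, b) (pg b w g)) t)
        = (z ^ i - w ^ i) * uinv (z - w) * coef (f * g) t"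
    proof -
      have "(\<Sum>n<i. coef (lq (n, a) (pg a z f) * lq (i - Suc n, b) (pg b w g)) t)
        = (\<Sum>n<i. w ^ (i - Suc n) * z ^ n) * coef (f * g) t"
        by (simp add: wser_mult_distribs sum_distrib_left mult_ac)
      also have "(\<Sum>n<i. w ^ (i - Suc n) * z ^ n) = (z ^ i - w ^ i) * uinv (z - w)"
      proof -
        have "(z ^ i - w ^ i) * uinv (z - w) = ((z - w) * uinv (z - w)) * (\<Sum>n<i. w ^ (i - Suc n) * z ^ n)"
          unfolding power_diff_sumr2 by (simp only: mult_ac)
        then show ?thesis by (simp only: uinv_right[OF assms] mult_1)
      qed
      finally show ?thesis .
    qed
    have s2: "(\<Sum>j<wt t. \<Sum>n\<le>i+j. dcf n (i + j - n) j *
               coef (bas [(j, 1)] * (lq (n, a) (pg a z f) * lq (i + j - n, b) (pg b w g))) t)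
       = (z ^ i - w ^ i) * coef (Hp (z - w) 1 * (f * g)) t"
    proof -
      have "(\<Sum>j<wt t. \<Sum>n\<le>i+j. dcf n (i + j - n) j *
               coef (bas [(j, 1)] * (lq (n, a) (pg a z f) * lq (i + j - n, b) (pg b w g))) t)
        = (\<Sum>j<wt t. (\<Sum>n\<le>i+j. dcf n (i + j - n) j * (z ^ n * w ^ (i + j - n)))
              * coef (bas [(j, 1)] * (f * g)) t)"
        by (simp add: wser_mult_distribs sum_distrib_left mult_ac)
      then show ?thesis
        unfolding dcf_sum coef_Hp_mult by (simp add: sum_distrib_left mult_ac)
    qed
    have 4: "(\<Sum>x\<in>UNIV. \<Sum>y\<in>UNIV. if x * y = c then
          (\<Sum>n<i. coef (lq (n, x) (pg a z f) * lq (i - Suc n, y) (pg b w g)) t)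
          + (\<Sum>j<wt t. \<Sum>n\<le>i+j. dcf n (i + j - n) j *
               coef (bas [(j, 1)] * (lq (n, x) (pg a z f) * lq (i + j - n, y) (pg b w g))) t)
        else 0) = (if a * b = c then (z ^ i - w ^ i) * coef (Gs (z - w) * (f * g)) t else 0)"
    proof (subst sum_sum_if[of a b], goal_cases)
      case (1 x y)
      then show ?case by auto
    next
      case 2
      show ?case unfolding s1 s2 Gs_def by (simp add: wser_mult_distribs distrib_left mult.assoc)
    qed
    show ?thesis unfolding Cons x coef_mult_Cons 1 4 by (auto simp: algebra_simps)
  qed simp
qed

lemma Gs_scale:
  assumes "m \<in> Fq" "m \<noteq> 0" "t dvd 1"
  shows "scal m (Gs (m * t)) = (Gs t :: ('c::{finite,comm_monoid_mult}, 'r::fq_algebra) wser)"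
proof -
  have 1: "m * uinv (m * t) = uinv t"
    using uinv_mult[OF Fq_unit(1)[OF assms(1,2)] assms(3)] uinv_right[OF Fq_unit(1)[OF assms(1,2)]]
    by (metis mult.assoc mult_1)
  have 2: "scal m (Hp (m * t) 1) = (Hp t 1 :: ('c, 'r) wser)"
  proof (rule wser_eqI)
    fix s show "coef (scal m (Hp (m * t) 1)) s = coef (Hp t 1 :: ('c, 'r) wser) s"
    proof (cases s)
      case (Cons x u)
      have "m * (hc n * (m * t) ^ n) = hc n * t ^ n" for n
      proof -
        have "m * (hc n * (m * t) ^ n) = (m ^ Suc n * hc n) * t ^ n"
          by (simp add: power_mult_distrib mult_ac)
        then show ?thesis by (simp only: hc_scale[OF assms(1,2)])
      qed
      then show ?thesis using Cons by (cases x) (simp flip: mult.assoc)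
    qed simp
  qed
  show ?thesis by (simp add: Gs_def scal_distribs 1 2)
qed

lemma Gs_minus: "t dvd 1 \<Longrightarrow> Gs (- t) = - (Gs t :: ('c::{finite,comm_monoid_mult}, 'r::fq_algebra) wser)"
  using Gs_scale[of "-1 :: 'r" t, where ?'c = 'c] Fq_closed(5)[OF Fq_closed(1), where ?'a = 'r]
  by (simp add: scal_distribs minus_equation_iff)

text \<open>Keeps all arguments of \<open>Gs\<close> in the product formula for \<open>Gs x * Gs y\<close> away from its poles.\<close>
definition generic :: "'r::fq_algebra \<Rightarrow> 'r \<Rightarrow> bool" where
  "generic x y \<longleftrightarrow> (\<forall>a\<in>Fq. \<forall>b\<in>Fq. (a, b) \<noteq> (0, 0) \<longrightarrow> a * x + b * y dvd 1)"

lemma genericD: "generic x y \<Longrightarrow> a \<in> Fq \<Longrightarrow> b \<in> Fq \<Longrightarrow> (a, b) \<noteq> (0, 0) \<Longrightarrow> a * x + b * y dvd 1"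
  by (auto simp: generic_def)

lemma generic_units:
  assumes "generic x y"
  shows "x dvd 1" "y dvd 1" "x - y dvd 1" "a \<in> Fq \<Longrightarrow> x - a * y dvd 1" "a \<in> Fq \<Longrightarrow> y - a * x dvd 1"
  using genericD[OF assms, of 1 0] genericD[OF assms, of 0 1] genericD[OF assms, of 1 "-1"]
    genericD[OF assms, of 1 "- a"] genericD[OF assms, of "- a" 1] by (simp_all add: Fq_closed)

lemma generic_commute: "generic x y \<Longrightarrow> generic y x"
  unfolding generic_def by (metis add.commute prod.inject)

lemma generic_diff: "generic x y \<Longrightarrow> generic (x - y) y"
  unfolding generic_def
proof (intro ballI impI)
  fix a b :: 'a assume a: "\<forall>a\<in>Fq. \<forall>b\<in>Fq. (a, b) \<noteq> (0, 0) \<longrightarrow> a * x + b * y dvd 1" "a \<in> Fq" "b \<in> Fq" "(a, b) \<noteq> (0, 0)"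
  then have "a * x + (b - a) * y dvd 1" using Fq_closed(3) by auto
  then show "a * (x - y) + b * y dvd 1" by (simp add: algebra_simps)
qed

lemma generic_minus: "generic x y \<Longrightarrow> generic (- x) y"
  unfolding generic_def
proof (intro ballI impI)
  fix a b :: 'a assume a: "\<forall>a\<in>Fq. \<forall>b\<in>Fq. (a, b) \<noteq> (0, 0) \<longrightarrow> a * x + b * y dvd 1" "a \<in> Fq" "b \<in> Fq" "(a, b) \<noteq> (0, 0)"
  then have "(- a) * x + b * y dvd 1" using Fq_closed(5)[of a] by fastforce
  then show "a * (- x) + b * y dvd 1" by simp
qed

text \<open>By \<open>Hp_eq_sum\<close> the power series parts are sums over points
  \<open>l * x\<close> and \<open>m * y\<close>. Their products bring in
  \<open>Gs (l * x - m * y)\<close>, and scaling by \<open>m\<close> or \<open>l\<close> leaves only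
  the ratio of \<open>l\<close> and \<open>m\<close>, which runs over all nonzero \<open>k\<close>.
  The result is linear in values of \<open>Gs\<close>, so that different products become
  comparable.\<close>

lemma Gs_mult_Gs:
  assumes "generic x y"
  shows "(Gs x :: ('c::{finite,comm_monoid_mult}, 'r::fq_algebra) wser) * Gs y =
    scal (uinv x * uinv y) 1 + Hp x (\<Sum>k\<in>Fq. Gs (y - k * x)) + Hp y (\<Sum>k\<in>Fq. Gs (x - k * y))"
proof -
  let ?F = "Fq - {0} :: 'r set"
  let ?G = "Gs :: 'r \<Rightarrow> ('c, 'r) wser"
  have u: "l * uinv l = 1" if "l \<in> ?F" for l
    using that Fq_unit(1) uinv_right by auto
  have cancel: "l * (uinv l * r) = r" if "l \<in> ?F" for l r
    using u[OF that] by (metis mult.assoc mult_1)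
  have q: "m * uinv l \<in> Fq" if "l \<in> ?F" "m \<in> ?F" for l m
    using that Fq_unit(2) Fq_closed(4) by auto
  define S where "S = (\<Sum>k\<in>?F. ?G (y - k * x))"
  define S' where "S' = (\<Sum>k\<in>?F. ?G (x - k * y))"
  have e1: "scal m (?G (l * x - m * y)) = - ?G (y - (l * uinv m) * x)"
    and e2: "scal l (?G (l * x - m * y)) = ?G (x - (m * uinv l) * y)"
    and un: "l * x - m * y dvd 1" if l: "l \<in> ?F" and m: "m \<in> ?F" for l m
  proof -
    have d: "y - (l * uinv m) * x dvd 1" "x - (m * uinv l) * y dvd 1"
      using generic_units[OF assms] q l m by auto
    have 1: "m * (- (y - (l * uinv m) * x)) = l * x - m * y"
      using cancel[OF m, of "l * x"] by (simp add: algebra_simps)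
    show "scal m (?G (l * x - m * y)) = - ?G (y - (l * uinv m) * x)"
      using Gs_scale[of m "- (y - (l * uinv m) * x)", where ?'c = 'c] m d(1)
      unfolding 1 Gs_minus[OF d(1)] minus_dvd_iff by blast
    have 2: "l * (x - (m * uinv l) * y) = l * x - m * y"
      using cancel[OF l, of "m * y"] by (simp add: algebra_simps)
    show "scal l (?G (l * x - m * y)) = ?G (x - (m * uinv l) * y)"
      using Gs_scale[of l "x - (m * uinv l) * y", where ?'c = 'c] d(2) l unfolding 2 by simp
    show "l * x - m * y dvd 1"
      unfolding 2[symmetric] by (intro unit_mult d) (use l Fq_unit in auto)
  qed
  let ?p = "\<lambda>t f. pg 1 t f :: ('c, 'r) wser"
  have "Hp x 1 * Hp y 1 = (\<Sum>l\<in>?F. \<Sum>m\<in>?F. scal (l * m) (?p (l * x) 1 * ?p (m * y) 1))"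
    unfolding Hp_eq_sum wser_mult_distribs wser_mult_sum
    by (subst sum.swap) (simp add: scal_distribs scal_sum sum_negf mult.commute)
  also have "\<dots> = (\<Sum>l\<in>?F. \<Sum>m\<in>?F. scal l (?p (l * x) (scal m (?p (m * y) 1)))
      + scal m (?p (m * y) (scal l (?p (l * x) 1)))
      - scal l (?p (l * x) (?G (y - (l * uinv m) * x)))
      - scal m (?p (m * y) (?G (x - (m * uinv l) * y))))"
  proof (intro sum.cong refl)
    fix l m assume l: "l \<in> ?F" and m: "m \<in> ?F"
    have "scal (l * m) (?p (l * x) 1 * ?p (m * y) 1)
      = scal l (?p (l * x) (scal m (?p (m * y) 1))) + scal m (?p (m * y) (scal l (?p (l * x) 1)))
       + (scal l (?p (l * x) (scal m (?G (l * x - m * y)))) - scal m (?p (m * y) (scal l (?G (l * x - m * y)))))"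
      unfolding pg_mult_pg[OF un[OF l m]] by (simp add: scal_distribs pg_linear mult.commute)
    then show "scal (l * m) (?p (l * x) 1 * ?p (m * y) 1) = scal l (?p (l * x) (scal m (?p (m * y) 1)))
      + scal m (?p (m * y) (scal l (?p (l * x) 1)))
      - scal l (?p (l * x) (?G (y - (l * uinv m) * x)))
      - scal m (?p (m * y) (?G (x - (m * uinv l) * y)))"
      unfolding e1[OF l m] e2[OF l m] by (simp add: pg_linear scal_distribs)
  qed
  also have "\<dots> = (\<Sum>l\<in>?F. scal l (?p (l * x) (\<Sum>m\<in>?F. scal m (?p (m * y) 1))))
      + (\<Sum>m\<in>?F. scal m (?p (m * y) (\<Sum>l\<in>?F. scal l (?p (l * x) 1))))
      - (\<Sum>l\<in>?F. scal l (?p (l * x) (\<Sum>m\<in>?F. ?G (y - (l * uinv m) * x))))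
      - (\<Sum>m\<in>?F. scal m (?p (m * y) (\<Sum>l\<in>?F. ?G (x - (m * uinv l) * y))))"
    unfolding sum.distrib sum_subtractf pg_sum scal_sum
    by (subst (2 4) sum.swap) (rule refl)
  also have "\<dots> = Hp x (Hp y 1) + Hp y (Hp x 1) + Hp x S + Hp y S'"
  proof -
    have "(\<Sum>m\<in>?F. ?G (y - (l * uinv m) * x)) = S" if "l \<in> ?F" for l
      unfolding S_def using Fq_reindex(2)[of l "\<lambda>k. ?G (y - k * x)"] that by auto
    moreover have "(\<Sum>l\<in>?F. ?G (x - (m * uinv l) * y)) = S'" if "m \<in> ?F" for m
      unfolding S'_def using Fq_reindex(2)[of m "\<lambda>k. ?G (x - k * y)"] that by auto
    ultimately show ?thesis
      unfolding Hp_eq_sum by (simp add: scal_distribs pg_linear sum_negf)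
  qed
  finally have H: "Hp x 1 * Hp y 1 = Hp x (Hp y 1) + Hp y (Hp x 1) + Hp x S + Hp y S'" .
  \<comment> \<open>The terms with \<open>k = 0\<close> do not come from \<open>S\<close> and
    \<open>S'\<close>: they are assembled from the mixed products of a pole with a power series part
    and from \<open>Hp x (Hp y 1)\<close> and \<open>Hp y (Hp x 1)\<close>.\<close>
  have S: "(\<Sum>k\<in>Fq. ?G (y - k * x)) = ?G y + S" "(\<Sum>k\<in>Fq. ?G (x - k * y)) = ?G x + S'"
    unfolding S_def S'_def by (subst sum.remove[of _ 0]; simp add: finite_Fq Fq_closed(2))+
  show ?thesis unfolding S unfolding Gs_def
    by (simp add: wser_mult_distribs H Hp_linear scal_distribs mult.commute add_ac)
qed

text \<open>Equivalent to the additivity of \<open>1 / Gs\<close>.\<close>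
lemma Gs_three_term:
  assumes "generic x y"
  shows "(Gs x :: ('c::{finite,comm_monoid_mult}, 'r::fq_algebra) wser) * Gs y
    = Gs (x - y) * Gs y - Gs (x - y) * Gs x"
proof -
  let ?G = "Gs :: 'r \<Rightarrow> ('c, 'r) wser"
  note un = generic_units[OF assms]
  have g1: "generic (x - y) y" using generic_diff[OF assms] .
  have g2: "generic (x - y) x"
    using generic_minus[OF generic_diff[OF generic_commute[OF assms]]] by simp
  \<comment> \<open>Expanding all three products, the sums over \<open>k\<close> are invariant under
    translations of \<open>F_q\<close>. So the parts with \<open>Hp x\<close> and
    \<open>Hp y\<close> match, those with \<open>Hp (x - y)\<close> cancel, and the scalars agree by
    partial fractions.\<close>
  have "(\<Sum>k\<in>Fq. ?G (x - y - k * y)) = (\<Sum>k\<in>Fq. ?G (x - k * y))"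
    using Fq_shift(1)[OF Fq_closed(1), of "\<lambda>k. ?G (x - k * y)"] by (simp add: algebra_simps)
  moreover have "(\<Sum>k\<in>Fq. ?G (x - y - k * x)) = - (\<Sum>k\<in>Fq. ?G (y - k * x))"
  proof -
    have "(\<Sum>k\<in>Fq. ?G (x - y - k * x)) = (\<Sum>k\<in>Fq. ?G (- (y - (1 - k) * x)))"
      by (simp add: algebra_simps)
    also have "\<dots> = (\<Sum>k\<in>Fq. - ?G (y - (1 - k) * x))"
      by (intro sum.cong refl Gs_minus un(5) Fq_closed)
    finally show ?thesis
      using Fq_shift(2)[OF Fq_closed(1), of "\<lambda>k. ?G (y - k * x)"] by (simp add: sum_negf)
  qed
  moreover have "(\<Sum>k\<in>Fq. ?G (x - k * (x - y))) = (\<Sum>k\<in>Fq. ?G (y - k * (x - y)))"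
    using Fq_shift(1)[OF Fq_closed(5)[OF Fq_closed(1)], of "\<lambda>k. ?G (y - k * (x - y))"]
    by (simp add: algebra_simps)
  moreover have "uinv x * uinv y = uinv (x - y) * uinv y - uinv (x - y) * uinv x"
  proof -
    have "uinv (x - y) * uinv y - uinv (x - y) * uinv x
        = uinv (x - y) * uinv y * (x * uinv x) - uinv (x - y) * uinv x * (y * uinv y)"
      using uinv_right[OF un(1)] uinv_right[OF un(2)] by simp
    also have "\<dots> = ((x - y) * uinv (x - y)) * (uinv x * uinv y)"
      by (simp add: algebra_simps)
    finally show ?thesis using uinv_right[OF un(3)] by simp
  qed
  ultimately show ?thesis
    unfolding Gs_mult_Gs[OF assms] Gs_mult_Gs[OF g1] Gs_mult_Gs[OF g2]
    by (simp add: Hp_linear scal_distribs)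
qed

section \<open>Associativity\<close>

lemma depth_le_pg:
  fixes f :: "('c, 'r::comm_ring_1) wser"
  shows "depth_le d f \<Longrightarrow> depth_le (Suc d) (pg a z f)"
  unfolding depth_le_def
proof (intro allI impI)
  fix s :: "(nat \<times> 'c) list" assume "\<forall>s. d < length s \<longrightarrow> coef f s = 0" "Suc d < length s"
  then show "coef (pg a z f) s = 0" by (cases s; cases "hd s") auto
qed

lemma depth_le_lq:
  fixes f :: "('c, 'r::comm_ring_1) wser"
  shows "depth_le (Suc d) f \<Longrightarrow> depth_le d (lq x f)" "depth_le 0 f \<Longrightarrow> lq x f = 0"
  by (auto simp: depth_le_def intro!: wser_eqI)

lemma depth_le_Gs: "depth_le 1 (Gs t)"
  unfolding depth_le_def
proof (intro allI impI)
  fix s :: "(nat \<times> 'a) list" assume "1 < length s"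
  then obtain x u where "s = x # u" "u \<noteq> []" by (cases s) auto
  then show "coef (Gs t) s = 0" by (cases x) (auto simp: Gs_def coef_one)
qed

text \<open>The diamond product merges two letters into one and its corrections shuffle one letter
  \<open>x_j\<close> back in, so depth never grows. The correction multiplies depth 1 by depth
  \<open>p + q - 2\<close>, hence the induction on a bound for the total depth rather than on one
  factor.\<close>

lemma depth_le_mult:
  fixes f g :: "('c::{finite,comm_monoid_mult}, 'r::fq_algebra) wser"
  assumes "depth_le p f" "depth_le q g"
  shows "depth_le (p + q) (f * g)"
proof -
  have "depth_le (p + q) (f * g)" if "depth_le p f" "depth_le q g" "p + q \<le> n" for n p q and f g :: "('c, 'r) wser"
    using that
  proof (induction n arbitrary: p q f g)
    case 0
    show ?case unfolding depth_le_def
    proof (intro allI impI)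
      fix s :: "(nat \<times> 'c) list" assume "p + q < length s"
      then obtain i c t where s: "s = (i, c) # t" by (cases s) auto
      show "coef (f * g) s = 0"
        unfolding s coef_mult_Cons using 0 by (simp add: depth_le_lq cong: if_cong)
    qed
  next
    case (Suc n)
    have 1: "depth_le (p + q - 1) (lq x f * g)" for x
      by (cases p) (use Suc.prems depth_le_lq in \<open>auto intro!: Suc.IH simp: depth_le_lq\<close>, simp add: depth_le_def)
    have 2: "depth_le (p + q - 1) (f * lq x g)" for x
    proof (cases q)
      case 0
      then show ?thesis using Suc.prems by (simp add: depth_le_lq) (simp add: depth_le_def)
    next
      case (Suc q')
      then show ?thesis using Suc.IH[of p f q' "lq x g"] Suc.prems depth_le_lq(1)[of q' g x] by simp
    qed
    have 3: "lq x f * lq y g = 0 \<or> 2 \<le> p + q \<and> depth_le (p + q - 2) (lq x f * lq y g)" for x y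
    proof (cases p)
      case 0
      then show ?thesis using Suc.prems by (simp add: depth_le_lq)
    next
      case p: (Suc p')
      show ?thesis
      proof (cases q)
        case 0
        then show ?thesis using Suc.prems by (simp add: depth_le_lq)
      next
        case (Suc q')
        then show ?thesis
          using Suc.IH[of p' "lq x f" q' "lq y g"] Suc.prems depth_le_lq(1)[of q' g y] depth_le_lq(1)[of p' f x] p by simp
      qed
    qed
    have 4: "depth_le (p + q - 1) (bas [(j, 1)] * (lq x f * lq y g))" for j x y
    proof (cases "lq x f * lq y g = 0")
      case False
      then have "depth_le (p + q - 2) (lq x f * lq y g)" "2 \<le> p + q" using 3 by blast+
      then show ?thesis
        using Suc.IH[of 1 "bas [(j, 1)]" "p + q - 2" "lq x f * lq y g"] Suc.prems(3) by (auto simp: depth_le_def)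
    qed (simp add: depth_le_def)
    show ?case unfolding depth_le_def
    proof (intro allI impI)
      fix s :: "(nat \<times> 'c) list" assume l: "p + q < length s"
      then obtain i c t where s: "s = (i, c) # t" by (cases s) auto
      have t: "p + q - 1 < length t \<or> p + q = 0" using l s by auto
      show "coef (f * g) s = 0"
      proof (cases "p + q = 0")
        case True
        then show ?thesis using Suc.prems unfolding s coef_mult_Cons by (simp add: depth_le_lq cong: if_cong)
      next
        case False
        with t have t: "p + q - 1 < length t" by blast
        have 5: "coef (lq x f * lq y g) t = 0" for x y
          using 3[of x y] t by (auto simp: depth_le_def)
        show ?thesis unfolding s coef_mult_Cons
          using 1 2 4 5 t by (simp add: depth_le_def cong: if_cong)
      qed
    qed
  qed
  from this[OF assms order_refl] show ?thesis .
qed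

text \<open>\<open>pg_mult_pg\<close> applied twice, sorted by the leading generating series. In
  this form the product of the same factors in reversed order can be compared summand by summand,
  with only products of smaller total depth inside.\<close>

lemma mult_pg3:
  fixes f g h :: "('c::{finite,comm_monoid_mult}, 'r::fq_algebra) wser" and z w v :: 'r and a b c :: 'c
  assumes "z - w dvd 1" "z - v dvd 1" "w - v dvd 1"
  defines "A \<equiv> pg a z f" and "B \<equiv> pg b w g" and "C \<equiv> pg c v h"
    and "Y \<equiv> Gs (z - w) * (f * g)" and "U \<equiv> Gs (z - v)" and "V \<equiv> Gs (w - v)"
  shows "(A * B) * C = pg a z ((f * B) * C) + pg b w ((A * g) * C) + pg c v ((A * B) * h)
    + (pg (a * b) z (Y * C) - pg (a * b) w (Y * C))
    + (pg (a * c) z (U * ((f * B) * h)) - pg (a * c) v (U * ((f * B) * h)))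
    + (pg (b * c) w (V * ((A * g) * h)) - pg (b * c) v (V * ((A * g) * h)))
    + (pg (a * b * c) z (U * (Y * h)) - pg (a * b * c) w (V * (Y * h))
       + pg (a * b * c) v (V * (Y * h) - U * (Y * h)))"
proof -
  have AB: "A * B = pg a z (f * B) + pg b w (A * g) + (pg (a * b) z Y - pg (a * b) w Y)"
    unfolding A_def B_def Y_def by (rule pg_mult_pg[OF assms(1)])
  have Z: "pg d z k * C = pg d z (k * C) + pg c v (pg d z k * h)
      + (pg (d * c) z (U * (k * h)) - pg (d * c) v (U * (k * h)))" for d k
    unfolding C_def U_def by (rule pg_mult_pg[OF assms(2)])
  have W: "pg d w k * C = pg d w (k * C) + pg c v (pg d w k * h)
      + (pg (d * c) w (V * (k * h)) - pg (d * c) v (V * (k * h)))" for d k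
    unfolding C_def V_def by (rule pg_mult_pg[OF assms(3)])
  have "(A * B) * C = pg a z (f * B) * C + pg b w (A * g) * C + (pg (a * b) z Y * C - pg (a * b) w Y * C)"
    by (simp only: AB wser_mult_distribs)
  moreover have "pg c v ((A * B) * h) = pg c v (pg a z (f * B) * h) + pg c v (pg b w (A * g) * h)
      + (pg c v (pg (a * b) z Y * h) - pg c v (pg (a * b) w Y * h))"
    by (simp only: AB wser_mult_distribs pg_linear)
  ultimately show ?thesis
    unfolding Z W by (simp add: pg_linear mult.assoc)
qed

text \<open>By commutativity the claim is \<open>(A * B) * C = (C * B) * A\<close>. Both sides
  expand by \<open>mult_pg3\<close>; the induction hypothesis and the oddness of \<open>G\<close>
  match everything except terms with character \<open>a * b * c\<close>. There the coefficients at
  \<open>z\<close> and \<open>v\<close> involve products of two values of \<open>G\<close>, which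
  agree by the three-term relation.\<close>

lemma mult_assoc_pg:
  fixes f g h :: "('c::{finite,comm_monoid_mult}, 'r::fq_algebra) wser"
  assumes IH: "\<And>p q r f g h. depth_le p f \<Longrightarrow> depth_le q g \<Longrightarrow> depth_le r h \<Longrightarrow> p + q + r \<le> n \<Longrightarrow>
      (f * g) * h = f * (g * h :: ('c, 'r) wser)"
    and d: "depth_le p f" "depth_le q g" "depth_le r h" "p + q + r + 2 \<le> n"
    and generic: "generic (z - v) (w - v)"
  shows "(pg a z f * pg b w g) * pg c v h = pg a z f * (pg b w g * pg c v h)"
proof -
  define A B C where ABC: "A = pg a z f" "B = pg b w g" "C = pg c v h"
  define U V W :: "('c, 'r) wser" where UVW: "U = Gs (z - v)" "V = Gs (w - v)" "W = Gs (z - w)"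
  note un = generic_units[OF generic]
  have un3: "z - w dvd 1" using un(3) by simp
  have un': "v - w dvd 1" "v - z dvd 1" "w - z dvd 1"
    using un(1,2) un3 by (metis minus_diff_eq minus_dvd_iff)+
  have neg: "Gs (v - z) = - U" "Gs (w - z) = - W" "Gs (v - w) = - V"
    using Gs_minus[OF un(1), where ?'c = 'c] Gs_minus[OF un(2), where ?'c = 'c]
      Gs_minus[OF un3, where ?'c = 'c] by (simp_all add: UVW)
  have dA: "depth_le (Suc p) A" and dB: "depth_le (Suc q) B" and dC: "depth_le (Suc r) C"
    using d by (simp_all add: ABC depth_le_pg)
  have dU: "depth_le 1 U" and dV: "depth_le 1 V" and dW: "depth_le 1 W"
    by (simp_all only: UVW depth_le_Gs)
  note com = wser_mult_commute
  define m where "m = (f * g) * h"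
  have dm: "depth_le (p + q + r) m" unfolding m_def by (intro depth_le_mult d)
  have T: "U * V = W * V - W * U"
    using Gs_three_term[OF generic, where ?'c = 'c] by (simp add: UVW)
  \<comment> \<open>The product \<open>A * B * C\<close> has depth bound
    \<open>p + q + r + 3\<close>. In each use of the hypothesis a leading letter is missing, or two
    or three of them are replaced by values of \<open>G\<close>, so the bound \<open>n\<close> is
    met.\<close>
  have E1: "(C * B) * f = (f * B) * C"
    using IH[OF d(1) dB dC] d(4) by (simp add: com[of "B * C" f] com[of C B])
  have E2: "(C * g) * A = (A * g) * C"
    using IH[OF dA d(2) dC] d(4) by (simp add: com[of "g * C" A] com[of C g])
  have E3: "(h * B) * A = (A * B) * h"
    using IH[OF dA dB d(3)] d(4) by (simp add: com[of "B * h" A] com[of h B])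
  have E4: "W * ((C * g) * f) = (W * (f * g)) * C"
  proof -
    have "(W * (f * g)) * C = W * ((f * g) * C)"
      by (rule IH[OF dW depth_le_mult[OF d(1,2)] dC]) (use d(4) in simp)
    also have "(f * g) * C = f * (g * C)" by (rule IH[OF d(1,2) dC]) (use d(4) in simp)
    finally show ?thesis by (simp only: com[of "g * C" f] com[of C g])
  qed
  have E5: "(h * B) * f = (f * B) * h"
    using IH[OF d(1) dB d(3)] d(4) by (simp add: com[of "B * h" f] com[of h B])
  have E6: "(V * (h * g)) * A = V * ((A * g) * h)"
  proof -
    have "(V * (h * g)) * A = V * ((h * g) * A)"
      by (rule IH[OF dV depth_le_mult[OF d(3,2)] dA]) (use d(4) in simp)
    moreover have "(A * g) * h = A * (g * h)" by (rule IH[OF dA d(2,3)]) (use d(4) in simp)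
    ultimately show ?thesis by (simp only: com[of "g * h" A] com[of h g])
  qed
  have m': "(h * g) * f = m"
    using IH[OF d(1-3)] d(4) unfolding m_def by (simp add: com[of "g * h" f] com[of h g])
  have E7: "(W * (f * g)) * h = W * m"
    unfolding m_def by (rule IH[OF dW depth_le_mult[OF d(1,2)] d(3)]) (use d(4) in simp)
  have E8: "(V * (h * g)) * f = V * m"
    unfolding m'[symmetric] by (rule IH[OF dV depth_le_mult[OF d(3,2)] d(1)]) (use d(4) in simp)
  have P: "X * (X' * m) = (X * X') * m" if "depth_le 1 X" "depth_le 1 X'" for X X'
    by (rule IH[OF that dm, symmetric]) (use d(4) in simp)
  have Tm: "U * (V * m) = W * (V * m) - W * (U * m)"
    unfolding P[OF dU dV] P[OF dW dV] P[OF dW dU] T by (simp add: wser_mult_distribs)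
  have sw: "U * (W * m) = W * (U * m)" "V * (W * m) = W * (V * m)" "V * (U * m) = U * (V * m)"
    using P dU dV dW com by metis+
  have "(A * B) * C = (C * B) * A"
    unfolding ABC mult_pg3[OF un3 un(1,2)] mult_pg3[OF un'(1,2,3)]
    unfolding ABC[symmetric] UVW[symmetric] neg
    unfolding wser_mult_distribs E1 E2 E3 E4 E5 E6 E7 E8 sw Tm
    by (simp add: pg_linear Tm mult_ac)
  then show ?thesis unfolding ABC[symmetric] com[of C B] com[of "B * C" A] .
qed

lemma generic_Lf:
  assumes "x \<in> Lf" "y \<in> Lf" "y \<noteq> 0" "x \<notin> (\<lambda>k. k * y) ` Fq"
  shows "generic x y"
  unfolding generic_def
proof (intro ballI impI)
  fix a b :: 'a assume ab: "a \<in> Fq" "b \<in> Fq" "(a, b) \<noteq> (0, 0)"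
  show "a * x + b * y dvd 1"
  proof (cases "a = 0")
    case True
    then show ?thesis using ab assms(2,3) unit_mult[OF Fq_unit(1)[of b] Lf_unit(1)[of y]] by simp
  next
    case False
    have "a * x + b * y \<noteq> 0"
    proof
      assume *: "a * x + b * y = 0"
      have "x = (a * uinv a) * x" using uinv_right[OF Fq_unit(1)[OF ab(1) False]] by simp
      also have "\<dots> = uinv a * (a * x)" by (simp only: mult_ac)
      also have "a * x = - (b * y)" using * by (simp add: eq_neg_iff_add_eq_0)
      also have "uinv a * - (b * y) = (- (uinv a * b)) * y" by (simp add: mult_ac)
      finally have "x \<in> (\<lambda>k. k * y) ` Fq"
        using Fq_unit(2)[OF ab(1) False] ab(2) by (intro image_eqI[of _ _ "- (uinv a * b)"] Fq_closed)
      with assms(4) show False by blast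
    qed
    moreover have "a * x + b * y \<in> Lf"
      using ab assms(1,2) Fq_subset_Lf by (intro Lf_closed) auto
    ultimately show ?thesis by (intro Lf_unit)
  qed
qed

text \<open>Induction on total depth. \<open>C1\<close> to \<open>C3\<close> free the three factors
  one by one from being generating series: each time \<open>lfun_eq_0\<close> tests on points
  outside the finitely many non-generic ones. Unbounded depth follows because every coefficient of
  either side is finitely determined in each factor.\<close>

lemma wser_mult_assoc:
  fixes f g h :: "('c::{finite,comm_monoid_mult}, 'r::fq_algebra) wser"
  shows "(f * g) * h = f * (g * h)"
proof -
  have lf: "lfun (\<lambda>f. coef ((f * g) * h) s - coef (f * (g * h)) s)"
    "lfun (\<lambda>f. coef ((g * f) * h) s - coef (g * (f * h)) s)"
    "lfun (\<lambda>f. coef ((g * h) * f) s - coef (g * (h * f)) s)" for g h :: "('c, 'r) wser" and s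
  proof -
    note m = lmap_mult[where ?'c = 'c and ?'r = 'r]
    have l: "lfun (\<lambda>f. coef (T f) s - coef (T' f) s)" if "lmap T" "lmap T'" for T T' :: "('c, 'r) wser \<Rightarrow> ('c, 'r) wser"
      using that by (auto simp: lmap_def intro: lfun_diff)
    show "lfun (\<lambda>f. coef ((f * g) * h) s - coef (f * (g * h)) s)"
      by (rule l[OF lmap_comp[OF m(1) m(1)] m(1)])
    show "lfun (\<lambda>f. coef ((g * f) * h) s - coef (g * (f * h)) s)"
      by (rule l[OF lmap_comp[OF m(1) m(2)] lmap_comp[OF m(2) m(1)]])
    show "lfun (\<lambda>f. coef ((g * h) * f) s - coef (g * (h * f)) s)"
      by (rule l[OF m(2) lmap_comp[OF m(2) m(2)]])
  qed
  have main: "depth_le p f \<Longrightarrow> depth_le q g \<Longrightarrow> depth_le r h \<Longrightarrow> p + q + r \<le> n \<Longrightarrow> (f * g) * h = f * (g * h)"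
    for n p q r and f g h :: "('c, 'r) wser"
  proof (induction n arbitrary: p q r f g h)
    case 0
    then have "depth_le 0 f" by simp
    then have "f = scal (coef f []) 1" by (intro wser_eqI) (auto simp: depth_le_def coef_one)
    then show ?case by (metis wser_mult_1(1) wser_mult_distribs(7))
  next
    case (Suc n)
    have C1: "(pg a z f * pg b w g) * pg c v h = pg a z f * (pg b w g * pg c v h)"
      if "depth_le p' f" "depth_le q' g" "depth_le r' h" "p = Suc p'" "q = Suc q'" "r = Suc r'" "generic (z - v) (w - v)"
      for p' q' r' f g h and a b c :: 'c and z w v :: 'r
      by (rule mult_assoc_pg[OF Suc.IH that(1-3) _ that(7)]) (use that(4-6) Suc.prems(4) in auto)
    have C2: "(f * pg b w g) * pg c v h = f * (pg b w g * pg c v h)"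
      if "depth_le p f" "depth_le q' g" "depth_le r' h" "q = Suc q'" "r = Suc r'" "w \<in> Lf" "v \<in> Lf" "w \<noteq> v"
      for q' r' f g h and b c :: 'c and w v :: 'r
    proof (rule wser_eqI)
      fix s
      \<comment> \<open>Exactly the points for which \<open>z - v\<close> is an
        \<open>F_q\<close>-multiple of \<open>w - v\<close> are removed.\<close>
      let ?S = "Lf - (\<lambda>k. v + k * (w - v)) ` Fq"
      have "coef ((f * pg b w g) * pg c v h) s - coef (f * (pg b w g * pg c v h)) s = 0"
      proof (rule lfun_eq_0[OF lf(1), where S = ?S and d = p])
        show "infinite ?S" by (intro Diff_infinite_finite finite_imageI finite_Fq infinite_Lf)
        show "coef ((pg a z k * pg b w g) * pg c v h) s - coef (pg a z k * (pg b w g * pg c v h)) s = 0"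
          if "p = Suc e" "z \<in> ?S" "depth_le e k" for a z k e
        proof -
          have "generic (z - v) (w - v)"
            by (rule generic_Lf)
              (use that \<open>w \<in> Lf\<close> \<open>v \<in> Lf\<close> \<open>w \<noteq> v\<close> in \<open>auto intro!: Lf_closed simp: image_iff algebra_simps\<close>)
          then show ?thesis
            using C1[of e k q' g r' h] \<open>depth_le q' g\<close> \<open>depth_le r' h\<close> \<open>q = _\<close> \<open>r = _\<close> that by simp
        qed
      qed (use that in auto)
      then show "coef ((f * pg b w g) * pg c v h) s = coef (f * (pg b w g * pg c v h)) s" by simp
    qed
    have C3: "(f * g) * pg c v h = f * (g * pg c v h)"
      if "depth_le p f" "depth_le q g" "depth_le r' h" "r = Suc r'" "v \<in> Lf" for r' f g h and c :: 'c and v :: 'r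
    proof (rule wser_eqI)
      fix s
      have "coef ((f * g) * pg c v h) s - coef (f * (g * pg c v h)) s = 0"
      proof (rule lfun_eq_0[OF lf(2), where S = "Lf - {v}" and d = q])
        show "infinite (Lf - {v} :: 'r set)" using infinite_Lf by simp
        show "coef ((f * pg a z k) * pg c v h) s - coef (f * (pg a z k * pg c v h)) s = 0"
          if "q = Suc e" "z \<in> Lf - {v}" "depth_le e k" for a z k e
          using C2[of f e k r' h z v] that \<open>depth_le p f\<close> \<open>depth_le r' h\<close> \<open>r = _\<close> \<open>v \<in> Lf\<close> by simp
      qed (use that in auto)
      then show "coef ((f * g) * pg c v h) s = coef (f * (g * pg c v h)) s" by simp
    qed
    show ?case
    proof (rule wser_eqI)
      fix s
      have "coef ((f * g) * h) s - coef (f * (g * h)) s = 0"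
        by (rule lfun_eq_0[OF lf(3), where S = Lf and d = r]) (use C3 Suc.prems infinite_Lf in auto)
      then show "coef ((f * g) * h) s = coef (f * (g * h)) s" by simp
    qed
  qed
  have fin: "(bas u * bas v) * bas w = bas u * (bas v * (bas w :: ('c, 'r) wser))" for u v w
    by (rule main[of "length u" _ "length v" _ "length w", OF _ _ _ order_refl]) (auto simp: depth_le_def)
  have 1: "(f * bas v) * bas w = f * (bas v * bas w)" for f :: "('c, 'r) wser" and v w
    using lfun_eq_0_words[OF lf(1)] fin by (intro wser_eqI) (metis (no_types, lifting) right_minus_eq)
  have 2: "(f * g) * bas w = f * (g * bas w)" for f g :: "('c, 'r) wser" and w
    using lfun_eq_0_words[OF lf(2)] 1 by (intro wser_eqI) (metis (no_types, lifting) right_minus_eq)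
  show ?thesis
    using lfun_eq_0_words[OF lf(3)] 2 by (intro wser_eqI) (metis (no_types, lifting) right_minus_eq)
qed

section \<open>The series as a commutative ring and as coefficients of further series\<close>

instance wser :: ("{finite,comm_monoid_mult}", fq_algebra) comm_ring_1
proof
  fix f g h :: "('a, 'b) wser"
  show "f * g * h = f * (g * h)" by (rule wser_mult_assoc)
  show "f * g = g * f" by (rule wser_mult_commute)
  show "(f + g) * h = f * h + g * h" by (rule wser_mult_distribs)
  show "1 * f = f" by simp
  have "coef 0 [] \<noteq> coef (1 :: ('a, 'b) wser) []" by (simp add: coef_one)
  then show "(0 :: ('a, 'b) wser) \<noteq> 1" by metis
qed

abbreviation cst :: "'r \<Rightarrow> ('c::{finite,comm_monoid_mult}, 'r::fq_algebra) wser" where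
  "cst r \<equiv> scal r 1"

lemma cst_hom: "cst (x + y) = cst x + cst y" "cst (x - y) = cst x - cst y" "cst (x * y) = cst x * cst y"
  "cst (- x) = - cst x" "cst 0 = 0" "cst 1 = 1"
  by (simp_all add: scal_distribs wser_mult_distribs mult.commute)

lemma cst_mult: "cst x * f = scal x f" "f * cst x = scal x f"
  by (simp_all add: wser_mult_distribs)

lemma cst_eq_iff [simp]: "(cst x :: ('c::{finite,comm_monoid_mult}, 'r::fq_algebra) wser) = cst y \<longleftrightarrow> x = y"
proof
  assume "(cst x :: ('c, 'r) wser) = cst y"
  then have "coef (cst x :: ('c, 'r) wser) [] = coef (cst y :: ('c, 'r) wser) []" by simp
  then show "x = y" by (simp add: coef_one)
qed simp

lemma subfield_set_cst:
  assumes "subfield_set (S :: 'r::fq_algebra set)"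
  shows "subfield_set (cst ` S :: ('c::{finite,comm_monoid_mult}, 'r) wser set)"
proof -
  note c = subfield_setD[OF assms]
  show ?thesis unfolding subfield_set_def
  proof (intro conjI ballI impI)
    show "1 \<in> cst ` S" using c(1) by (metis cst_hom(6) imageI)
    fix x assume x: "x \<in> (cst ` S :: ('c, 'r) wser set)"
    then obtain x' where x': "x = cst x'" "x' \<in> S" by blast
    show "x - y \<in> cst ` S" "x * y \<in> cst ` S" if "y \<in> cst ` S" for y
      using x' that c by (auto simp flip: cst_hom(2,3))
    show "\<exists>y\<in>cst ` S. x * y = 1" if "x \<noteq> 0"
    proof -
      have "x' \<noteq> 0" using that x' by auto
      then obtain y where "y \<in> S" "x' * y = 1" using assms x'(2) unfolding subfield_set_def by blast
      then show ?thesis using x' by (metis cst_hom(3,6) imageI)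
    qed
  qed
qed

instantiation wser :: ("{finite,comm_monoid_mult}", fq_algebra) fq_algebra
begin

definition "Fq = cst ` Fq"
definition "Lf = cst ` Lf"

instance
proof
  show "finite (Fq :: ('a, 'b) wser set)" by (simp add: Fq_wser_def finite_Fq)
  show "infinite (Lf :: ('a, 'b) wser set)"
    unfolding Lf_wser_def using infinite_Lf by (subst finite_image_iff) (auto simp: inj_on_def)
  show "Fq \<subseteq> (Lf :: ('a, 'b) wser set)" using Fq_subset_Lf by (auto simp: Fq_wser_def Lf_wser_def)
  show "subfield_set (Fq :: ('a, 'b) wser set)" "subfield_set (Lf :: ('a, 'b) wser set)"
    unfolding Fq_wser_def Lf_wser_def by (intro subfield_set_cst subfield_Fq subfield_Lf)+
qed

end

section \<open>The coproduct\<close>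

lemma coef_mult_cong:
  fixes f g :: "('c::{finite,comm_monoid_mult}, 'r::fq_algebra) wser"
  assumes "\<And>s'. wt s' \<le> wt s \<Longrightarrow> coef f s' = coef f' s'" "\<And>s'. wt s' \<le> wt s \<Longrightarrow> coef g s' = coef g' s'"
  shows "coef (f * g) s = coef (f' * g') s"
  unfolding times_wser_def coef_wser by (rule smul_cong) (use assms in auto)

section \<open>The weight grading and the additive series \<open>E\<close>\<close>

definition theta :: "'r::comm_ring_1 \<Rightarrow> ('c, 'r) wser \<Rightarrow> ('c, 'r) wser" where
  "theta z f = wser (\<lambda>s. z ^ wt s * coef f s)"

lemma coef_theta [simp]: "coef (theta z f) s = z ^ wt s * coef f s"
  by (simp add: theta_def)

lemma theta_1 [simp]: "theta z 1 = 1"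
  by (auto intro!: wser_eqI simp: coef_one)

text \<open>The product preserves total weight: \<open>(n, a)\<close> and
  \<open>(i - Suc n, b)\<close> together weigh as much as \<open>(i, c)\<close>, and the two letters
  of a correction weigh as much as \<open>(i, c)\<close> and \<open>x_j\<close>.\<close>

lemma theta_mult:
  fixes f g :: "('c::{finite,comm_monoid_mult}, 'r::fq_algebra) wser"
  shows "theta z (f * g) = theta z f * theta z g"
proof -
  have "coef (theta z f * theta z g) s = z ^ wt s * coef (f * g) s" for s
  proof (induction s arbitrary: f g rule: wt_induct)
    case (less s)
    show ?case
    proof (cases s)
      case (Cons x t)
      obtain i c where x: "x = (i, c)" by force
      have IH: "coef (theta z f * theta z g) s = z ^ wt s * coef (f * g) s" if "wt s \<le> wt t"
        for f g :: "('c, 'r) wser" and s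
        by (rule less.IH) (use that in \<open>simp add: Cons x\<close>)
      have l: "lq (n, a) (theta z h) = scal (z ^ Suc n) (theta z (lq (n, a) h))" for n a and h :: "('c, 'r) wser"
        by (intro wser_eqI) (simp add: power_add mult_ac)
      have 1: "coef (lq (i, c) (theta z f) * theta z g) t = z ^ wt s * coef (lq (i, c) f * g) t"
        "coef (theta z f * lq (i, c) (theta z g)) t = z ^ wt s * coef (f * lq (i, c) g) t"
        unfolding l by (simp_all add: wser_mult_distribs IH Cons x power_add mult_ac)
      have 2: "coef (lq (n, a) (theta z f) * lq (i - Suc n, b) (theta z g)) t
          = z ^ wt s * coef (lq (n, a) f * lq (i - Suc n, b) g) t" if "n < i" for n a b
      proof -
        have "z ^ wt s = z ^ Suc n * z ^ Suc (i - Suc n) * z ^ wt t"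
          unfolding power_add[symmetric] using that by (simp add: Cons x)
        then show ?thesis unfolding l by (simp add: wser_mult_distribs IH mult_ac)
      qed
      have 3: "coef (bas [(j, 1)] * (lq (n, a) (theta z f) * lq (i + j - n, b) (theta z g))) t
          = z ^ wt s * coef (bas [(j, 1)] * (lq (n, a) f * lq (i + j - n, b) g)) t" if "n \<le> i + j" for n a b j
      proof -
        have "coef (bas [(j, 1)] * (theta z (lq (n, a) f) * theta z (lq (i + j - n, b) g))) t
            = coef (bas [(j, 1)] * theta z (lq (n, a) f * lq (i + j - n, b) g)) t"
          by (rule coef_mult_cong) (simp_all add: IH)
        moreover have "z ^ Suc n * z ^ Suc (i + j - n) = z ^ Suc i * z ^ Suc j"
          unfolding power_add[symmetric] using that by simp
        moreover have "scal (z ^ Suc j) (bas [(j, 1)]) = (theta z (bas [(j, 1)]) :: ('c, 'r) wser)"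
          by (auto intro!: wser_eqI)
        then have "z ^ Suc j * coef (bas [(j, 1)] * theta z h) t = z ^ wt t * coef (bas [(j, 1)] * h) t"
          for h :: "('c, 'r) wser"
          using IH[of t "bas [(j, 1)]" h] by (metis coef_simps(2) order_refl wser_mult_distribs(7))
        ultimately have "z ^ Suc n * z ^ Suc (i + j - n) * coef (bas [(j, 1)] * (theta z (lq (n, a) f) * theta z (lq (i + j - n, b) g))) t
            = z ^ Suc i * (z ^ wt t * coef (bas [(j, 1)] * (lq (n, a) f * lq (i + j - n, b) g)) t)"
          by (simp only: mult.assoc)
        then show ?thesis unfolding l Cons x by (simp only: wser_mult_distribs coef_simps wt_simps fst_conv power_add mult_ac)
      qed
      show ?thesis unfolding Cons x coef_mult_Cons 1
        by (simp add: 2 3 Cons x sum_distrib_left distrib_left mult.left_commute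
            if_distrib[of "\<lambda>r. _ * r"] cong: if_cong)
    qed simp
  qed
  then show ?thesis by (intro wser_eqI) simp
qed

lemma scal_power: "scal r f ^ n = scal (r ^ n) (f ^ n)"
  by (induction n) (simp_all add: wser_mult_distribs mult.commute)

lemma theta_power: "theta z (f ^ n) = theta z (f :: ('c::{finite,comm_monoid_mult}, 'r::fq_algebra) wser) ^ n"
  by (induction n) (simp_all add: theta_mult)

text \<open>\<open>1 - Ys\<close> is \<open>t G(t)\<close> at \<open>t = 1\<close>; applying
  \<open>theta\<close> restores the variable from the weight.\<close>

definition Ys :: "('c::{finite,comm_monoid_mult}, 'r::fq_algebra) wser" where
  "Ys = - Hp 1 1"

text \<open>\<open>Js r\<close> is the expansion of \<open>(1 - Ys)\<^sup>-\<^sup>r\<close>.\<close>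
definition Js :: "nat \<Rightarrow> ('c::{finite,comm_monoid_mult}, 'r::fq_algebra) wser" where
  "Js r = wser (\<lambda>s. \<Sum>m\<le>wt s. of_nat ((r + m - 1) choose m) * coef (Ys ^ m) s)"

lemma coef_Ys_power: "wt s < m \<Longrightarrow> coef (Ys ^ m) s = 0"
proof (induction m arbitrary: s)
  case (Suc m)
  have "coef Ys s' = 0" if "wt s' < 1" for s'
    using that by (cases s') (auto simp: Ys_def)
  then show ?case unfolding power_Suc
    by (rule coef_mult_order[of 1 _ m]) (use Suc in auto)
qed simp

lemma coef_of_nat_mult: "coef (of_nat n * f) s = of_nat n * coef f s"
  by (induction n) (simp_all add: distrib_right)

lemma coef_Js_truncate:
  assumes "wt s \<le> N"
  shows "coef (Js r) s = coef (\<Sum>m\<le>N. of_nat ((r + m - 1) choose m) * Ys ^ m) s"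
  unfolding Js_def coef_wser coef_sum coef_of_nat_mult
  by (rule sum.mono_neutral_left) (use assms in \<open>auto simp: coef_Ys_power\<close>)

lemma Js_Suc: "(1 - Ys) * Js (Suc r) = (Js r :: ('c::{finite,comm_monoid_mult}, 'r::fq_algebra) wser)"
proof (rule wser_eqI)
  fix s :: "(nat \<times> 'c) list"
  \<comment> \<open>By Pascal's rule the truncated sums telescope up to a remainder in
    \<open>y^(N+1)\<close>. For \<open>y = Ys\<close> and \<open>N = wt s\<close> this lies beyond
    the coefficient being read.\<close>
  have t: "(1 - y) * (\<Sum>m\<le>N. of_nat ((r + m) choose m) * y ^ m)
      = (\<Sum>m\<le>N. of_nat ((r + m - 1) choose m) * y ^ m) - of_nat ((r + N) choose N) * y ^ Suc N" for y :: "('c, 'r) wser" and N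
  proof (induction N)
    case (Suc N)
    have "(r + Suc N) choose Suc N = ((r + N) choose N) + ((r + N) choose Suc N)"
      by simp
    then show ?case using Suc by (simp add: algebra_simps)
  qed (simp add: algebra_simps)
  have "coef ((1 - Ys) * Js (Suc r)) s
      = coef ((1 - Ys :: ('c, 'r) wser) * (\<Sum>m\<le>wt s. of_nat ((r + m) choose m) * Ys ^ m)) s"
    by (rule coef_mult_cong) (simp_all add: coef_Js_truncate[of _ "wt s" "Suc r"])
  also have "\<dots> = coef (Js r) s"
    unfolding t by (simp add: coef_Js_truncate[of s "wt s"] coef_of_nat_mult coef_Ys_power del: power_Suc)
  finally show "coef ((1 - Ys) * Js (Suc r)) s = coef (Js r :: ('c, 'r) wser) s" .
qed

lemma Js_0: "Js 0 = 1"
proof (rule wser_eqI)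
  fix s :: "(nat \<times> 'a) list"
  \<comment> \<open>With truncated subtraction, \<open>(m - 1) choose m\<close> is 1 at
    \<open>m = 0\<close> and 0 afterwards.\<close>
  have "coef (Js 0) s = (\<Sum>m\<le>wt s. if m = 0 then coef 1 s else 0)"
    unfolding Js_def coef_wser by (intro sum.cong refl) (auto simp: binomial_eq_0)
  then show "coef (Js 0) s = coef (1 :: ('a, 'b) wser) s" by simp
qed

lemma Js_power: "Js r = Js 1 ^ r"
proof (induction r)
  case (Suc r)
  have "Js (Suc r) = ((1 - Ys) * Js (Suc 0)) * Js (Suc r)" unfolding Js_Suc by (simp add: Js_0)
  also have "\<dots> = Js 1 * ((1 - Ys) * Js (Suc r))" by (simp add: mult_ac)
  finally have "Js (Suc r) = Js 1 * Js r" unfolding Js_Suc .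
  then show ?case using Suc.IH by (metis power_Suc)
qed (simp add: Js_0)

lemma Js_1_inverse: "(1 - Ys) * Js 1 = 1"
  using Js_Suc[of 0] by (simp add: Js_0)

text \<open>Equal to \<open>1 / G(z)\<close> when \<open>z\<close> is a unit, but written without
  \<open>uinv z\<close> and hence meaningful at every point, as \<open>cop_pg\<close>
  requires.\<close>

definition Es :: "'r \<Rightarrow> ('c::{finite,comm_monoid_mult}, 'r::fq_algebra) wser" where
  "Es z = scal z (theta z (Js 1))"

lemma theta_Ys: "theta z (1 - Ys) = 1 + scal z (Hp z 1)"
proof (rule wser_eqI)
  fix s show "coef (theta z (1 - Ys)) s = coef (1 + scal z (Hp z 1)) s"
    by (cases s; cases "hd s") (auto simp: Ys_def coef_one mult_ac)
qed

lemma Es_inverse: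
  assumes "z dvd 1"
  shows "Es z * Gs z = (1 :: ('c::{finite,comm_monoid_mult}, 'r::fq_algebra) wser)"
proof -
  have z: "z * uinv z = 1" using uinv_right[OF assms] .
  have "Gs z = scal (uinv z) (theta z (1 - Ys) :: ('c, 'r) wser)"
    unfolding theta_Ys Gs_def using z by (simp add: scal_distribs mult.commute)
  then have "Es z * Gs z = scal (z * uinv z) (theta z ((1 - Ys) * Js 1) :: ('c, 'r) wser)"
    unfolding Es_def theta_mult by (simp add: wser_mult_distribs mult.commute)
  then show ?thesis unfolding Js_1_inverse z by simp
qed

lemma Es_unit: "z dvd 1 \<Longrightarrow> Es z dvd (1 :: ('c::{finite,comm_monoid_mult}, 'r::fq_algebra) wser)"
  by (metis Es_inverse dvd_triv_left)

lemma Es_scale: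
  assumes "m \<in> Fq" "m \<noteq> 0"
  shows "Es (m * z) = scal m (Es z :: ('c::{finite,comm_monoid_mult}, 'r::fq_algebra) wser)"
proof -
  have "theta (m * z) (1 - Ys) = (theta z (1 - Ys) :: ('c, 'r) wser)"
  proof (rule wser_eqI)
    fix s :: "(nat \<times> 'c) list"
    have "(m * z) * (hc n * (m * z) ^ n) = z * (hc n * z ^ n)" for n
    proof -
      have "(m * z) * (hc n * (m * z) ^ n) = (m ^ Suc n * hc n) * (z * z ^ n)"
        by (simp only: power_mult_distrib power_Suc mult_ac)
      then show ?thesis unfolding hc_scale[OF assms] by (simp only: mult_ac)
    qed
    then show "coef (theta (m * z) (1 - Ys)) s = coef (theta z (1 - Ys) :: ('c, 'r) wser) s"
      unfolding theta_Ys by (cases s; cases "hd s") (auto simp: coef_one)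
  qed
  moreover have "theta t (1 - Ys) * theta t (Js 1) = (1 :: ('c, 'r) wser)" for t
    unfolding theta_mult[symmetric] Js_1_inverse by simp
  ultimately have "theta (m * z) (Js 1) = (theta z (Js 1) :: ('c, 'r) wser)"
    by (metis uinv_eqI)
  then show ?thesis by (simp add: Es_def)
qed

text \<open>Multiply \<open>G(x) G(y) = G(x - y) (G(y) - G(x))\<close> by
  \<open>E(x - y) E(x) E(y)\<close>.\<close>

lemma Es_diff:
  assumes "generic x y"
  shows "Es (x - y) = Es x - (Es y :: ('c::{finite,comm_monoid_mult}, 'r::fq_algebra) wser)"
proof -
  let ?E = "Es :: 'r \<Rightarrow> ('c, 'r) wser" and ?G = "Gs :: 'r \<Rightarrow> ('c, 'r) wser"
  note i = Es_inverse[OF generic_units(1)[OF assms], where ?'c = 'c]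
    Es_inverse[OF generic_units(2)[OF assms], where ?'c = 'c] Es_inverse[OF generic_units(3)[OF assms], where ?'c = 'c]
  have "?E (x - y) = ?E (x - y) * ((?E x * ?G x) * (?E y * ?G y))" by (simp only: i mult_1_right)
  also have "\<dots> = ?E (x - y) * ?E x * ?E y * (?G x * ?G y)" by (simp only: mult_ac)
  also have "\<dots> = (?E (x - y) * ?G (x - y)) * ((?E y * ?G y) * ?E x - (?E x * ?G x) * ?E y)"
    unfolding Gs_three_term[OF assms] by (simp add: algebra_simps)
  finally show ?thesis unfolding i by simp
qed

section \<open>The coproduct as evaluation at \<open>E(z)\<close>\<close>

definition graded_part :: "nat \<Rightarrow> ('c, 'r::zero) wser \<Rightarrow> ('c, 'r) wser" where
  "graded_part k f = wser (\<lambda>s. if wt s = k then coef f s else 0)"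

lemma coef_graded_part [simp]: "coef (graded_part k f) s = (if wt s = k then coef f s else 0)"
  by (simp add: graded_part_def)

lemma coef_theta_mult:
  fixes f g :: "('c::{finite,comm_monoid_mult}, 'r::fq_algebra) wser"
  shows "coef (theta z f * g) s = (\<Sum>k\<le>wt s. z ^ k * coef (graded_part k f * g) s)"
proof -
  have "coef (theta z f * g) s = coef ((\<Sum>k\<le>wt s. scal (z ^ k) (graded_part k f)) * g) s"
    by (rule coef_mult_cong) (simp_all add: coef_sum if_distrib[of "\<lambda>r. _ * r"] cong: if_cong)
  then show ?thesis by (simp add: sum_distrib_right coef_sum wser_mult_distribs)
qed

text \<open>A letter of weight \<open>i\<close> contributes \<open>x_r\<close> on the left and, on
  the right, the part of weight \<open>i - r\<close> of \<open>(1 - Ys)^(-(r-1))\<close>. Here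
  \<open>fst x\<close> is \<open>r - 1\<close> because of the shifted indices, and \<open>k\<close>
  is \<open>i - r\<close>; larger \<open>k\<close> cannot reach the coefficient at
  \<open>q\<close>.\<close>

primrec cop_at :: "(nat \<times> 'c) list \<Rightarrow> ('c::{finite,comm_monoid_mult}, 'r::fq_algebra) wser \<Rightarrow> ('c, 'r) wser" where
  "cop_at [] f = f"
| "cop_at (x # p) f = wser (\<lambda>q. \<Sum>k\<le>wt q.
     coef (graded_part k (Js 1 ^ fst x) * cop_at p (lq (fst x + k, snd x) f)) q)"

text \<open>Tensor powers are iterated series: \<open>coef (coef (cop f) p) q\<close> is the coefficient of \<open>p \<otimes> q\<close>.\<close>
definition cop :: "('c::{finite,comm_monoid_mult}, 'r::fq_algebra) wser \<Rightarrow> ('c, ('c, 'r) wser) wser" where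
  "cop f = wser (\<lambda>p. cop_at p f)"

lemma coef_cop [simp]: "coef (cop f) p = cop_at p f"
  by (simp add: cop_def)

lemma cop_at_linear: "cop_at p (scal r f + g) = scal r (cop_at p f) + cop_at p g"
proof (induction p arbitrary: f g)
  case (Cons x p)
  show ?case
    by (rule wser_eqI) (simp add: Cons distrib_left wser_mult_distribs sum.distrib sum_distrib_left)
qed simp

lemma cop_at_order:
  assumes "\<And>s. wt s \<le> wt p + wt q \<Longrightarrow> coef f s = 0"
  shows "coef (cop_at p f) q = 0"
  using assms
proof (induction p arbitrary: f q)
  case (Cons x p)
  have "coef (graded_part k (Js 1 ^ fst x) * cop_at p (lq (fst x + k, snd x) f)) q = 0" if "k \<le> wt q" for k
  proof (rule coef_mult_order[of k _ "Suc (wt q - k)"])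
    show "coef (cop_at p (lq (fst x + k, snd x) f)) s' = 0" if "wt s' < Suc (wt q - k)" for s'
      by (rule Cons.IH) (use that \<open>k \<le> wt q\<close> Cons.prems in auto)
  qed (use that in auto)
  then show ?case by simp
qed simp

lemma lmap_cop_at: "lmap (cop_at p)"
  unfolding lmap_def lfun_def
  by (auto simp: cop_at_linear intro!: exI[of _ "wt p + wt _"] cop_at_order)

lemma cop_at_0 [simp]: "cop_at p 0 = 0"
  using cop_at_linear[of p "-1" 0 0] by (simp add: scal_distribs)

lemma cop_at_scal: "cop_at p (scal r f) = scal r (cop_at p f)"
  using cop_at_linear[of p r f 0] by simp

lemma cop_linear:
  "cop (f + g) = cop f + cop g" "cop (scal r f) = scal (cst r) (cop f)" "cop (f - g) = cop f - cop g"
  "cop 0 = 0" "cop (- f) = - cop f"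
proof -
  have 1: "cop_at p (f + g) = cop_at p f + cop_at p g" for p and f g :: "('a, 'b) wser"
    using cop_at_linear[of p 1 f g] by simp
  have 2: "cop_at p (- f) = - cop_at p f" for p and f :: "('a, 'b) wser"
    using cop_at_scal[of p "-1" f] by (simp add: scal_distribs)
  show "cop (f + g) = cop f + cop g" by (intro wser_eqI) (simp add: 1)
  show "cop (- f) = - cop f" by (intro wser_eqI) (simp add: 2)
  show "cop (f - g) = cop f - cop g" using 1[of _ f "- g"] by (intro wser_eqI) (simp add: 2)
  show "cop 0 = 0" by (intro wser_eqI) simp
  show "cop (scal r f) = scal (cst r) (cop f)" by (intro wser_eqI) (simp add: cop_at_scal cst_mult)
qed

lemma cop_sum: "cop (\<Sum>x\<in>A. f x) = (\<Sum>x\<in>A. cop (f x))"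
  by (induction A rule: infinite_finite_induct) (simp_all add: cop_linear)

lemma cop_1 [simp]: "cop 1 = 1"
proof (rule wser_eqI)
  fix p :: "(nat \<times> 'a) list"
  show "coef (cop 1) p = coef 1 p"
  proof (cases p)
    case (Cons x p')
    have "cop_at p 1 = 0" unfolding Cons by (rule wser_eqI) (simp add: one_wser_def)
    then show ?thesis by (simp add: Cons coef_one)
  qed (simp add: coef_one)
qed

lemma cop_cst: "cop (cst r) = cst (cst r)"
  by (simp add: cop_linear)

text \<open>In the sum over \<open>k\<close> the factor \<open>z^(r + k)\<close> splits:
  \<open>z^k\<close> regrades \<open>Js 1 ^ r\<close> to \<open>theta z (Js 1 ^ r)\<close>, and
  \<open>z^r\<close> completes it to \<open>Es z ^ r\<close>.\<close>

lemma cop_pg: "cop (pg a z f) = cst (pg a z f) + pg a (Es z) (cop f)"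
proof (rule wser_eqI)
  fix p :: "(nat \<times> 'a) list"
  show "coef (cop (pg a z f)) p = coef (cst (pg a z f) + pg a (Es z) (cop f)) p"
  proof (cases p)
    case Nil
    then show ?thesis by (simp add: coef_one)
  next
    case (Cons x p')
    obtain r c where x: "x = (r, c)" by force
    have E: "Es z ^ r = scal (z ^ r) (theta z (Js 1 ^ r) :: ('a, 'b) wser)"
      unfolding Es_def scal_power theta_power ..
    have "cop_at p (pg a z f) = (if c = a then Es z ^ r * cop_at p' f else 0)"
    proof (rule wser_eqI)
      fix q
      have "coef (cop_at p (pg a z f)) q = (if c = a then
          (\<Sum>k\<le>wt q. z ^ (r + k) * coef (graded_part k (Js 1 ^ r) * cop_at p' f) q) else 0)"
        unfolding Cons x by (simp add: cop_at_scal wser_mult_distribs)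
      also have "\<dots> = coef (if c = a then Es z ^ r * cop_at p' f else 0) q"
        unfolding E by (simp add: wser_mult_distribs coef_theta_mult sum_distrib_left power_add mult.assoc)
      finally show "coef (cop_at p (pg a z f)) q = coef (if c = a then Es z ^ r * cop_at p' f else 0) q" .
    qed
    then show ?thesis by (simp add: Cons x coef_one)
  qed
qed

lemma cst_sum: "cst (\<Sum>x\<in>A. f x) = (\<Sum>x\<in>A. cst (f x))"
  by (induction A rule: infinite_finite_induct) (simp_all add: cst_hom)

text \<open>Only \<open>F_q\<close>-multiples of \<open>t\<close> occur as points in
  \<open>Hp t 1\<close>, and \<open>Es\<close> commutes with them, so \<open>cop (Hp t 1)\<close> is
  \<open>Hp (Es t) 1\<close> plus the constant \<open>Hp t 1\<close>. This constant joins
  \<open>1 / t\<close> to form \<open>Gs t\<close>, which is the pole term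
  \<open>1 / Es t\<close>.\<close>

lemma cop_Gs:
  assumes "t dvd 1"
  shows "cop (Gs t) = (Gs (Es t) :: ('c::{finite,comm_monoid_mult}, ('c, 'r::fq_algebra) wser) wser)"
proof -
  have F: "(Fq - {0} :: ('c, 'r) wser set) = cst ` (Fq - {0})"
    using cst_eq_iff[of _ "0 :: 'r", where ?'c = 'c] by (auto simp: Fq_wser_def)
  have "cop (Hp t 1 :: ('c, 'r) wser)
      = - (\<Sum>l\<in>Fq - {0}. scal (cst l) (cst (pg 1 (l * t) 1) + pg 1 (cst l * Es t) 1))"
    unfolding Hp_eq_sum cop_linear cop_sum cop_pg
    by (intro arg_cong[of _ _ uminus] sum.cong refl) (simp add: Es_scale cst_mult)
  also have "\<dots> = cst (Hp t 1) - (\<Sum>l\<in>Fq - {0}. scal (cst l) (pg 1 (cst l * Es t) 1))"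
    unfolding Hp_eq_sum scal_distribs(1) sum.distrib cst_hom(4) cst_sum by (simp add: cst_mult)
  also have "(\<Sum>l\<in>Fq - {0}. scal (cst l) (pg 1 (cst l * Es t) 1)) = - Hp (Es t) (1 :: ('c, ('c, 'r) wser) wser)"
    unfolding Hp_eq_sum F by (subst sum.reindex) (auto simp: inj_on_def)
  finally have H: "cop (Hp t 1 :: ('c, 'r) wser) = cst (Hp t 1) + Hp (Es t) 1" by simp
  have "uinv (Es t) = (Gs t :: ('c, 'r) wser)" by (rule uinv_eqI[OF Es_inverse[OF assms]])
  then show ?thesis
    unfolding Gs_def[of "Es t"] by (simp add: Gs_def cop_linear H scal_distribs)
qed

text \<open>\<open>\<Psi>\<close> is linear over the series in the right tensor factor, the
  composite only over \<open>'r\<close>. Expanding \<open>\<Psi>\<close> over finitely many left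
  words leaves maps \<open>cop_at s\<close> followed by a multiplication.\<close>

lemma lfun_cop:
  fixes \<Psi> :: "('c::{finite,comm_monoid_mult}, ('c, 'r::fq_algebra) wser) wser \<Rightarrow> ('c, 'r) wser"
  assumes "lfun \<Psi>"
  shows "lfun (\<lambda>f. coef (\<Psi> (cop f)) q)"
proof -
  obtain N where N: "\<forall>f. \<Psi> f = (\<Sum>s | wt s \<le> N. coef f s * \<Psi> (bas s))"
    using lfun_expand_ex[OF assms] by blast
  have "coef (\<Psi> (cop f)) q = (\<Sum>s | wt s \<le> N. coef (cop_at s f * \<Psi> (bas s)) q)" for f
    by (simp only: N[THEN spec, of "cop f"] coef_sum coef_cop)
  then have "(\<lambda>f. coef (\<Psi> (cop f)) q) = (\<lambda>f. \<Sum>s | wt s \<le> N. coef (cop_at s f * \<Psi> (bas s)) q)"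
    by (rule ext)
  moreover have "lfun (\<lambda>f. coef (cop_at s f * \<Psi> (bas s)) q)" for s
  proof -
    have "lmap (\<lambda>f. cop_at s f * \<Psi> (bas s))" by (rule lmap_comp[OF lmap_mult(1) lmap_cop_at])
    then show ?thesis by (simp add: lmap_def)
  qed
  ultimately show ?thesis by (simp add: lfun_sum)
qed

lemma cop_mult_pg:
  fixes f g :: "('c::{finite,comm_monoid_mult}, 'r::fq_algebra) wser"
  assumes IH: "\<And>p q f g. depth_le p f \<Longrightarrow> depth_le q g \<Longrightarrow> p + q \<le> n \<Longrightarrow> cop (f * g) = cop f * cop (g :: ('c, 'r) wser)"
    and d: "depth_le p f" "depth_le q g" "p + q + 1 \<le> n" and generic: "generic z w"
  shows "cop (pg a z f * pg b w g) = cop (pg a z f) * cop (pg b w g)"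
proof -
  define A B where AB: "A = pg a z f" "B = pg b w g"
  define A2 B2 where AB2: "A2 = pg a (Es z) (cop f)" "B2 = pg b (Es w) (cop g)"
  have c: "cop A = cst A + A2" "cop B = cst B + B2"
    by (simp_all add: AB AB2 cop_pg)
  define Y where "Y = Gs (z - w) * (f * g)"
  note u = generic_units(3)[OF generic]
  have E: "Es z - Es w dvd (1 :: ('c, 'r) wser)" unfolding Es_diff[OF generic, symmetric] by (rule Es_unit[OF u])
  have dA: "depth_le (Suc p) A" and dB: "depth_le (Suc q) B" using d by (simp_all add: AB depth_le_pg)
  have IH1: "cop (f * B) = cop f * cop B" by (rule IH[OF d(1) dB]) (use d in simp)
  have IH2: "cop (A * g) = cop A * cop g" by (rule IH[OF dA d(2)]) (use d in simp)
  \<comment> \<open>\<open>Y\<close> has depth \<open>p + q + 1\<close>, one less than the bound for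
    \<open>A * B\<close>, so the hypothesis covers it. Additivity of \<open>Es\<close> then provides
    the very value of \<open>G\<close> that the product formula at \<open>Es z\<close> and
    \<open>Es w\<close> asks for.\<close>
  have IH3: "cop Y = Gs (Es z - Es w) * (cop f * cop g)"
  proof -
    have "cop Y = cop (Gs (z - w)) * cop (f * g)"
      unfolding Y_def by (rule IH[OF depth_le_Gs depth_le_mult[OF d(1,2)]]) (use d in simp)
    also have "cop (f * g) = cop f * cop g" by (rule IH[OF d(1,2)]) (use d in simp)
    finally show ?thesis unfolding cop_Gs[OF u] Es_diff[OF generic] .
  qed
  have P: "A * B = pg a z (f * B) + pg b w (A * g) + (pg (a * b) z Y - pg (a * b) w Y)"
    unfolding AB Y_def by (rule pg_mult_pg[OF u])
  have "cop (A * B) = cst (A * B) + pg a (Es z) (cop (f * B)) + pg b (Es w) (cop (A * g))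
      + (pg (a * b) (Es z) (cop Y) - pg (a * b) (Es w) (cop Y))"
    unfolding P cop_linear cop_pg cst_hom by (simp add: algebra_simps)
  also have "\<dots> = cst A * cst B + pg a (Es z) (cop f * cop B) + pg b (Es w) (cop A * cop g)
      + (pg (a * b) (Es z) (cop Y) - pg (a * b) (Es w) (cop Y))"
    unfolding IH1 IH2 cst_hom ..
  also have "pg a (Es z) (cop f * cop B) = A2 * cst B + pg a (Es z) (cop f * B2)"
    unfolding c AB2 by (simp add: distrib_left pg_linear cst_mult)
  also have "pg b (Es w) (cop A * cop g) = cst A * B2 + pg b (Es w) (A2 * cop g)"
    unfolding c AB2 by (simp add: distrib_right pg_linear cst_mult)
  also have "cst A * cst B + (A2 * cst B + pg a (Es z) (cop f * B2)) + (cst A * B2 + pg b (Es w) (A2 * cop g))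
      + (pg (a * b) (Es z) (cop Y) - pg (a * b) (Es w) (cop Y))
      = cst A * cst B + A2 * cst B + cst A * B2 + A2 * B2"
  proof -
    have "A2 * B2 = pg a (Es z) (cop f * B2) + pg b (Es w) (A2 * cop g)
      + (pg (a * b) (Es z) (cop Y) - pg (a * b) (Es w) (cop Y))"
      unfolding AB2 IH3 by (rule pg_mult_pg[OF E])
    then show ?thesis by simp
  qed
  finally show ?thesis unfolding AB[symmetric] c by (simp add: algebra_simps)
qed

text \<open>The scheme of the associativity proof with two factors: induction on total depth,
  generating series at generic points, then passage from words to arbitrary series.\<close>

lemma cop_mult:
  fixes f g :: "('c::{finite,comm_monoid_mult}, 'r::fq_algebra) wser"
  shows "cop (f * g) = cop f * cop g"
proof -
  let ?\<phi> = "\<lambda>P Q g f. coef (coef (cop (f * g)) P) Q - coef (coef (cop f * cop g) P) Q"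
  have lf: "lfun (?\<phi> P Q g)" for P Q and g :: "('c, 'r) wser"
  proof (rule lfun_diff)
    show "lfun (\<lambda>f. coef (coef (cop (f * g)) P) Q)"
    proof -
      have "lmap (\<lambda>f. cop_at P (f * g))" by (rule lmap_comp[OF lmap_cop_at lmap_mult(1)])
      then show ?thesis by (simp add: lmap_def)
    qed
    show "lfun (\<lambda>f. coef (coef (cop f * cop g) P) Q)"
      by (rule lfun_cop[of "\<lambda>T. coef (T * cop g) P"]) (use lmap_mult(1) in \<open>auto simp: lmap_def\<close>)
  qed
  have main: "depth_le p f \<Longrightarrow> depth_le q g \<Longrightarrow> p + q \<le> n \<Longrightarrow> cop (f * g) = cop f * cop g"
    for n p q and f g :: "('c, 'r) wser"
  proof (induction n arbitrary: p q f g)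
    case 0
    then have "f = cst (coef f [])" by (intro wser_eqI) (auto simp: depth_le_def coef_one)
    then show ?case by (metis cop_cst cop_linear(2) cst_mult(1))
  next
    case (Suc n)
    have C1: "cop (f * pg b w g) = cop f * cop (pg b w g)"
      if "depth_le p f" "depth_le q' g" "q = Suc q'" "w \<in> Lf - {0}" for q' f g and b :: 'c and w :: 'r
    proof (intro wser_eqI)
      fix P Q
      let ?S = "Lf - (\<lambda>k. k * w) ` Fq"
      have "?\<phi> P Q (pg b w g) f = 0"
      proof (rule lfun_eq_0[OF lf, where S = ?S and d = p])
        show "infinite ?S" by (intro Diff_infinite_finite finite_imageI finite_Fq infinite_Lf)
        show "?\<phi> P Q (pg b w g) (pg a z k) = 0" if "p = Suc e" "z \<in> ?S" "depth_le e k" for a z k e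
        proof -
          have "generic z w" by (rule generic_Lf) (use that \<open>w \<in> Lf - {0}\<close> in auto)
          then have "cop (pg a z k * pg b w g) = cop (pg a z k) * cop (pg b w g)"
            by (intro cop_mult_pg[OF Suc.IH that(3) \<open>depth_le q' g\<close>]) (use that \<open>depth_le q' g\<close> \<open>q = _\<close> Suc.prems(3) in auto)
          then show ?thesis by simp
        qed
      qed (use that in auto)
      then show "coef (coef (cop (f * pg b w g)) P) Q = coef (coef (cop f * cop (pg b w g)) P) Q" by simp
    qed
    show ?case
    proof (intro wser_eqI)
      fix P Q
      have "?\<phi> P Q f g = 0"
      proof (rule lfun_eq_0[OF lf, where S = "Lf - {0}" and d = q])
        show "infinite (Lf - {0} :: 'r set)" using infinite_Lf by simp
        show "?\<phi> P Q f (pg a z k) = 0" if "q = Suc e" "z \<in> Lf - {0}" "depth_le e k" for a z k e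
          using C1[of f e k z a] that Suc.prems(1) by (simp add: mult.commute)
      qed (use Suc.prems in auto)
      then show "coef (coef (cop (f * g)) P) Q = coef (coef (cop f * cop g) P) Q" by (simp add: mult.commute)
    qed
  qed
  have 0: "cop (bas u * bas v) = cop (bas u) * cop (bas v :: ('c, 'r) wser)" for u v
    by (rule main[of "length u" _ "length v", OF _ _ order_refl]) (auto simp: depth_le_def)
  have 1: "cop (f * bas v) = cop f * cop (bas v)" for f :: "('c, 'r) wser" and v
    using lfun_eq_0_words[OF lf] 0 by (intro wser_eqI) (metis (no_types, lifting) right_minus_eq)
  show ?thesis
    using lfun_eq_0_words[OF lf] 1 by (intro wser_eqI) (metis (no_types, lifting) right_minus_eq mult.commute)
qed

lemma cop_power: "cop (f ^ n) = cop f ^ n"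
  by (induction n) (simp_all add: cop_mult)

text \<open>Both sides invert \<open>Gs (Es z)\<close>, the left one because \<open>cop\<close> is a
  ring homomorphism.\<close>

lemma cop_Es:
  assumes "z dvd 1"
  shows "cop (Es z :: ('c::{finite,comm_monoid_mult}, 'r::fq_algebra) wser) = Es (Es z)"
proof -
  have "cop (Es z) * Gs (Es z) = (1 :: ('c, ('c, 'r) wser) wser)"
    unfolding cop_Gs[OF assms, symmetric] cop_mult[symmetric] Es_inverse[OF assms] by simp
  moreover have "Es (Es z) * Gs (Es z) = (1 :: ('c, ('c, 'r) wser) wser)"
    by (rule Es_inverse[OF Es_unit[OF assms]])
  ultimately show ?thesis by (metis uinv_eqI mult.commute)
qed

text \<open>The map id tensor Delta: it acts on the coefficients, that is on the right tensor
  factor.\<close>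

definition map_cop :: "('c::{finite,comm_monoid_mult}, ('c, 'r::fq_algebra) wser) wser \<Rightarrow>
    ('c, ('c, ('c, 'r) wser) wser) wser" where
  "map_cop T = wser (\<lambda>p. cop (coef T p))"

lemma coef_map_cop [simp]: "coef (map_cop T) p = cop (coef T p)"
  by (simp add: map_cop_def)

text \<open>The outer \<open>cop\<close> on the right is taken over the coefficient ring of the right tensor factor,
  so that it acts as \<open>\<Delta> \<otimes> id\<close>.\<close>
lemma cop_coassoc:
  fixes f :: "('c::{finite,comm_monoid_mult}, 'r::fq_algebra) wser"
  shows "map_cop (cop f) = cop (cop f)"
proof -
  let ?\<phi> = "\<lambda>p p' q f. coef (coef (coef (map_cop (cop f)) p) p') q - coef (coef (coef (cop (cop f)) p) p') q"
  have lf: "lfun (?\<phi> p p' q :: ('c, 'r) wser \<Rightarrow> 'r)" for p p' q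
  proof (rule lfun_diff)
    show "lfun (\<lambda>f :: ('c, 'r) wser. coef (coef (coef (map_cop (cop f)) p) p') q)"
    proof -
      have "lmap (\<lambda>f :: ('c, 'r) wser. cop_at p' (cop_at p f))" by (rule lmap_comp[OF lmap_cop_at lmap_cop_at])
      then show ?thesis by (simp add: lmap_def)
    qed
    show "lfun (\<lambda>f :: ('c, 'r) wser. coef (coef (coef (cop (cop f)) p) p') q)"
      unfolding coef_cop[of "cop _"]
      by (rule lfun_cop[of "\<lambda>T. coef (cop_at p T) p'"]) (use lmap_cop_at in \<open>auto simp: lmap_def\<close>)
  qed
  have main: "depth_le d f \<Longrightarrow> map_cop (cop f) = cop (cop f)" for d and f :: "('c, 'r) wser"
  proof (induction d arbitrary: f rule: less_induct)
    case (less d)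
    show ?case
    proof (intro wser_eqI)
      fix p p' q
      have "?\<phi> p p' q f = 0"
      proof (rule lfun_eq_0[OF lf, where S = "Lf - {0}" and d = d])
        show "infinite (Lf - {0} :: 'r set)" using infinite_Lf by simp
        have "map_cop (1 :: ('c, ('c, 'r) wser) wser) = 1"
          by (rule wser_eqI) (simp add: coef_one cop_linear(4))
        then show "?\<phi> p p' q (1 :: ('c, 'r) wser) = 0" by (simp only: cop_1 diff_self)
        fix a :: 'c and z e and k :: "('c, 'r) wser" assume e: "d = Suc e" "depth_le e k" and z: "z \<in> Lf - {0 :: 'r}"
        have u: "z dvd 1" using z Lf_unit by auto
        have 1: "map_cop (cst X + T) = cst (cop X) + map_cop T" for X :: "('c, 'r) wser" and T
          by (intro wser_eqI) (auto simp: cop_linear coef_one)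
        \<comment> \<open>Multiplicativity of \<open>cop\<close> enters here: the powers
          \<open>Es z ^ n\<close> in the right factor go to \<open>cop (Es z) ^ n\<close>.\<close>
        have 2: "map_cop (pg a (Es z) T) = pg a (cop (Es z)) (map_cop T)" for T :: "('c, ('c, 'r) wser) wser"
        proof (rule wser_eqI)
          fix p show "coef (map_cop (pg a (Es z) T)) p = coef (pg a (cop (Es z)) (map_cop T)) p"
            by (cases p; cases "hd p") (auto simp: cop_linear(4) cop_mult cop_power)
        qed
        have "map_cop (cop (pg a z k)) = cst (cop (pg a z k)) + pg a (Es (Es z)) (map_cop (cop k))"
          unfolding cop_pg[of a z k] 1 2 cop_Es[OF u] by (simp add: cop_pg)
        also have "map_cop (cop k) = cop (cop k)" by (rule less.IH[OF _ e(2)]) (use e in simp)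
        also have "cst (cop (pg a z k)) + pg a (Es (Es z)) (cop (cop k)) = cop (cop (pg a z k))"
          unfolding cop_pg[of a z k] cop_linear cop_cst cop_pg cst_hom by (simp add: add_ac)
        finally show "?\<phi> p p' q (pg a z k) = 0" by simp
      qed (use less.prems in auto)
      then show "coef (coef (coef (map_cop (cop f)) p) p') q = coef (coef (coef (cop (cop f)) p) p') q" by simp
    qed
  qed
  have "map_cop (cop (bas u)) = cop (cop (bas u :: ('c, 'r) wser))" for u
    by (rule main[of "length u"]) (auto simp: depth_le_def)
  then show ?thesis
    using lfun_eq_0_words[OF lf] by (intro wser_eqI) (metis (no_types, lifting) right_minus_eq)
qed

section \<open>Power sums over a finite field\<close>

lemma finite_field_power_card_minus_1:
  fixes x :: "'k::{field,finite}"
  assumes "x \<noteq> 0"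
  shows "x ^ (CARD('k) - 1) = 1"
proof -
  let ?P = "\<Prod>y\<in>UNIV - {0 :: 'k}. y"
  have "?P = (\<Prod>y\<in>UNIV - {0}. x * y)"
    by (rule prod.reindex_bij_witness[of _ "\<lambda>y. x * y" "\<lambda>y. y / x"]) (use assms in auto)
  also have "\<dots> = x ^ (CARD('k) - 1) * ?P" by (simp add: prod.distrib)
  finally show ?thesis by simp
qed

text \<open>If \<open>q - 1\<close> divides \<open>m\<close>, all \<open>q - 1\<close> summands are
  1. Otherwise some nonzero \<open>y\<close> has \<open>y^m\<close> different from 1, and
  substituting \<open>y * x\<close> multiplies the sum by \<open>y^m\<close>, which forces
  0.\<close>

lemma finite_field_power_sum:
  "(\<Sum>x\<in>UNIV - {0 :: 'k::{field,finite}}. x ^ m) = (if CARD('k) - 1 dvd m then - 1 else 0)"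
proof (cases "CARD('k) - 1 dvd m")
  case True
  then obtain d where d: "m = (CARD('k) - 1) * d" by (rule dvdE)
  have "(\<Sum>x\<in>UNIV - {0 :: 'k}. x ^ m) = (\<Sum>x\<in>UNIV - {0 :: 'k}. 1)"
    by (intro sum.cong refl) (simp add: d power_mult finite_field_power_card_minus_1 del: One_nat_def)
  also have "\<dots> = (\<Sum>x\<in>(UNIV :: 'k set). 1) - 1"
    by (subst (2) sum.remove[of _ 0]) auto
  also have "(\<Sum>x\<in>(UNIV :: 'k set). (1 :: 'k)) = 0"
  proof -
    have "(\<Sum>x\<in>(UNIV :: 'k set). x + 1) = (\<Sum>x\<in>UNIV. x)"
      by (rule sum.reindex_bij_witness[of _ "\<lambda>x. x - 1" "\<lambda>x. x + 1"]) auto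
    then show ?thesis unfolding sum.distrib by simp
  qed
  finally show ?thesis using True by simp
next
  case False
  let ?r = "m mod (CARD('k) - 1)"
  have r: "0 < ?r" using False by (simp add: mod_greater_zero_iff_not_dvd)
  have c: "1 < CARD('k)" using card_mono[of UNIV "{0, 1 :: 'k}"] by simp
  then have r': "?r < CARD('k) - 1" by simp
  \<comment> \<open>A nonzero polynomial \<open>X^r - 1\<close> has at most \<open>r\<close> roots,
    and \<open>r < q - 1\<close> is less than the number of nonzero elements.\<close>
  have "\<exists>y\<in>UNIV - {0 :: 'k}. y ^ m \<noteq> 1"
  proof (rule ccontr)
    assume neg: "\<not> ?thesis"
    then have "y ^ ?r = 1" if "y \<noteq> 0" for y :: 'k
    proof -
      have "y ^ m = (y ^ (CARD('k) - 1)) ^ (m div (CARD('k) - 1)) * y ^ ?r"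
        by (simp flip: power_mult power_add)
      then show ?thesis using neg that finite_field_power_card_minus_1[OF that] by simp
    qed
    then have sub: "UNIV - {0 :: 'k} \<subseteq> {y. poly (monom 1 ?r - 1) y = 0}"
      by (auto simp: poly_monom)
    have d: "degree (monom 1 ?r - 1 :: 'k poly) = ?r"
      using degree_add_eq_left[of "- 1 :: 'k poly" "monom 1 ?r"] r by (simp add: degree_monom_eq)
    then have nz: "(monom 1 ?r - 1 :: 'k poly) \<noteq> 0" using r by (metis degree_0 less_irrefl)
    have "CARD('k) - 1 = card (UNIV - {0 :: 'k})" by simp
    also have "\<dots> \<le> card {y. poly (monom 1 ?r - 1) y = (0 :: 'k)}"
      by (rule card_mono[OF _ sub]) simp
    also have "\<dots> \<le> ?r" using card_poly_roots_bound[OF nz] d by simp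
    finally show False using r' by simp
  qed
  then obtain y where y: "y \<noteq> 0" "y ^ m \<noteq> (1 :: 'k)" by blast
  have "(\<Sum>x\<in>UNIV - {0 :: 'k}. x ^ m) = (\<Sum>x\<in>UNIV - {0}. (y * x) ^ m)"
    by (rule sum.reindex_bij_witness[of _ "\<lambda>x. y * x" "\<lambda>x. x / y"]) (use y in auto)
  also have "\<dots> = y ^ m * (\<Sum>x\<in>UNIV - {0 :: 'k}. x ^ m)"
    by (simp add: power_mult_distrib sum_distrib_left)
  finally show ?thesis using y False by simp
qed

section \<open>Comparison with the word-level definitions\<close>

text \<open>Word letters carry their weight, series letters their weight minus one;
  \<open>up\<close> and \<open>dn\<close> translate between the two.\<close>

definition up :: "(nat \<times> 'c) list \<Rightarrow> (nat \<times> 'c) list" where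
  "up = map (\<lambda>x. (Suc (fst x), snd x))"

definition dn :: "(nat \<times> 'c) list \<Rightarrow> (nat \<times> 'c) list" where
  "dn = map (\<lambda>x. (fst x - 1, snd x))"

definition pword :: "(nat \<times> 'c) list \<Rightarrow> bool" where
  "pword w \<longleftrightarrow> (\<forall>x\<in>set w. 1 \<le> fst x)"

lemma up_simps [simp]: "up [] = []" "up (x # s) = (Suc (fst x), snd x) # up s" "length (up s) = length s"
  "dn [] = []" "dn (x # s) = (fst x - 1, snd x) # dn s"
  "pword []" "pword (x # s) \<longleftrightarrow> 1 \<le> fst x \<and> pword s" "pword (s @ t) \<longleftrightarrow> pword s \<and> pword t"
  by (auto simp: up_def dn_def pword_def)

lemma dn_up [simp]: "dn (up s) = s" and pword_up [simp]: "pword (up s)"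
  by (induction s) auto

lemma up_dn [simp]: "pword w \<Longrightarrow> up (dn w) = w"
  by (induction w) auto

lemma up_eq_iff [simp]: "up s = up t \<longleftrightarrow> s = t"
  by (metis dn_up)

text \<open>Finite support matters because a sum over an infinite \<open>supp\<close> is 0 by
  convention; words with a letter of weight 0 would be invisible after the shift of indices.\<close>

definition pvec :: "((nat \<times> 'c) list \<Rightarrow> 'k::zero) \<Rightarrow> bool" where
  "pvec f \<longleftrightarrow> finite (supp f) \<and> (\<forall>w\<in>supp f. pword w)"

lemma in_supp [simp]: "w \<in> supp f \<longleftrightarrow> f w \<noteq> 0"
  by (simp add: supp_def)

lemma pvec_mono:
  assumes "finite A" "\<And>w. f w \<noteq> 0 \<Longrightarrow> w \<in> A \<and> pword w"
  shows "pvec f"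
  unfolding pvec_def using assms by (auto intro: finite_subset[OF _ assms(1)])

lemma pvec_basis: "pword u \<Longrightarrow> pvec (basis u)"
  by (rule pvec_mono[of "{u}"]) (auto simp: basis_def split: if_splits)

lemma pvec_add: "pvec f \<Longrightarrow> pvec g \<Longrightarrow> pvec (\<lambda>w. f w + g w :: 'k::comm_ring_1)"
proof (rule pvec_mono[of "supp f \<union> supp g"])
  fix w assume "pvec f" "pvec g" "f w + g w \<noteq> 0"
  then have "f w \<noteq> 0 \<or> g w \<noteq> 0" by force
  then show "w \<in> supp f \<union> supp g \<and> pword w" using \<open>pvec f\<close> \<open>pvec g\<close> by (auto simp: pvec_def)
qed (simp add: pvec_def)

lemma pvec_cmult: "pvec f \<Longrightarrow> pvec (\<lambda>w. c * f w :: 'k::comm_ring_1)"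
  by (rule pvec_mono[of "supp f"]) (auto simp: pvec_def)

lemma pvec_0: "pvec (\<lambda>w. 0)"
  by (rule pvec_mono[of "{}"]) auto

lemma pvec_sum: "(\<And>x. x \<in> A \<Longrightarrow> pvec (f x)) \<Longrightarrow> pvec (\<lambda>w. \<Sum>x\<in>A. f x w :: 'k::comm_ring_1)"
proof (induction A rule: infinite_finite_induct)
  case (insert x A)
  have "pvec (\<lambda>w. f x w + (\<Sum>x\<in>A. f x w))" by (rule pvec_add) (use insert in auto)
  then show ?case using insert.hyps by simp
qed (simp_all add: pvec_0)

lemma pvec_prepend: "1 \<le> fst x \<Longrightarrow> pvec f \<Longrightarrow> pvec (prepend x f)"
  by (rule pvec_mono[of "(#) x ` supp f"])
    (auto simp: pvec_def prepend_def split: list.splits if_splits)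

lemma pvec_lin: "(\<And>u. u \<in> supp v \<Longrightarrow> pvec (f u)) \<Longrightarrow> pvec (lin f v)"
  unfolding lin_def by (intro pvec_sum pvec_cmult)

lemma pvec_dstep:
  assumes "pvec (f a b)" "\<And>j u. 1 \<le> j \<Longrightarrow> pword u \<Longrightarrow> pvec (f [(j, 1)] u)" "1 \<le> fst x" "1 \<le> fst y"
  shows "pvec (dstep f x a y b)"
  unfolding dstep_def
  by (intro pvec_add pvec_sum pvec_cmult pvec_prepend pvec_lin assms)
    (use assms(3,4) assms(1)[unfolded pvec_def] in auto)

lemma pvec_shf: "pword a \<Longrightarrow> pword b \<Longrightarrow> pvec (shf n a b)"
proof (induction n arbitrary: a b)
  case 0
  then show ?case by (auto simp: pvec_basis pvec_0)
next
  case (Suc n)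
  then show ?case
    by (cases a; cases b) (auto intro!: pvec_add pvec_prepend pvec_dstep simp: pvec_basis)
qed

lemma pvec_shw: "pword a \<Longrightarrow> pword b \<Longrightarrow> pvec (shw a b)"
  by (simp add: shw_def pvec_shf)

lemma pvec_shuffle: "pvec f \<Longrightarrow> pvec g \<Longrightarrow> pvec (shuffle f g)"
  unfolding shuffle_def by (intro pvec_sum pvec_cmult pvec_shw) (auto simp: pvec_def)

definition lett :: "nat \<times> 'c \<Rightarrow> ('c, 'r::zero) wser \<Rightarrow> ('c, 'r) wser" where
  "lett x f = wser (\<lambda>s. case s of [] \<Rightarrow> 0 | y # t \<Rightarrow> if y = x then coef f t else 0)"

lemma coef_lett [simp]: "coef (lett x f) [] = 0" "coef (lett x f) (y # t) = (if y = x then coef f t else 0)"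
  by (simp_all add: lett_def)

text \<open>Recovers the recursion on the two input words from \<open>coef_mult_Cons\<close>, which
  recurses on the output: of all splittings of the first output letter only \<open>n = i\<close>
  survives. The index \<open>Suc (i + m)\<close> stands for the weight
  \<open>(i + 1) + (m + 1)\<close>.\<close>

lemma bas_Cons_mult:
  fixes i m :: nat and a b :: "'c::{finite,comm_monoid_mult}"
  shows "bas ((i, a) # s) * bas ((m, b) # t) = lett (i, a) (bas s * bas ((m, b) # t))
    + lett (m, b) (bas ((i, a) # s) * bas t)
    + (lett (Suc (i + m), a * b) (bas s * bas t)
      + (\<Sum>j\<le>i+m. scal (dcf i m j) (lett (i + m - j, a * b) (bas [(j, 1)] * (bas s * bas t)))) :: ('c, 'r::fq_algebra) wser)"
    (is "?L = ?R")
proof (rule wser_eqI)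
  fix w show "coef ?L w = coef ?R w"
  proof (cases w)
    case Nil
    then show ?thesis by (simp add: coef_sum)
  next
    case (Cons x w')
    obtain k c where x: "x = (k, c)" by force
    let ?X = "bas s * bas t :: ('c, 'r) wser"
    have 1: "(\<Sum>n<k. coef (lq (n, a) (bas ((i, a) # s)) * lq (k - Suc n, b) (bas ((m, b) # t)) :: ('c, 'r) wser) w')
        = (if k = Suc (i + m) then coef ?X w' else 0)"
    proof -
      have "(\<Sum>n<k. coef (lq (n, a) (bas ((i, a) # s)) * lq (k - Suc n, b) (bas ((m, b) # t)) :: ('c, 'r) wser) w')
        = (\<Sum>n<k. if n = i then (if k = Suc (i + m) then coef ?X w' else 0) else 0)"
        by (intro sum.cong refl) auto
      then show ?thesis by simp
    qed
    have 2: "(\<Sum>j<wt w'. \<Sum>n\<le>k+j. dcf n (k + j - n) j *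
          coef (bas [(j, 1)] * (lq (n, a) (bas ((i, a) # s)) * lq (k + j - n, b) (bas ((m, b) # t))) :: ('c, 'r) wser) w')
        = (\<Sum>j\<le>i+m. dcf i m j * (if k = i + m - j then coef (bas [(j, 1)] * ?X) w' else 0))"
    proof -
      have "(\<Sum>j<wt w'. \<Sum>n\<le>k+j. dcf n (k + j - n) j *
          coef (bas [(j, 1)] * (lq (n, a) (bas ((i, a) # s)) * lq (k + j - n, b) (bas ((m, b) # t))) :: ('c, 'r) wser) w')
        = (\<Sum>j<wt w'. \<Sum>n\<le>k+j. if n = i then (if k + j = i + m then dcf i m j * coef (bas [(j, 1)] * ?X) w' else 0) else 0)"
        by (intro sum.cong refl) auto
      also have "\<dots> = (\<Sum>j<wt w'. if k + j = i + m then dcf i m j * coef (bas [(j, 1)] * ?X) w' else 0)"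
        by (intro sum.cong refl) auto
      also have "\<dots> = (\<Sum>j\<le>i+m. dcf i m j * (if k = i + m - j then coef (bas [(j, 1)] * ?X) w' else 0))"
      proof (rule sum.mono_neutral_cong)
        \<comment> \<open>The sum in \<open>coef_mult_Cons\<close> stops at \<open>wt w'\<close>;
          from there on \<open>x_j\<close> alone outweighs \<open>w'\<close>, so summing up to
          \<open>i + m\<close> instead gives the same value.\<close>
        show "dcf i m j * (if k = i + m - j then coef (bas [(j, 1)] * ?X) w' else 0) = 0"
          if "j \<in> {..i+m} - {..<wt w'}" for j
        proof -
          have "coef (bas [(j, 1)] * ?X) w' = 0"
            by (rule coef_mult_order[of "Suc j" _ 0]) (use that in auto)
          then show ?thesis by simp
        qed
      qed auto
      finally show ?thesis .
    qed
    have 3: "(\<Sum>x\<in>UNIV. \<Sum>y\<in>UNIV. if x * y = c then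
          (\<Sum>n<k. coef (lq (n, x) (bas ((i, a) # s)) * lq (k - Suc n, y) (bas ((m, b) # t)) :: ('c, 'r) wser) w')
          + (\<Sum>j<wt w'. \<Sum>n\<le>k+j. dcf n (k + j - n) j *
               coef (bas [(j, 1)] * (lq (n, x) (bas ((i, a) # s)) * lq (k + j - n, y) (bas ((m, b) # t)))) w')
        else 0) = (if a * b = c then (if k = Suc (i + m) then coef ?X w' else 0) +
          (\<Sum>j\<le>i+m. dcf i m j * (if k = i + m - j then coef (bas [(j, 1)] * ?X) w' else 0)) else 0)"
    proof (subst sum_sum_if[of a b], goal_cases)
      case (1 x y)
      then show ?case by (auto intro!: sum.neutral)
    qed (simp only: 1 2)
    show ?thesis unfolding Cons x coef_mult_Cons 3
      by (auto simp: coef_sum intro!: sum.cong)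
  qed
qed

text \<open>At \<open>s\<close> the hypothesis equates \<open>z^(wt s)\<close> and
  \<open>z^k\<close> times the same nonzero coefficient for all \<open>z\<close>, and infinitely
  many points separate two different powers.\<close>

lemma wser_homogeneous:
  fixes f :: "('c::{finite,comm_monoid_mult}, 'r::fq_algebra) wser"
  assumes "\<And>z. theta z f = scal (z ^ k) f" "coef f s \<noteq> 0"
  shows "wt s = k"
proof (rule ccontr)
  assume ne: "wt s \<noteq> k"
  let ?c = "\<lambda>n. (if n = wt s then coef f s else 0) - (if n = k then coef f s else 0)"
  have "?c (wt s) = 0"
  proof (rule power_sum_coeffs_eq_0[where S = Lf and N = "wt s + k" and c = ?c and n = "wt s"])
    fix z :: 'r
    have "z ^ wt s * coef f s - z ^ k * coef f s = 0"
      using arg_cong[OF assms(1)[of z], of "\<lambda>f. coef f s"] by simp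
    then show "(\<Sum>n\<le>wt s + k. z ^ n * ?c n) = 0"
      by (simp add: right_diff_distrib sum_subtractf if_distrib[of "\<lambda>r. _ * r"] cong: if_cong)
  qed (auto simp: infinite_Lf)
  then show False using ne assms(2) by simp
qed

text \<open>Instantiated twice at the end: with \<open>F_q\<close> as the constants of the Laurent
  series field, and as the constants of the series over it, where the coefficients play the role of
  a right tensor factor.\<close>

locale fq_embedding =
  fixes \<iota> :: "'k::{field,finite} \<Rightarrow> 'r::fq_algebra"
  assumes hom_add: "\<iota> (x + y) = \<iota> x + \<iota> y"
    and hom_mult: "\<iota> (x * y) = \<iota> x * \<iota> y"
    and hom_1: "\<iota> 1 = 1"
    and range_hom: "range \<iota> = Fq"
begin

lemma hom_0 [simp]: "\<iota> 0 = 0"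
  using hom_add[of 0 0] by simp

lemma hom_minus: "\<iota> (- x) = - \<iota> x"
  using hom_add[of x "- x"] by (simp add: eq_neg_iff_add_eq_0 add.commute)

lemma hom_eq_0_iff: "\<iota> x = 0 \<longleftrightarrow> x = 0"
proof
  assume "\<iota> x = 0"
  then show "x = 0" using hom_mult[of x "1 / x"] hom_1 by (cases "x = 0") auto
qed simp

lemma hom_inj: "\<iota> x = \<iota> y \<longleftrightarrow> x = y"
  using hom_eq_0_iff[of "x - y"] hom_add[of x "- y"] by (simp add: hom_minus)

lemma hom_sum: "\<iota> (\<Sum>x\<in>A. f x) = (\<Sum>x\<in>A. \<iota> (f x))"
  by (induction A rule: infinite_finite_induct) (simp_all add: hom_add)

lemma hom_power: "\<iota> (x ^ n) = \<iota> x ^ n"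
  by (induction n) (simp_all add: hom_mult hom_1)

lemma hom_of_nat: "\<iota> (of_nat n) = of_nat n"
  by (induction n) (simp_all add: hom_add hom_1)

lemma hc_eq: "hc j = (if CARD('k) - 1 dvd Suc j then 1 else 0 :: 'r)"
proof -
  have F: "Fq - {0} = \<iota> ` (UNIV - {0})"
    unfolding range_hom[symmetric] by (auto simp: hom_eq_0_iff)
  have "hc j = - (\<Sum>x\<in>UNIV - {0}. \<iota> x ^ Suc j)"
    unfolding hc_def F by (subst sum.reindex) (auto simp: inj_on_def hom_inj)
  also have "\<dots> = \<iota> (- (\<Sum>x\<in>UNIV - {0}. x ^ Suc j))"
    by (simp only: hom_minus hom_sum hom_power)
  finally show ?thesis unfolding finite_field_power_sum by (simp add: hom_1)
qed

lemma hom_Dco: "\<iota> (Dco (Suc a) (Suc b) (Suc j)) = dcf a b j"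
  unfolding Dco_def dcf_def hc_eq by (simp add: hom_add hom_mult hom_power hom_minus hom_of_nat hom_1)

definition emb :: "((nat \<times> 'c) list \<Rightarrow> 'k) \<Rightarrow> ('c, 'r) wser" where
  "emb f = wser (\<lambda>s. \<iota> (f (up s)))"

lemma coef_emb [simp]: "coef (emb f) s = \<iota> (f (up s))"
  by (simp add: emb_def)

lemma emb_add: "emb (\<lambda>w. f w + g w) = emb f + emb g"
  by (intro wser_eqI) (simp add: hom_add)

lemma emb_cmult: "emb (\<lambda>w. c * f w) = scal (\<iota> c) (emb f)"
  by (intro wser_eqI) (simp add: hom_mult)

lemma emb_sum: "emb (\<lambda>w. \<Sum>x\<in>A. f x w) = (\<Sum>x\<in>A. emb (f x))"
  by (intro wser_eqI) (simp add: hom_sum coef_sum)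

lemma emb_basis: "emb (basis (up s)) = bas s"
  by (intro wser_eqI) (simp add: basis_def hom_1)

lemma bas_Nil: "bas [] = 1"
  by (simp add: one_wser_def)

lemma emb_prepend: "emb (prepend (Suc i, c) f) = lett (i, c) (emb f)"
proof (rule wser_eqI)
  fix s show "coef (emb (prepend (Suc i, c) f)) s = coef (lett (i, c) (emb f)) s"
    by (cases s; cases "hd s") (auto simp: prepend_def)
qed

lemma emb_eq_sum: "pvec f \<Longrightarrow> emb f = (\<Sum>u\<in>supp f. scal (\<iota> (f u)) (bas (dn u)))"
proof (rule wser_eqI)
  fix s assume f: "pvec f"
  have "coef (\<Sum>u\<in>supp f. scal (\<iota> (f u)) (bas (dn u))) s = (\<Sum>u\<in>supp f. if u = up s then \<iota> (f (up s)) else 0)"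
    unfolding coef_sum by (intro sum.cong refl) (use f in \<open>auto simp: pvec_def\<close>)
  also have "\<dots> = \<iota> (f (up s))"
    using f by (auto simp: pvec_def)
  finally show "coef (emb f) s = coef (\<Sum>u\<in>supp f. scal (\<iota> (f u)) (bas (dn u))) s" by simp
qed

text \<open>The values of \<open>f\<close> are prescribed on the support of \<open>v\<close> only,
  since the fuel of \<open>shf\<close> suffices just for words up to a certain length.\<close>

lemma emb_lin:
  assumes "pvec v" "\<And>u. v (up u) \<noteq> 0 \<Longrightarrow> emb (f (up u)) = g * bas u"
  shows "emb (lin f v) = g * emb v"
proof -
  have "emb (lin f v) = (\<Sum>u\<in>supp v. scal (\<iota> (v u)) (emb (f u)))"
    unfolding lin_def emb_sum emb_cmult ..
  also have "\<dots> = (\<Sum>u\<in>supp v. g * scal (\<iota> (v u)) (bas (dn u)))"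
  proof (intro sum.cong refl)
    fix u assume u: "u \<in> supp v"
    then have "pword u" using assms(1) by (auto simp: pvec_def)
    then show "scal (\<iota> (v u)) (emb (f u)) = g * scal (\<iota> (v u)) (bas (dn u))"
      using assms(2)[of "dn u"] u by (simp add: wser_mult_distribs)
  qed
  finally show ?thesis by (simp add: emb_eq_sum[OF assms(1)] sum_distrib_left)
qed

lemma emb_shf: "length s + length t \<le> n \<Longrightarrow> emb (shf n (up s) (up t)) = bas s * (bas t :: ('k, 'r) wser)"
proof (induction n arbitrary: s t)
  case 0
  then show ?case using emb_basis[of "[] :: (nat \<times> 'k) list"] by (simp add: bas_Nil)
next
  case (Suc n)
  show ?case
  proof (cases "s = [] \<or> t = []")
    case True
    then show ?thesis
    proof
      assume "s = []"
      then show ?thesis using emb_basis[of t] by (simp add: bas_Nil)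
    next
      assume "t = []"
      then show ?thesis using emb_basis[of s] by (cases s) (simp_all add: bas_Nil)
    qed
  next
    case False
    then obtain i a s' m b t' where st: "s = (i, a) # s'" "t = (m, b) # t'"
      by (metis neq_Nil_conv surj_pair)
    note IH = Suc.IH
    let ?X = "bas s' * bas t' :: ('k, 'r) wser"
    have X: "emb (shf n (up s') (up t')) = ?X" by (rule IH) (use Suc.prems st in simp)
    have P: "pvec (shf n (up s') (up t'))" by (rule pvec_shf) simp_all
    have L: "emb (lin (\<lambda>u. shf n [(Suc j, 1)] u) (shf n (up s') (up t'))) = bas [(j, 1)] * ?X" for j
      unfolding X[symmetric]
    proof (rule emb_lin[OF P])
      fix u assume "shf n (up s') (up t') (up u) \<noteq> 0"
      then have "coef ?X u \<noteq> 0" unfolding X[symmetric] by (simp add: hom_eq_0_iff)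
      \<comment> \<open>The depth bound on the product limits the length of \<open>u\<close>, so
        that the fuel \<open>n\<close> still covers the additional letter
        \<open>x_j\<close>.\<close>
      moreover have "depth_le (length s' + length t') ?X" by (rule depth_le_mult) (auto simp: depth_le_def)
      ultimately have "length u \<le> length s' + length t'" by (auto simp: depth_le_def not_less[symmetric])
      then show "emb (shf n [(Suc j, 1)] (up u)) = bas [(j, 1)] * bas u"
        using IH[of "[(j, 1)]" u] Suc.prems st by simp
    qed
    have D: "emb (dstep (shf n) (Suc i, a) (up s') (Suc m, b) (up t'))
      = lett (Suc (i + m), a * b) ?X
        + (\<Sum>j\<le>i+m. scal (dcf i m j) (lett (i + m - j, a * b) (bas [(j, 1)] * ?X)))"
    proof -
      have "emb (dstep (shf n) (Suc i, a) (up s') (Suc m, b) (up t'))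
        = emb (prepend (Suc (Suc (i + m)), a * b) (shf n (up s') (up t')))
          + (\<Sum>j\<in>{1..<Suc (Suc (i + m))}. scal (\<iota> (Dco (Suc i) (Suc m) j))
              (emb (prepend (Suc (Suc (i + m)) - j, a * b) (lin (\<lambda>u. shf n [(j, 1)] u) (shf n (up s') (up t'))))))"
        unfolding dstep_def emb_add emb_sum emb_cmult by simp
      also have "(\<Sum>j\<in>{1..<Suc (Suc (i + m))}. scal (\<iota> (Dco (Suc i) (Suc m) j))
              (emb (prepend (Suc (Suc (i + m)) - j, a * b) (lin (\<lambda>u. shf n [(j, 1)] u) (shf n (up s') (up t'))))))
        = (\<Sum>j\<le>i+m. scal (dcf i m j) (lett (i + m - j, a * b) (bas [(j, 1)] * ?X)))"
      proof (rule sum.reindex_bij_witness[of _ Suc "\<lambda>j. j - 1"])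
        fix j assume j: "j \<in> {1..<Suc (Suc (i + m))}"
        then obtain j' where j': "j = Suc j'" "j' \<le> i + m" by (cases j) auto
        then have e: "Suc (Suc (i + m)) - j = Suc (i + m - j')" by simp
        show "scal (dcf i m (j - 1)) (lett (i + m - (j - 1), a * b) (bas [(j - 1, 1)] * ?X)) =
          scal (\<iota> (Dco (Suc i) (Suc m) j))
              (emb (prepend (Suc (Suc (i + m)) - j, a * b) (lin (\<lambda>u. shf n [(j, 1)] u) (shf n (up s') (up t')))))"
          unfolding e unfolding j' hom_Dco emb_prepend L by simp
      qed auto
      finally show ?thesis unfolding emb_prepend X .
    qed
    have "emb (shf (Suc n) (up s) (up t)) = lett (i, a) (emb (shf n (up s') (up t)))
        + lett (m, b) (emb (shf n (up s) (up t')))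
        + emb (dstep (shf n) (Suc i, a) (up s') (Suc m, b) (up t'))"
      unfolding st by (simp add: emb_add emb_prepend)
    also have "emb (shf n (up s') (up t)) = bas s' * bas t" by (rule IH) (use Suc.prems st in simp)
    also have "emb (shf n (up s) (up t')) = bas s * bas t'" by (rule IH) (use Suc.prems st in simp)
    finally show ?thesis unfolding D unfolding st bas_Cons_mult .
  qed
qed

lemma emb_shw: "emb (shw (up s) (up t)) = bas s * (bas t :: ('k, 'r) wser)"
  unfolding shw_def by (rule emb_shf) simp

lemma emb_shuffle:
  assumes "pvec f" "pvec g"
  shows "emb (shuffle f g) = emb f * emb g"
proof -
  have "emb (shuffle f g) = (\<Sum>u\<in>supp f. \<Sum>v\<in>supp g. scal (\<iota> (f u * g v)) (emb (shw u v)))"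
    unfolding shuffle_def emb_sum emb_cmult ..
  also have "\<dots> = (\<Sum>u\<in>supp f. \<Sum>v\<in>supp g. scal (\<iota> (f u)) (bas (dn u)) * scal (\<iota> (g v)) (bas (dn v)))"
  proof (intro sum.cong refl)
    fix u v assume "u \<in> supp f" "v \<in> supp g"
    then have "emb (shw u v) = bas (dn u) * bas (dn v)"
      using assms emb_shw[of "dn u" "dn v"] by (simp add: pvec_def)
    then show "scal (\<iota> (f u * g v)) (emb (shw u v)) = scal (\<iota> (f u)) (bas (dn u)) * scal (\<iota> (g v)) (bas (dn v))"
      by (simp add: wser_mult_distribs hom_mult mult.commute)
  qed
  also have "\<dots> = emb f * emb g"
    unfolding emb_eq_sum[OF assms(1)] emb_eq_sum[OF assms(2)] sum_product ..
  finally show ?thesis .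
qed

definition lprod :: "(nat \<times> 'k) list \<Rightarrow> ('k, 'r) wser" where
  "lprod w = foldr (\<lambda>x v. bas [x] * v) w 1"

lemma lprod_simps [simp]: "lprod [] = 1" "lprod (x # w) = bas [x] * lprod w"
  by (simp_all add: lprod_def)

lemma theta_lprod: "theta z (lprod w) = scal (z ^ wt w) (lprod w)"
proof (induction w)
  case (Cons x w)
  have "theta z (bas [x]) = scal (z ^ Suc (fst x)) (bas [x] :: ('k, 'r) wser)"
    by (auto intro!: wser_eqI)
  then show ?case
    by (simp add: theta_mult Cons wser_mult_distribs power_add mult_ac)
qed simp

lemma emb_letters:
  assumes "\<And>x. x \<in> set w \<Longrightarrow> snd x = 1"
  shows "emb (foldr (\<lambda>x v. shuffle (basis [(fst x, 1)]) v) (up w) (basis []) :: 'k vec) = lprod w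
    \<and> pvec (foldr (\<lambda>x v. shuffle (basis [(fst x, 1)]) v) (up w) (basis []) :: 'k vec)"
  using assms
proof (induction w)
  case Nil
  then show ?case using emb_basis[of "[] :: (nat \<times> 'k) list"] by (simp add: bas_Nil pvec_basis)
next
  case (Cons x w)
  have x: "(fst x, 1) = x" using Cons.prems[of x] by (cases x) simp
  have IH: "emb (foldr (\<lambda>x v. shuffle (basis [(fst x, 1)]) v) (up w) (basis []) :: 'k vec) = lprod w"
    "pvec (foldr (\<lambda>x v. shuffle (basis [(fst x, 1)]) v) (up w) (basis []) :: 'k vec)"
    using Cons by auto
  have b: "pvec (basis [(Suc (fst x), 1)] :: 'k vec)" by (rule pvec_basis) simp
  have "emb (basis [(Suc (fst x), 1)]) = bas [(fst x, 1 :: 'k)]"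
    using emb_basis[of "[(fst x, 1)] :: (nat \<times> 'k) list"] by simp
  then have "emb (basis [(Suc (fst x), 1)]) = bas [x]" unfolding x .
  then show ?case using IH b by (simp add: emb_shuffle pvec_shuffle)
qed

lemma weight_up: "weight (up w) = wt w"
  by (induction w) (simp_all add: weight_def)

lemma emb_bracket:
  assumes "\<And>x. x \<in> set w \<Longrightarrow> snd x = 1"
  shows "emb (bracket (up w)) = scal ((-1) ^ length w * (\<Prod>x\<leftarrow>w. hc (fst x))) (lprod w)"
    and "pvec (bracket (up w))"
proof -
  let ?F = "foldr (\<lambda>x v. shuffle (basis [(fst x, 1)]) v) (up w) (basis []) :: 'k vec"
  let ?c = "(-1) ^ length (up w) * (\<Prod>x\<leftarrow>up w. Dco 1 (weight (up w) + 1) (fst x)) :: 'k"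
  have b: "bracket (up w) = (\<lambda>q. ?c * ?F q)" by (simp add: bracket_def)
  have D: "\<iota> (Dco 1 (N + 1) (Suc j)) = hc j" if "Suc j \<le> N" for N j
    using hom_Dco[of 0 N j] that by (simp add: dcf_def binomial_eq_0)
  have "\<iota> (\<Prod>x\<leftarrow>up v. Dco 1 (N + 1) (fst x)) = (\<Prod>x\<leftarrow>v. hc (fst x))" if "wt v \<le> N" for v :: "(nat \<times> 'k) list" and N
    using that D by (induction v) (simp_all add: hom_1 hom_mult)
  then have "\<iota> ?c = (-1) ^ length w * (\<Prod>x\<leftarrow>w. hc (fst x))"
    by (simp add: hom_mult hom_power hom_minus hom_1 weight_up)
  then show "emb (bracket (up w)) = scal ((-1) ^ length w * (\<Prod>x\<leftarrow>w. hc (fst x))) (lprod w)"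
    unfolding b emb_cmult using emb_letters[of w] assms by simp
  show "pvec (bracket (up w))"
    unfolding b using emb_letters[of w] assms by (intro pvec_cmult) blast
qed

definition ones :: "nat \<Rightarrow> (nat \<times> 'k) set" where
  "ones N = (\<lambda>j. (j, 1)) ` {..<N}"

lemma finite_ones_lists: "finite {w. set w \<subseteq> ones N \<and> length w = m}"
  by (rule finite_lists_length_eq) (simp add: ones_def)

lemma power_letters_sum:
  "(- (\<Sum>x\<in>ones N. scal (hc (fst x)) (bas [x]))) ^ m
    = (\<Sum>w | set w \<subseteq> ones N \<and> length w = m. scal ((-1) ^ m * (\<Prod>x\<leftarrow>w. hc (fst x))) (lprod w))"
    (is "?Y ^ m = _")
proof (induction m)
  case 0
  have "{w. set w \<subseteq> ones N \<and> w = []} = {[]}" by auto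
  then show ?case by simp
next
  case (Suc m)
  let ?S = "{w. set w \<subseteq> ones N \<and> length w = m}"
  have S: "{w. set w \<subseteq> ones N \<and> length w = Suc m} = (\<lambda>(x, w). x # w) ` (ones N \<times> ?S)"
    by (auto simp: image_iff length_Suc_conv)
  have "?Y ^ Suc m = (\<Sum>x\<in>ones N. \<Sum>w\<in>?S. scal (- hc (fst x)) (bas [x]) * scal ((-1) ^ m * (\<Prod>x\<leftarrow>w. hc (fst x))) (lprod w))"
    unfolding power_Suc Suc unfolding sum_negf[symmetric] scal_distribs(6)[symmetric] sum_product ..
  also have "\<dots> = (\<Sum>(x, w)\<in>ones N \<times> ?S. scal ((-1) ^ Suc m * (\<Prod>x\<leftarrow>x # w. hc (fst x))) (lprod (x # w)))"
    unfolding sum.cartesian_product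
    by (intro sum.cong refl) (auto simp: wser_mult_distribs mult_ac)
  also have "\<dots> = (\<Sum>w | set w \<subseteq> ones N \<and> length w = Suc m. scal ((-1) ^ Suc m * (\<Prod>x\<leftarrow>w. hc (fst x))) (lprod w))"
    unfolding S by (subst sum.reindex) (auto simp: inj_on_def case_prod_beta)
  finally show ?case .
qed

text \<open>Links powers of \<open>Ys\<close> to the word sums of the coproduct. For a coefficient
  of weight \<open>k\<close> only letters of index below \<open>k\<close> matter, which makes the
  alphabet finite; words of another total weight drop out by homogeneity.\<close>

lemma coef_Ys_power_sum:
  assumes "wt t = k"
  shows "coef (Ys ^ m :: ('k, 'r) wser) t
    = (\<Sum>w | (\<forall>x\<in>set w. snd x = 1) \<and> wt w = k \<and> length w = m. (-1) ^ m * (\<Prod>x\<leftarrow>w. hc (fst x)) * coef (lprod w) t)"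
proof -
  let ?Y = "- (\<Sum>x\<in>ones k. scal (hc (fst x)) (bas [x])) :: ('k, 'r) wser"
  have Y: "coef Ys s = coef ?Y s" if "wt s \<le> k" for s
  proof -
    have "coef (\<Sum>x\<in>ones k. scal (hc (fst x)) (bas [x])) s = (\<Sum>j<k. if s = [(j, 1)] then hc j else 0 :: 'r)"
      unfolding ones_def by (subst sum.reindex) (auto simp: inj_on_def coef_sum intro!: sum.cong)
    also have "\<dots> = coef (Hp 1 1 :: ('k, 'r) wser) s"
    proof (cases s)
      case (Cons x u)
      then show ?thesis using that by (cases x; cases u) (auto simp: coef_one)
    qed simp
    finally show ?thesis by (simp add: Ys_def)
  qed
  have "coef (Ys ^ m) s = coef (?Y ^ m) s" if "wt s \<le> k" for s
    using that
  proof (induction m arbitrary: s)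
    case (Suc m)
    show ?case unfolding power_Suc by (rule coef_mult_cong) (use Suc Y in auto)
  qed simp
  then have "coef (Ys ^ m) t = coef (?Y ^ m) t" using assms by simp
  also have "\<dots> = (\<Sum>w | set w \<subseteq> ones k \<and> length w = m. (-1) ^ m * (\<Prod>x\<leftarrow>w. hc (fst x)) * coef (lprod w) t)"
    unfolding power_letters_sum coef_sum by simp
  also have "\<dots> = (\<Sum>w | (\<forall>x\<in>set w. snd x = 1) \<and> wt w = k \<and> length w = m. (-1) ^ m * (\<Prod>x\<leftarrow>w. hc (fst x)) * coef (lprod w) t)"
  proof (rule sum.mono_neutral_right[OF finite_ones_lists])
    have "set w \<subseteq> ones N" if "\<forall>x\<in>set w. snd x = 1" "wt w \<le> N" for w :: "(nat \<times> 'k) list" and N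
      using that by (induction w) (auto simp: ones_def image_iff prod_eq_iff)
    then show "{w. (\<forall>x\<in>set w. snd x = 1) \<and> wt w = k \<and> length w = m} \<subseteq> {w. set w \<subseteq> ones k \<and> length w = m}"
      by auto
    show "\<forall>w\<in>{w. set w \<subseteq> ones k \<and> length w = m} - {w. (\<forall>x\<in>set w. snd x = 1) \<and> wt w = k \<and> length w = m}.
       (-1) ^ m * (\<Prod>x\<leftarrow>w. hc (fst x)) * coef (lprod w) t = 0"
    proof
      fix w assume w: "w \<in> {w. set w \<subseteq> ones k \<and> length w = m} - {w. (\<forall>x\<in>set w. snd x = 1) \<and> wt w = k \<and> length w = m}"
      then have "wt w \<noteq> k" by (auto simp: ones_def)
      then have "coef (lprod w) t = 0"
        using wser_homogeneous[of "lprod w" "wt w" t] theta_lprod assms by auto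
      then show "(-1) ^ m * (\<Prod>x\<leftarrow>w. hc (fst x)) * coef (lprod w) t = 0" by simp
    qed
  qed
  finally show ?thesis .
qed

definition slice :: "'k vec2 \<Rightarrow> 'k word \<Rightarrow> 'k vec" where
  "slice T p = (\<lambda>q. T (p, q))"

lemma char1_set_eq:
  assumes "r \<le> i"
  shows "{a :: 'k word. char1_word a \<and> Suc r + weight a = Suc i} = up ` {w. (\<forall>x\<in>set w. snd x = 1) \<and> wt w = i - r}"
proof (rule set_eqI)
  fix a :: "'k word"
  have c: "char1_word a \<longleftrightarrow> pword a \<and> (\<forall>x\<in>set (dn a). snd x = 1)" for a :: "'k word"
    by (induction a) (auto simp: char1_word_def)
  show "a \<in> {a. char1_word a \<and> Suc r + weight a = Suc i} \<longleftrightarrow> a \<in> up ` {w. (\<forall>x\<in>set w. snd x = 1) \<and> wt w = i - r}"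
  proof
    assume a: "a \<in> {a. char1_word a \<and> Suc r + weight a = Suc i}"
    then have "a = up (dn a)" "wt (dn a) = i - r" using c[of a] weight_up[of "dn a"] by auto
    then show "a \<in> up ` {w. (\<forall>x\<in>set w. snd x = 1) \<and> wt w = i - r}" using a c[of a] by blast
  qed (use assms c in \<open>auto simp: weight_up\<close>)
qed

lemma finite_ones_wt: "finite {w :: (nat \<times> 'k) list. (\<forall>x\<in>set w. snd x = 1) \<and> wt w = k}"
  by (rule finite_subset[OF _ finite_wt_le[of k]]) auto

lemma cop_rest_slice:
  "slice (cop_rest (Suc i, c)) p = (\<lambda>q. \<Sum>r\<le>i. \<Sum>w | (\<forall>x\<in>set w. snd x = 1) \<and> wt w = i - r.
     of_nat ((r + length w - 1) choose length w) * basis [(Suc r, c)] p * bracket (up w) q)"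
proof (rule ext)
  fix q :: "'k word"
  have "slice (cop_rest (Suc i, c)) p q = (\<Sum>r\<in>{1..Suc i}. \<Sum>a | char1_word a \<and> r + weight a = Suc i.
       of_nat ((r + depth a - 2) choose depth a) * basis [(r, c)] p * bracket a q)"
    by (simp add: slice_def cop_rest_def)
  also have "\<dots> = (\<Sum>r\<le>i. \<Sum>a | char1_word a \<and> Suc r + weight a = Suc i.
       of_nat ((Suc r + depth a - 2) choose depth a) * basis [(Suc r, c)] p * bracket a q)"
    by (rule sum.reindex_bij_witness[of _ Suc "\<lambda>r. r - 1"]) auto
  also have "\<dots> = (\<Sum>r\<le>i. \<Sum>w | (\<forall>x\<in>set w. snd x = 1) \<and> wt w = i - r.
     of_nat ((r + length w - 1) choose length w) * basis [(Suc r, c)] p * bracket (up w) q)"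
  proof (rule sum.cong[OF refl])
    fix r assume "r \<in> {..i}"
    then show "(\<Sum>a | char1_word a \<and> Suc r + weight a = Suc i.
       of_nat ((Suc r + depth a - 2) choose depth a) * basis [(Suc r, c)] p * bracket a q)
      = (\<Sum>w | (\<forall>x\<in>set w. snd x = 1) \<and> wt w = i - r.
     of_nat ((r + length w - 1) choose length w) * basis [(Suc r, c)] p * bracket (up w) q)"
      by (subst char1_set_eq) (auto simp: sum.reindex inj_on_def depth_def numeral_2_eq_2)
  qed
  finally show "slice (cop_rest (Suc i, c)) p q = (\<Sum>r\<le>i. \<Sum>w | (\<forall>x\<in>set w. snd x = 1) \<and> wt w = i - r.
     of_nat ((r + length w - 1) choose length w) * basis [(Suc r, c)] p * bracket (up w) q)" .
qed

lemma pvec_cop_rest: "pvec (slice (cop_rest (Suc i, c)) p)"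
  unfolding cop_rest_slice by (intro pvec_sum pvec_cmult emb_bracket) auto

lemma cop_rest_eq_0: "(\<And>r. p \<noteq> [(Suc r, c)] \<or> i < r) \<Longrightarrow> slice (cop_rest (Suc i, c)) p q = 0"
  unfolding cop_rest_slice by (intro sum.neutral) (force simp: basis_def intro!: sum.neutral)

text \<open>Grouped by length \<open>m\<close>, the words on the right give the sum defining
  \<open>Js r\<close>. As the left letter has weight \<open>Suc r\<close>, the binomial reads
  \<open>(r + m - 1) choose m\<close>, hence the exponent \<open>r\<close>.\<close>

lemma emb_cop_rest:
  assumes "r \<le> i"
  shows "emb (slice (cop_rest (Suc i, c)) [(Suc r, c)]) = graded_part (i - r) (Js 1 ^ r)"
proof (rule wser_eqI)
  fix t :: "(nat \<times> 'k) list"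
  let ?A = "{w :: (nat \<times> 'k) list. (\<forall>x\<in>set w. snd x = 1) \<and> wt w = i - r}"
  let ?B = "\<lambda>w. of_nat ((r + length w - 1) choose length w) * ((-1) ^ length w * (\<Prod>x\<leftarrow>w. hc (fst x)) * coef (lprod w) t) :: 'r"
  have "slice (cop_rest (Suc i, c)) [(Suc r, c)] = (\<lambda>q. \<Sum>w\<in>?A.
     of_nat ((r + length w - 1) choose length w) * bracket (up w) q)"
  proof
    fix q
    have "slice (cop_rest (Suc i, c)) [(Suc r, c)] q = (\<Sum>r'\<le>i. if r' = r then
        (\<Sum>w\<in>?A. of_nat ((r + length w - 1) choose length w) * bracket (up w) q) else 0)"
      unfolding cop_rest_slice by (intro sum.cong refl) (simp add: basis_def)
    then show "slice (cop_rest (Suc i, c)) [(Suc r, c)] q = (\<Sum>w\<in>?A.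
        of_nat ((r + length w - 1) choose length w) * bracket (up w) q)" using assms by simp
  qed
  then have "coef (emb (slice (cop_rest (Suc i, c)) [(Suc r, c)])) t = coef (\<Sum>w\<in>?A.
      scal (of_nat ((r + length w - 1) choose length w)) (emb (bracket (up w)))) t"
    by (simp only: emb_sum emb_cmult hom_of_nat)
  also have "\<dots> = (\<Sum>w\<in>?A. ?B w)"
    unfolding coef_sum by (intro sum.cong refl) (simp add: emb_bracket)
  also have "\<dots> = coef (graded_part (i - r) (Js 1 ^ r)) t"
  proof (cases "wt t = i - r")
    case False
    then have "coef (lprod w) t = 0" if "w \<in> ?A" for w
      using wser_homogeneous[of "lprod w" "wt w" t] theta_lprod that by auto
    then show ?thesis using False by simp
  next
    case True
    have "coef (Js r) t = (\<Sum>m\<le>i - r. \<Sum>w | (\<forall>x\<in>set w. snd x = 1) \<and> wt w = i - r \<and> length w = m. ?B w)"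
      unfolding Js_def coef_wser coef_Ys_power_sum[OF True] sum_distrib_left True
      by (intro sum.cong refl) auto
    also have "\<dots> = (\<Sum>m\<le>i - r. sum ?B {w \<in> ?A. length w = m})"
      by (intro sum.cong) auto
    also have "\<dots> = (\<Sum>w\<in>?A. ?B w)"
      by (rule sum.group) (auto simp: finite_ones_wt intro: length_le_wt[THEN order_trans])
    finally show ?thesis using True unfolding Js_power[of r] by simp
  qed
  finally show "coef (emb (slice (cop_rest (Suc i, c)) [(Suc r, c)])) t = coef (graded_part (i - r) (Js 1 ^ r)) t" .
qed

end

definition pvec2 :: "('k::zero) vec2 \<Rightarrow> bool" where
  "pvec2 T \<longleftrightarrow> finite (supp T) \<and> (\<forall>(p, q)\<in>supp T. pword p \<and> pword q)"

lemma pvec2D: "pvec2 T \<Longrightarrow> T (p, q) \<noteq> 0 \<Longrightarrow> pword p \<and> pword q" "pvec2 T \<Longrightarrow> finite (supp T)"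
  by (auto simp: pvec2_def)

lemma pvec2_mono:
  assumes "finite A" "\<And>p q. T (p, q) \<noteq> 0 \<Longrightarrow> (p, q) \<in> A \<and> pword p \<and> pword q"
  shows "pvec2 T"
  unfolding pvec2_def using assms(2) by (auto intro: finite_subset[OF _ assms(1)])

context fq_embedding
begin

lemma slice_sum:
  assumes "finite (supp T)"
  shows "(\<Sum>ab\<in>supp T. T ab * (if fst ab = p then F (snd ab) else 0)) = (\<Sum>b\<in>supp (slice T p). slice T p b * F b)"
proof -
  have "(\<Sum>ab\<in>supp T. T ab * (if fst ab = p then F (snd ab) else 0))
      = (\<Sum>ab\<in>Pair p ` supp (slice T p). T ab * F (snd ab))"
    by (rule sum.mono_neutral_cong_right) (use assms in \<open>auto simp: slice_def image_iff\<close>)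
  also have "\<dots> = (\<Sum>b\<in>supp (slice T p). slice T p b * F b)"
    by (subst sum.reindex) (auto simp: inj_on_def slice_def)
  finally show ?thesis .
qed

lemma pvec_slice: "pvec2 T \<Longrightarrow> pvec (slice T p)"
  by (rule pvec_mono[of "snd ` supp T"]) (auto simp: slice_def pvec2D image_iff, force dest: pvec2D(1))

lemma cop_rest_nonzero:
  assumes "cop_rest (Suc i, c :: 'k) (p, q) \<noteq> 0"
  shows "\<exists>r\<le>i. p = [(Suc r, c)]"
proof (rule ccontr)
  assume "\<not> ?thesis"
  then have "p \<noteq> [(Suc r, c)] \<or> i < r" for r by (cases "r \<le> i") auto
  from cop_rest_eq_0[OF this] show False using assms by (simp add: slice_def)
qed

lemma pvec2_cop_rest: "pvec2 (cop_rest (Suc i, c :: 'k))"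
proof (rule pvec2_mono)
  let ?A = "\<Union>r\<in>{..i}. Pair [(Suc r, c)] ` supp (slice (cop_rest (Suc i, c)) [(Suc r, c)])"
  show "finite ?A" using pvec_cop_rest by (auto simp: pvec_def)
  fix p q assume nz: "cop_rest (Suc i, c) (p, q) \<noteq> 0"
  then obtain r where r: "p = [(Suc r, c)]" "r \<le> i"
    using cop_rest_nonzero by blast
  moreover have "pword q" using pvec_cop_rest[of i c p] nz by (auto simp: pvec_def slice_def)
  ultimately show "(p, q) \<in> ?A \<and> pword p \<and> pword q" using nz by (auto simp: slice_def image_iff)
qed

lemma pvec2_combine:
  fixes T1 T2 :: "'k vec2"
  assumes "pvec2 T1" "pvec2 T2"
  shows "pvec2 (combine T1 T2)"
proof (rule pvec2_mono)
  let ?A = "\<Union>ab\<in>supp T1. \<Union>cd\<in>supp T2. Pair (fst ab @ fst cd) ` supp (shw (snd ab) (snd cd) :: 'k vec)"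
  have sh: "pvec (shw (snd ab) (snd cd) :: 'k vec)" if "ab \<in> supp T1" "cd \<in> supp T2" for ab cd
    using pvec2D(1)[OF assms(1), of "fst ab" "snd ab"] pvec2D(1)[OF assms(2), of "fst cd" "snd cd"] that
    by (intro pvec_shw) auto
  then show "finite ?A" using assms by (auto simp: pvec2_def pvec_def)
  fix p q assume "combine T1 T2 (p, q) \<noteq> 0"
  then have "(\<Sum>ab\<in>supp T1. \<Sum>cd\<in>supp T2.
      T1 ab * T2 cd * (if p = fst ab @ fst cd then shw (snd ab) (snd cd) q else 0)) \<noteq> 0"
    by (simp only: combine_def prod.case) simp
  then obtain ab where ab: "ab \<in> supp T1" and
    "(\<Sum>cd\<in>supp T2. T1 ab * T2 cd * (if p = fst ab @ fst cd then shw (snd ab) (snd cd) q else 0)) \<noteq> 0"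
    by (rule sum.not_neutral_contains_not_neutral)
  from this(2) obtain cd where cd: "cd \<in> supp T2" and
    nz: "T1 ab * T2 cd * (if p = fst ab @ fst cd then shw (snd ab) (snd cd) q else 0) \<noteq> 0"
    by (rule sum.not_neutral_contains_not_neutral)
  have pq: "p = fst ab @ fst cd" "shw (snd ab) (snd cd) q \<noteq> (0 :: 'k)"
    using nz by (auto split: if_splits)
  have "pword p" "pword q"
    using pvec2D(1)[OF assms(1), of "fst ab" "snd ab"] pvec2D(1)[OF assms(2), of "fst cd" "snd cd"] ab cd
      sh[OF ab cd] pq by (auto simp: pvec_def)
  moreover have "(p, q) \<in> ?A"
    using ab cd pq by (intro UN_I[OF ab] UN_I[OF cd]) simp
  ultimately show "(p, q) \<in> ?A \<and> pword p \<and> pword q" by simp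
qed

text \<open>The left factors of \<open>T1\<close> are single letters, so \<open>y # p\<close> splits
  as a concatenation in one way only.\<close>

lemma combine_slice_Cons:
  assumes "finite (supp T1)" "finite (supp T2)" "\<And>a b. T1 (a, b) \<noteq> 0 \<Longrightarrow> length a = 1"
  shows "slice (combine T1 T2) (y # p) = shuffle (slice T1 [y]) (slice T2 p)"
proof
  fix q
  have inner: "(\<Sum>cd\<in>supp T2. T2 cd * (if fst cd = p then shw v (snd cd) q else 0))
      = (\<Sum>d\<in>supp (slice T2 p). slice T2 p d * shw v d q)" for v
    by (rule slice_sum[OF assms(2), of p "\<lambda>d. shw v d q"])
  have "slice (combine T1 T2) (y # p) q = (\<Sum>ab\<in>supp T1. \<Sum>cd\<in>supp T2.
       T1 ab * T2 cd * (if y # p = fst ab @ fst cd then shw (snd ab) (snd cd) q else 0))"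
    by (simp add: slice_def combine_def)
  also have "\<dots> = (\<Sum>ab\<in>supp T1. T1 ab * (if fst ab = [y] then
       (\<Sum>cd\<in>supp T2. T2 cd * (if fst cd = p then shw (snd ab) (snd cd) q else 0)) else 0))"
  proof (rule sum.cong[OF refl])
    fix ab assume "ab \<in> supp T1"
    then have "length (fst ab) = 1" using assms(3)[of "fst ab" "snd ab"] by simp
    then obtain z where z: "fst ab = [z]" by (auto simp: length_Suc_conv)
    show "(\<Sum>cd\<in>supp T2. T1 ab * T2 cd * (if y # p = fst ab @ fst cd then shw (snd ab) (snd cd) q else 0))
      = T1 ab * (if fst ab = [y] then
       (\<Sum>cd\<in>supp T2. T2 cd * (if fst cd = p then shw (snd ab) (snd cd) q else 0)) else 0)"
      by (auto simp: z sum_distrib_left mult.assoc intro!: sum.cong sum.neutral)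
  qed
  also have "\<dots> = (\<Sum>b\<in>supp (slice T1 [y]). slice T1 [y] b * (\<Sum>d\<in>supp (slice T2 p). slice T2 p d * shw b d q))"
    unfolding inner using slice_sum[OF assms(1), of "[y]" "\<lambda>b. \<Sum>d\<in>supp (slice T2 p). slice T2 p d * shw b d q"] .
  also have "\<dots> = shuffle (slice T1 [y]) (slice T2 p) q"
    by (simp add: shuffle_def sum_distrib_left mult.assoc)
  finally show "slice (combine T1 T2) (y # p) q = shuffle (slice T1 [y]) (slice T2 p) q" .
qed

lemma shuffle_basis_Nil:
  assumes "finite (supp f)"
  shows "shuffle f (basis []) = (f :: 'k vec)"
proof
  fix w
  have s: "supp (basis [] :: 'k vec) = {[]}" by (auto simp: basis_def split: if_splits)
  have "shw u [] = (basis u :: 'k vec)" for u by (cases u) (simp_all add: shw_def)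
  then have "shuffle f (basis []) w = (\<Sum>u\<in>supp f. if w = u then f u else 0)"
    unfolding shuffle_def s by (intro sum.cong refl) (simp add: basis_def)
  then show "shuffle f (basis []) w = f w" using assms by simp
qed

lemma cop_rest_length: "cop_rest (Suc i, c :: 'k) (a, b) \<noteq> 0 \<Longrightarrow> length a = 1"
  using cop_rest_nonzero by fastforce

text \<open>Treats the last two equations of \<open>coprod\<close> alike: the empty word has
  coproduct 1 tensor 1, and shuffling with 1 changes nothing.\<close>

lemma coprod_slice:
  "slice (coprod ((Suc i, c) # v)) [] = basis ((Suc i, c) # v)"
  "pvec2 (coprod v) \<Longrightarrow> slice (coprod ((Suc i, c) # v)) (y # p) = shuffle (slice (cop_rest (Suc i, c)) [y]) (slice (coprod v) p)"
proof -
  have 0: "cop_rest (Suc i, c) ([], q) = 0" for q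
    using cop_rest_length[of i c "[]" q] by auto
  show "slice (coprod ((Suc i, c) # v)) [] = basis ((Suc i, c) # v)"
  proof (cases v)
    case (Cons z v')
    have "combine (cop_rest (Suc i, c)) (coprod (z # v')) ([], q) = 0" for q
      unfolding combine_def using cop_rest_length[of i c]
      by (auto intro!: sum.neutral dest: 0[THEN notE[rotated]] simp: 0)
    then show ?thesis by (auto simp: Cons slice_def basis_def)
  qed (auto simp: slice_def basis_def 0)
  assume v: "pvec2 (coprod v)"
  show "slice (coprod ((Suc i, c) # v)) (y # p) = shuffle (slice (cop_rest (Suc i, c)) [y]) (slice (coprod v) p)"
  proof (cases v)
    case Nil
    show ?thesis
    proof (cases "p = []")
      case True
      have "slice (basis ([], [])) [] = (basis [] :: 'k vec)" by (auto simp: slice_def basis_def)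
      moreover have "finite (supp (slice (cop_rest (Suc i, c)) [y]))"
        using pvec_cop_rest by (auto simp: pvec_def)
      ultimately show ?thesis
        using True by (simp add: Nil shuffle_basis_Nil) (simp add: slice_def basis_def)
    next
      case False
      have "cop_rest (Suc i, c) (y # p, q) = 0" for q
        using cop_rest_length[of i c "y # p" q] False by auto
      then show ?thesis using False by (auto simp: Nil slice_def shuffle_def basis_def supp_def)
    qed
  next
    case (Cons z v')
    have "slice (coprod ((Suc i, c) # v)) (y # p) = slice (combine (cop_rest (Suc i, c)) (coprod v)) (y # p)"
      by (simp add: Cons slice_def basis_def)
    also have "\<dots> = shuffle (slice (cop_rest (Suc i, c)) [y]) (slice (coprod v) p)"
      by (rule combine_slice_Cons[OF pvec2D(2)[OF pvec2_cop_rest] pvec2D(2)[OF v] cop_rest_length])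
    finally show ?thesis .
  qed
qed

lemma cop_at_Cons_bas:
  "cop_at ((r, c') # p) (bas ((i, c) # s) :: ('k, 'r) wser)
    = (if c' = c \<and> r \<le> i then graded_part (i - r) (Js 1 ^ r) * cop_at p (bas s) else 0)"
proof (rule wser_eqI)
  fix q
  let ?h = "if c' = c \<and> r \<le> i then coef (graded_part (i - r) (Js 1 ^ r) * cop_at p (bas s) :: ('k, 'r) wser) q else 0"
  have "coef (cop_at ((r, c') # p) (bas ((i, c) # s) :: ('k, 'r) wser)) q
      = (\<Sum>k\<le>wt q. if k = i - r then ?h else 0)"
    unfolding cop_at.simps coef_wser by (rule sum.cong[OF refl]) auto
  also have "\<dots> = (if i - r \<le> wt q then ?h else 0)" by simp
  also have "\<dots> = ?h"
  proof (cases "i - r \<le> wt q")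
    case False
    \<comment> \<open>The cutoff at \<open>wt q\<close> loses nothing, since a factor of weight
      \<open>i - r\<close> cannot contribute to a lighter word.\<close>
    have "coef (graded_part (i - r) (Js 1 ^ r) * cop_at p (bas s) :: ('k, 'r) wser) q = 0"
      by (rule coef_mult_order[of "i - r" _ 0]) (use False in auto)
    then show ?thesis by simp
  qed simp
  finally show "coef (cop_at ((r, c') # p) (bas ((i, c) # s) :: ('k, 'r) wser)) q
      = coef (if c' = c \<and> r \<le> i then graded_part (i - r) (Js 1 ^ r) * cop_at p (bas s) else 0) q" by simp
qed

lemma emb_coprod:
  "pvec2 (coprod (up s :: 'k word)) \<and> (\<forall>p. emb (slice (coprod (up s)) (up p)) = cop_at p (bas s))"
proof (induction s)
  case Nil
  have "emb (slice (coprod []) (up p)) = cop_at p (bas [])" for p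
  proof (cases p)
    case Nil
    have "slice (coprod []) [] = (basis [] :: 'k vec)" by (auto simp: slice_def basis_def)
    then show ?thesis using Nil emb_basis[of "[] :: (nat \<times> 'k) list"] by simp
  next
    case (Cons x p')
    have "coef (cop (1 :: ('k, 'r) wser)) p = coef 1 p" by (simp only: cop_1)
    then have "cop_at p (bas []) = (0 :: ('k, 'r) wser)"
      using Cons by (simp add: bas_Nil coef_one del: cop_at.simps cop_1)
    then show ?thesis by (intro wser_eqI) (simp add: Cons slice_def basis_def)
  qed
  moreover have "pvec2 (coprod [] :: 'k vec2)"
    by (rule pvec2_mono[of "{([], [])}"]) (auto simp: basis_def split: if_splits)
  ultimately show ?case by simp
next
  case (Cons x s)
  obtain i c where x: "x = (i, c)" by force
  let ?x = "(Suc i, c)"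
  have v: "pvec2 (coprod (up s))" using Cons by simp
  have "pvec2 (coprod (?x # up s))"
  proof (rule pvec2_mono)
    let ?C = "combine (cop_rest ?x) (coprod (up s))"
    let ?A = "insert ([], ?x # up s) (supp (cop_rest ?x) \<union> supp ?C)"
    show "finite ?A"
      using pvec2_cop_rest pvec2_combine[OF pvec2_cop_rest v] by (simp add: pvec2_def)
    fix p q assume "coprod (?x # up s) (p, q) \<noteq> 0"
    then have "(p, q) = ([], ?x # up s) \<or> cop_rest ?x (p, q) \<noteq> 0 \<or> ?C (p, q) \<noteq> 0"
      by (cases "up s") (auto simp: basis_def split: if_splits)
    then show "(p, q) \<in> ?A \<and> pword p \<and> pword q"
      using pvec2D(1)[OF pvec2_cop_rest] pvec2D(1)[OF pvec2_combine[OF pvec2_cop_rest v]] by auto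
  qed
  moreover have "emb (slice (coprod (up (x # s))) (up p)) = cop_at p (bas (x # s))" for p
  proof (cases p)
    case Nil
    then show ?thesis using emb_basis[of "x # s"] by (simp add: x coprod_slice(1))
  next
    case (Cons y p')
    obtain r c' where y: "y = (r, c')" by force
    have "emb (slice (coprod (up (x # s))) (up p))
        = emb (slice (cop_rest ?x) [(Suc r, c')]) * cop_at p' (bas s)"
      using \<open>_ \<and> _\<close> by (simp add: Cons x y coprod_slice(2)[OF v] emb_shuffle pvec_cop_rest pvec_slice[OF v])
    also have "emb (slice (cop_rest ?x) [(Suc r, c')]) = (if c' = c \<and> r \<le> i then graded_part (i - r) (Js 1 ^ r) else 0)"
    proof (cases "c' = c \<and> r \<le> i")
      case False
      then have "slice (cop_rest ?x) [(Suc r, c')] q = 0" for q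
        by (intro cop_rest_eq_0) auto
      then show ?thesis using False by (auto intro!: wser_eqI)
    qed (simp add: emb_cop_rest)
    finally show ?thesis unfolding Cons x y cop_at_Cons_bas by simp
  qed
  ultimately show ?case by (simp add: x)
qed

lemma hom_coprod: "\<iota> (coprod (up s) (up p, up q)) = coef (cop_at p (bas s)) q"
  using emb_coprod[of s] coef_emb[of "slice (coprod (up s)) (up p)" q] by (simp add: slice_def)

end

section \<open>Evaluation points: the Laurent series over \<open>F_q\<close>, an infinite
  field\<close>

instantiation fls :: ("{field,finite}") fq_algebra
begin
definition "Fq = range (fls_const :: 'a \<Rightarrow> 'a fls)"
definition "Lf = (UNIV :: 'a fls set)"
instance
proof
  show "finite (Fq :: 'a fls set)" unfolding Fq_fls_def by (rule finite_imageI) (rule finite)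
  have i: "inj (\<lambda>n. fls_X ^ n :: 'a fls)"
  proof (rule injI)
    fix m n assume "fls_X ^ m = (fls_X ^ n :: 'a fls)"
    then have "fls_nth (fls_X ^ m :: 'a fls) (int m) = fls_nth (fls_X ^ n :: 'a fls) (int m)" by simp
    then show "m = n" by (simp add: fls_X_power_nth split: if_splits)
  qed
  have "infinite (range (\<lambda>n. fls_X ^ n :: 'a fls))" by (rule range_inj_infinite[OF i])
  then show "infinite (Lf :: 'a fls set)"
    unfolding Lf_fls_def by (rule infinite_super[OF subset_UNIV])
  show "Fq \<subseteq> (Lf :: 'a fls set)" by (simp add: Lf_fls_def)
  have "\<exists>y. x * y = 1" if "x \<noteq> 0" for x :: "'a fls" using right_inverse[OF that] by blast
  then show "subfield_set (Lf :: 'a fls set)"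
    unfolding subfield_set_def Lf_fls_def by simp
  show "subfield_set (Fq :: 'a fls set)"
    unfolding subfield_set_def Fq_fls_def
  proof (intro conjI ballI impI)
    show "1 \<in> range (fls_const :: 'a \<Rightarrow> 'a fls)" by (rule range_eqI[of _ _ 1]) simp
    fix x :: "'a fls" assume "x \<in> range fls_const"
    then obtain a where a: "x = fls_const a" by blast
    show "x - y \<in> range fls_const" if "y \<in> range fls_const" for y
      using that by (auto simp: a fls_minus_const)
    show "x * y \<in> range fls_const" if "y \<in> range fls_const" for y
      using that by (auto simp: a fls_const_mult_const)
    show "\<exists>y\<in>range fls_const. x * y = 1" if "x \<noteq> 0"
    proof
      show "x * fls_const (inverse a) = 1" using that a by (auto simp: fls_const_mult_const)
    qed simp
  qed
qed
end

theorem theorem6p8: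
  fixes u :: "('k::{field,finite}) word"
  assumes "valid_word u"
  shows "id_cop (coprod u) = cop_id (coprod u)"
proof -
  interpret A: fq_embedding "fls_const :: 'k \<Rightarrow> 'k fls"
    by standard (simp_all add: fls_plus_const fls_const_mult_const Fq_fls_def)
  \<comment> \<open>Needed for the outer \<open>cop\<close> in \<open>cop (cop f)\<close>, whose
    coefficients are themselves series.\<close>
  interpret B: fq_embedding "\<lambda>x :: 'k. cst (fls_const x) :: ('k, 'k fls) wser"
    by standard (simp_all only: A.hom_add A.hom_mult A.hom_1 cst_hom(1,3,6) Fq_wser_def Fq_fls_def image_image)
  define s where "s = dn u"
  have u: "u = up s" using assms by (simp add: s_def valid_word_def pword_def)
  define T where "T = coprod u"
  have T: "pvec2 T" "A.emb (A.slice T (up p)) = cop_at p (bas s)" for p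
    using A.emb_coprod[of s] by (simp_all add: T_def u)
  have pcop: "pvec2 (coprod w)" if "pword w" for w :: "'k word"
    using A.emb_coprod[of "dn w"] that by simp
  have id_eq: "id_cop T (a, c, d) = (\<Sum>b\<in>supp (A.slice T a). A.slice T a b * coprod b (c, d))" for a c d
    unfolding id_cop_def using A.slice_sum[OF pvec2D(2)[OF T(1)], of a "\<lambda>b. coprod b (c, d)"] by simp
  \<comment> \<open>The terms added by summing over all left words of the support are zero, and the
    index set no longer depends on \<open>b\<close>.\<close>
  have cop_eq: "cop_id T (c, d, b) = (\<Sum>a\<in>fst ` supp T. T (a, b) * coprod a (c, d))" for c d b
  proof -
    have "cop_id T (c, d, b) = (\<Sum>ab\<in>(\<lambda>a. (a, b)) ` fst ` supp T. T ab * coprod (fst ab) (c, d))"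
      unfolding cop_id_def prod.case
      by (rule sum.mono_neutral_cong) (use pvec2D(2)[OF T(1)] in \<open>force simp: image_iff\<close>)+
    then show ?thesis by (subst (asm) sum.reindex) (auto simp: inj_on_def)
  qed
  show ?thesis unfolding T_def[symmetric]
  proof (rule ext, clarify)
    fix a b c :: "'k word"
    show "id_cop T (a, b, c) = cop_id T (a, b, c)"
    proof (cases "pword a \<and> pword b \<and> pword c")
      \<comment> \<open>Words with a letter of weight 0 lie outside the range of \<open>up\<close>.
        They do not occur in the coproduct of a word with positive weights, so both sides
        vanish.\<close>
      case False
      have z: "coprod w (p, q) = 0" if "pword w" "\<not> (pword p \<and> pword q)" for w p q :: "'k word"
        using pvec2D(1)[OF pcop[OF that(1)]] that(2) by blast
      have "id_cop T (a, b, c) = 0"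
        unfolding id_eq using False z pvec2D(1)[OF T(1)]
        by (auto intro!: sum.neutral simp: A.slice_def)
      moreover have "cop_id T (a, b, c) = 0"
        unfolding cop_eq using False z pvec2D(1)[OF T(1)] by (fastforce intro!: sum.neutral)
      ultimately show ?thesis by simp
    next
      case True
      define x y w where xyw: "x = dn a" "y = dn b" "w = dn c"
      have abc: "a = up x" "b = up y" "c = up w" using True by (simp_all add: xyw)
      have "fls_const (id_cop T (a, b, c))
          = (\<Sum>v\<in>supp (A.slice T a). fls_const (A.slice T a v) * coef (cop_at y (bas (dn v))) w)"
        unfolding id_eq A.hom_sum A.hom_mult
      proof (intro sum.cong refl arg_cong2[of _ _ _ _ "(*)"])
        fix v assume "v \<in> supp (A.slice T a)"
        then have "pword v" using pvec2D(1)[OF T(1)] by (auto simp: A.slice_def)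
        then show "fls_const (coprod v (b, c)) = coef (cop_at y (bas (dn v))) w"
          using A.hom_coprod[of "dn v" y w] by (simp add: abc)
      qed
      also have "\<dots> = coef (coef (cop (A.emb (A.slice T a))) y) w"
        unfolding A.emb_eq_sum[OF A.pvec_slice[OF T(1)]] cop_sum
        by (simp add: coef_sum cop_at_scal)
      also have "\<dots> = coef (coef (coef (map_cop (cop (bas s))) x) y) w"
        by (simp add: abc T(2))
      also have "\<dots> = coef (coef (coef (cop (cop (bas s))) x) y) w"
        by (simp only: cop_coassoc)
      \<comment> \<open>Expansion over the finitely many left words, with the right factors as
        coefficients. The outer \<open>cop\<close> is linear over these and so acts on the left
        words alone.\<close>
      also have "cop (bas s) = (\<Sum>v\<in>fst ` supp T. scal (A.emb (A.slice T v)) (bas (dn v)))"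
      proof (rule wser_eqI)
        fix p
        have "coef (\<Sum>v\<in>fst ` supp T. scal (A.emb (A.slice T v)) (bas (dn v))) p
            = (\<Sum>v\<in>fst ` supp T. if v = up p then A.emb (A.slice T (up p)) else 0)"
          unfolding coef_sum
        proof (rule sum.cong[OF refl])
          fix v assume "v \<in> fst ` supp T"
          then have "pword v" using pvec2D(1)[OF T(1)] by auto
          then show "coef (scal (A.emb (A.slice T v)) (bas (dn v))) p = (if v = up p then A.emb (A.slice T (up p)) else 0)"
            by auto
        qed
        also have "\<dots> = A.emb (A.slice T (up p))"
        proof (cases "up p \<in> fst ` supp T")
          case False
          then have "A.slice T (up p) q = 0" for q by (force simp: A.slice_def)
          then have "A.emb (A.slice T (up p)) = 0" by (intro wser_eqI) simp
          then show ?thesis by (simp only: if_cancel sum.neutral_const)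
        qed (simp add: pvec2D(2)[OF T(1)])
        finally show "coef (cop (bas s)) p = coef (\<Sum>v\<in>fst ` supp T. scal (A.emb (A.slice T v)) (bas (dn v))) p"
          by (simp add: T(2))
      qed
      also have "coef (coef (coef (cop (\<Sum>v\<in>fst ` supp T. scal (A.emb (A.slice T v)) (bas (dn v)))) x) y) w
          = (\<Sum>v\<in>fst ` supp T. fls_const (T (v, c) * coprod v (a, b)))"
        unfolding cop_sum coef_sum
      proof (rule sum.cong[OF refl])
        fix v assume "v \<in> fst ` supp T"
        then have "pword v" using pvec2D(1)[OF T(1)] by auto
        then have "coef (cop_at x (bas (dn v))) y = (cst (fls_const (coprod v (a, b))) :: ('k, 'k fls) wser)"
          using B.hom_coprod[of "dn v" x y] by (simp add: abc)
        then show "coef (coef (coef (cop (scal (A.emb (A.slice T v)) (bas (dn v)))) x) y) w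
            = fls_const (T (v, c) * coprod v (a, b))"
          by (simp only: coef_cop cop_at_scal coef_simps(2) cst_mult(2) A.coef_emb A.slice_def A.hom_mult
              abc(3) mult.commute)
      qed
      also have "\<dots> = fls_const (cop_id T (a, b, c))"
        unfolding cop_eq A.hom_sum ..
      finally show ?thesis by (simp add: A.hom_inj)
    qed
  qed
qed

end
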